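(* Let $u_1,\dots,u_g$ be functions of $t=(t_1=x,\dots,t_g)$ on a simply connected neighbourhood of $t=0$, whose generating function $\mathbf u(\xi)=\sum_{i=1}^gu_i\xi^i$ satisfies $$\mathbf u'''(\xi)+2u_1'(2-\mathbf u(\xi))-4(\xi^{-1}+u_1)\mathbf u'(\xi)=0,$$ $$\partial_k\mathbf u(\xi)=D_k(2-\mathbf u(\xi))\,\mathbf u'(\xi)-D_k(\mathbf u'(\xi))\,(2-\mathbf u(\xi)),\quad 1\le k\le g.$$ Let $p_{ij}(t)$, $1\le i,j\le g$, be the coefficients of the basic generating function $P(\xi,\eta)=\sum_{i,j=1}^gp_{ij}\xi^i\eta^j$ defined in the context. Then there is a unique special solution $w$ of the problem $$2\partial_x^2\log w=-u_1,\qquad w(0)=1,\quad \partial_kw(0)=0\ (k=1,\dots,g),$$ such that $$2\,\partial_i\partial_j\log w=-p_{ij}\qquad\text{for all }1\le i,j\le g.$$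
   Context: Prime denotes $\partial_x=\partial/\partial t_1$; $\partial_i=\partial/\partial t_i$ for $1\le i\le g$, $\partial_{g+1}:=0$. For a polynomial $f(\xi)=\sum_{j\ge0}f_j\xi^j$, $(D_kf)(\xi)=\frac12\sum_{j=0}^{k-1}f_j\xi^{j-k+1}$. Derivatives of $\mathbf u(\xi)$ are taken coefficientwise. Under the displayed equations the quantities $\mu_1,\dots,\mu_{2g}$ defined by $4\bigl(4\xi^{-1}+\sum_{i=1}^{2g}\mu_i\xi^i\bigr)=\mathbf u'(\xi)^2+2\mathbf u''(\xi)(2-\mathbf u(\xi))+4(\xi^{-1}+u_1)(2-\mathbf u(\xi))^2$ are constants. Put $$\mu(\xi,\eta)=4\xi^{-1}+4\eta^{-1}+2\sum_{i=1}^g\mu_{2i}\xi^i\eta^i+\sum_{i=0}^{g-1}\mu_{2i+1}(\xi+\eta)\xi^i\eta^i,$$ $$Q(\xi,\eta)=\mathbf u'(\xi)\mathbf u'(\eta)+(2-\mathbf u(\xi))\mathbf u''(\eta)+\mathbf u''(\xi)(2-\mathbf u(\eta))+2(2-\mathbf u(\xi))(2-\mathbf u(\eta))(\xi^{-1}+\eta^{-1}+2u_1),$$ $$P(\xi,\eta)=\frac{\xi^2\eta^2}{4(\xi-\eta)^2}\bigl(2\mu(\xi,\eta)-Q(\xi,\eta)\bigr),$$ which is a polynomial in $\xi,\eta$ of the form $\sum_{i,j=1}^gp_{ij}\xi^i\eta^j$. A solution $w$ (a differentiable, nonvanishing function near $0$) of $2\partial_x^2\log w=-u_1$, $w(0)=1$,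 $\partial_kw(0)=0$ is called special if the functions $-2\partial_x\partial_k\log w$, $k=1,\dots,g$, have the property that the operators built from them, $\mathcal L=\partial_x^2-u_1$ and $\mathcal U_i=\partial_x^2\partial_i-\frac12(u_1\partial_i+\partial_iu_1)-\frac14(u_i\partial_x+\partial_xu_i)-\partial_{i+1}$ ($1\le i\le g$; with $u_k=-2\partial_x\partial_k\log w$, functions acting by multiplication, products being compositions), commute pairwise, and that their generating function satisfies the displayed formula for $4(4\xi^{-1}+\sum\mu_i\xi^i)$ with some constants $\mu_i$. *)

theory Defs
  imports "HOL-Analysis.Analysis" "HOL-Computational_Algebra.Polynomial"
begin

text \<open>
  Throughout, \<open>g = CARD('n)\<close>, the variable \<open>t\<close> ranges over \<open>'k^'n\<close>, and \<open>e\<close> enumerates the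
  coordinates, i.e. \<open>t\<^sub>i = t $ e i\<close> for \<open>1 \<le> i \<le> g\<close>. The sort
  \<open>{real_normed_field, euclidean_space}\<close> of \<open>'k\<close> has both \<open>real\<close> and \<open>complex\<close> as instances.
  A family \<open>u\<^sub>1, \<dots>, u\<^sub>g\<close> is a function on \<open>nat\<close>, only its values on \<open>{1..g}\<close> being relevant.
\<close>

subsection \<open>Differentiation in several variables over the field\<close>

definition partial :: "'n \<Rightarrow> ('k::real_normed_field ^ 'n \<Rightarrow> 'k) \<Rightarrow> 'k ^ 'n \<Rightarrow> 'k" where
  "partial i f t = deriv (\<lambda>z. f (t + axis i z)) 0"

text \<open>The derivative has to be linear over \<open>'k\<close>: holomorphy if \<open>'k\<close> is \<open>complex\<close>.\<close>

definition field_differentiable_on :: "('k::real_normed_field ^ 'n \<Rightarrow> 'k) \<Rightarrow> ('k ^ 'n) set \<Rightarrow> bool" where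
  "field_differentiable_on f S \<longleftrightarrow>
     (\<forall>t\<in>S. \<exists>c :: 'k ^ 'n. (f has_derivative (\<lambda>h. \<Sum>i\<in>UNIV. c $ i * h $ i)) (at t))"

definition twice_differentiable_on :: "('k::real_normed_field ^ 'n \<Rightarrow> 'k) \<Rightarrow> ('k ^ 'n) set \<Rightarrow> bool" where
  "twice_differentiable_on f S \<longleftrightarrow>
     field_differentiable_on f S \<and> (\<forall>i. field_differentiable_on (partial i f) S)"

definition smooth_on :: "('k::real_normed_field ^ 'n \<Rightarrow> 'k) \<Rightarrow> ('k ^ 'n) set \<Rightarrow> bool" where
  "smooth_on f S \<longleftrightarrow> (\<forall>is. field_differentiable_on (foldr partial is f) S)"

text \<open>The operator \<open>\<partial>\<^sub>k\<close>, including the convention \<open>\<partial>\<^sub>g\<^sub>+\<^sub>1 = 0\<close>; \<open>\<partial>\<^sub>x = \<partial>\<^sub>1\<close>.\<close>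

definition pd :: "(nat \<Rightarrow> 'n) \<Rightarrow> nat \<Rightarrow> ('k::real_normed_field ^ 'n \<Rightarrow> 'k) \<Rightarrow> 'k ^ 'n \<Rightarrow> 'k" where
  "pd e k f t = (if 1 \<le> k \<and> k \<le> CARD('n) then partial (e k) f t else 0)"

text \<open>
  \<open>\<partial>\<^sub>k log w\<close> is the logarithmic derivative, so that no branch of the logarithm is involved.
\<close>

definition pd_log :: "(nat \<Rightarrow> 'n) \<Rightarrow> nat \<Rightarrow> ('k::real_normed_field ^ 'n \<Rightarrow> 'k) \<Rightarrow> 'k ^ 'n \<Rightarrow> 'k" where
  "pd_log e k w t = pd e k w t / w t"

subsection \<open>The system for the generating function\<close>

definition gen :: "(nat \<Rightarrow> 'k::real_normed_field ^ 'n \<Rightarrow> 'k) \<Rightarrow> 'k ^ 'n \<Rightarrow> 'k poly" where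
  "gen u t = (\<Sum>i = 1..CARD('n). monom (u i t) i)"

definition dx :: "(nat \<Rightarrow> 'n) \<Rightarrow> (nat \<Rightarrow> 'k::real_normed_field ^ 'n \<Rightarrow> 'k) \<Rightarrow> nat \<Rightarrow> 'k ^ 'n \<Rightarrow> 'k" where
  "dx e u i = pd e 1 (u i)"

definition D_op :: "nat \<Rightarrow> 'k::real_normed_field poly \<Rightarrow> 'k \<Rightarrow> 'k" where
  "D_op k f \<xi> = 1 / 2 * (\<Sum>j<k. coeff f j * \<xi> powi (int j - int k + 1))"

definition kdv_system ::
  "(nat \<Rightarrow> 'n) \<Rightarrow> (nat \<Rightarrow> 'k::real_normed_field ^ 'n \<Rightarrow> 'k) \<Rightarrow> ('k ^ 'n) set \<Rightarrow> bool" where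
  "kdv_system e u U \<longleftrightarrow>
     (\<forall>t\<in>U. \<forall>\<xi>. \<xi> \<noteq> 0 \<longrightarrow>
        poly (gen (dx e (dx e (dx e u))) t) \<xi> + 2 * dx e u 1 t * (2 - poly (gen u t) \<xi>)
          - 4 * (1 / \<xi> + u 1 t) * poly (gen (dx e u) t) \<xi> = 0) \<and>
     (\<forall>t\<in>U. \<forall>k\<in>{1..CARD('n)}. \<forall>\<xi>. \<xi> \<noteq> 0 \<longrightarrow>
        poly (gen (\<lambda>i. pd e k (u i)) t) \<xi> =
          D_op k (2 - gen u t) \<xi> * poly (gen (dx e u) t) \<xi>
          - D_op k (gen (dx e u) t) \<xi> * (2 - poly (gen u t) \<xi>))"

subsection \<open>The basic generating function\<close>

definition curve_eq ::
  "(nat \<Rightarrow> 'n) \<Rightarrow> (nat \<Rightarrow> 'k::real_normed_field ^ 'n \<Rightarrow> 'k) \<Rightarrow> 'k ^ 'n \<Rightarrow> (nat \<Rightarrow> 'k) \<Rightarrow> bool" where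
  "curve_eq e u t m \<longleftrightarrow>
     (\<forall>\<xi>. \<xi> \<noteq> 0 \<longrightarrow>
        4 * (4 / \<xi> + (\<Sum>i = 1..2 * CARD('n). m i * \<xi> ^ i)) =
          (poly (gen (dx e u) t) \<xi>)\<^sup>2
          + 2 * poly (gen (dx e (dx e u)) t) \<xi> * (2 - poly (gen u t) \<xi>)
          + 4 * (1 / \<xi> + u 1 t) * (2 - poly (gen u t) \<xi>)\<^sup>2)"

text \<open>
  The coefficients \<open>\<mu>\<^sub>i\<close> are taken pointwise in \<open>t\<close>; their independence of \<open>t\<close> is not built in.
\<close>

definition curve_mu ::
  "(nat \<Rightarrow> 'n) \<Rightarrow> (nat \<Rightarrow> 'k::real_normed_field ^ 'n \<Rightarrow> 'k) \<Rightarrow> 'k ^ 'n \<Rightarrow> nat \<Rightarrow> 'k" where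
  "curve_mu e u t = (THE m. curve_eq e u t m \<and> (\<forall>i. i \<notin> {1..2 * CARD('n)} \<longrightarrow> m i = 0))"

definition mu_gen ::
  "(nat \<Rightarrow> 'n) \<Rightarrow> (nat \<Rightarrow> 'k::real_normed_field ^ 'n \<Rightarrow> 'k) \<Rightarrow> 'k ^ 'n \<Rightarrow> 'k \<Rightarrow> 'k \<Rightarrow> 'k" where
  "mu_gen e u t \<xi> \<eta> =
     4 / \<xi> + 4 / \<eta>
     + 2 * (\<Sum>i = 1..CARD('n). curve_mu e u t (2 * i) * \<xi> ^ i * \<eta> ^ i)
     + (\<Sum>i<CARD('n). curve_mu e u t (2 * i + 1) * (\<xi> + \<eta>) * \<xi> ^ i * \<eta> ^ i)"

definition Q_gen ::
  "(nat \<Rightarrow> 'n) \<Rightarrow> (nat \<Rightarrow> 'k::real_normed_field ^ 'n \<Rightarrow> 'k) \<Rightarrow> 'k ^ 'n \<Rightarrow> 'k \<Rightarrow> 'k \<Rightarrow> 'k" where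
  "Q_gen e u t \<xi> \<eta> =
     poly (gen (dx e u) t) \<xi> * poly (gen (dx e u) t) \<eta>
     + (2 - poly (gen u t) \<xi>) * poly (gen (dx e (dx e u)) t) \<eta>
     + poly (gen (dx e (dx e u)) t) \<xi> * (2 - poly (gen u t) \<eta>)
     + 2 * (2 - poly (gen u t) \<xi>) * (2 - poly (gen u t) \<eta>) * (1 / \<xi> + 1 / \<eta> + 2 * u 1 t)"

definition P_gen ::
  "(nat \<Rightarrow> 'n) \<Rightarrow> (nat \<Rightarrow> 'k::real_normed_field ^ 'n \<Rightarrow> 'k) \<Rightarrow> 'k ^ 'n \<Rightarrow> 'k \<Rightarrow> 'k \<Rightarrow> 'k" where
  "P_gen e u t \<xi> \<eta> =
     \<xi>\<^sup>2 * \<eta>\<^sup>2 / (4 * (\<xi> - \<eta>)\<^sup>2) * (2 * mu_gen e u t \<xi> \<eta> - Q_gen e u t \<xi> \<eta>)"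

text \<open>
  \<open>P_gen\<close> is a rational expression; it is compared with its polynomial \<open>\<Sum> p\<^sub>i\<^sub>j \<xi>\<^sup>i \<eta>\<^sup>j\<close> away
  from the zeros of the denominators.
\<close>

definition p_coeff ::
  "(nat \<Rightarrow> 'n) \<Rightarrow> (nat \<Rightarrow> 'k::real_normed_field ^ 'n \<Rightarrow> 'k) \<Rightarrow> 'k ^ 'n \<Rightarrow> nat \<Rightarrow> nat \<Rightarrow> 'k" where
  "p_coeff e u t =
     (THE p. (\<forall>\<xi> \<eta>. \<xi> \<noteq> 0 \<longrightarrow> \<eta> \<noteq> 0 \<longrightarrow> \<xi> \<noteq> \<eta> \<longrightarrow>
               P_gen e u t \<xi> \<eta> = (\<Sum>i = 1..CARD('n). \<Sum>j = 1..CARD('n). p i j * \<xi> ^ i * \<eta> ^ j)) \<and>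
             (\<forall>i j. i \<notin> {1..CARD('n)} \<or> j \<notin> {1..CARD('n)} \<longrightarrow> p i j = 0))"

subsection \<open>Special solutions\<close>

definition L_op ::
  "(nat \<Rightarrow> 'n) \<Rightarrow> (nat \<Rightarrow> 'k::real_normed_field ^ 'n \<Rightarrow> 'k) \<Rightarrow> ('k ^ 'n \<Rightarrow> 'k) \<Rightarrow> 'k ^ 'n \<Rightarrow> 'k" where
  "L_op e v f = (\<lambda>t. pd e 1 (pd e 1 f) t - v 1 t * f t)"

definition U_op ::
  "(nat \<Rightarrow> 'n) \<Rightarrow> (nat \<Rightarrow> 'k::real_normed_field ^ 'n \<Rightarrow> 'k) \<Rightarrow> nat \<Rightarrow> ('k ^ 'n \<Rightarrow> 'k) \<Rightarrow> 'k ^ 'n \<Rightarrow> 'k" where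
  "U_op e v i f = (\<lambda>t.
     pd e 1 (pd e 1 (pd e i f)) t
     - 1 / 2 * (v 1 t * pd e i f t + pd e i (\<lambda>s. v 1 s * f s) t)
     - 1 / 4 * (v i t * pd e 1 f t + pd e 1 (\<lambda>s. v i s * f s) t)
     - pd e (i + 1) f t)"

definition commute_on ::
  "('k ^ 'n) set \<Rightarrow> (('k::real_normed_field ^ 'n \<Rightarrow> 'k) \<Rightarrow> 'k ^ 'n \<Rightarrow> 'k)
     \<Rightarrow> (('k ^ 'n \<Rightarrow> 'k) \<Rightarrow> 'k ^ 'n \<Rightarrow> 'k) \<Rightarrow> bool" where
  "commute_on V A B \<longleftrightarrow> (\<forall>f. smooth_on f V \<longrightarrow> (\<forall>t\<in>V. A (B f) t = B (A f) t))"

definition w_potential ::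
  "(nat \<Rightarrow> 'n) \<Rightarrow> ('k::real_normed_field ^ 'n \<Rightarrow> 'k) \<Rightarrow> nat \<Rightarrow> 'k ^ 'n \<Rightarrow> 'k" where
  "w_potential e w k t = - 2 * pd e 1 (pd_log e k w) t"

definition w_solution ::
  "(nat \<Rightarrow> 'n) \<Rightarrow> ('k::real_normed_field ^ 'n \<Rightarrow> 'k) \<Rightarrow> ('k ^ 'n) set \<Rightarrow> ('k ^ 'n \<Rightarrow> 'k) \<Rightarrow> bool" where
  "w_solution e u1 V w \<longleftrightarrow>
     twice_differentiable_on w V \<and> (\<forall>t\<in>V. w t \<noteq> 0) \<and>
     (\<forall>t\<in>V. 2 * pd e 1 (pd_log e 1 w) t = - u1 t) \<and>
     w 0 = 1 \<and> (\<forall>k\<in>{1..CARD('n)}. pd e k w 0 = 0)"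

text \<open>
  Smoothness of the potentials is what makes the compositions of the operators meaningful.
\<close>

definition special ::
  "(nat \<Rightarrow> 'n) \<Rightarrow> ('k ^ 'n) set \<Rightarrow> ('k::real_normed_field ^ 'n \<Rightarrow> 'k) \<Rightarrow> bool" where
  "special e V w \<longleftrightarrow>
     (let v = w_potential e w in
       (\<forall>k\<in>{1..CARD('n)}. smooth_on (v k) V) \<and>
       (\<forall>i\<in>{1..CARD('n)}. commute_on V (L_op e v) (U_op e v i)) \<and>
       (\<forall>i\<in>{1..CARD('n)}. \<forall>j\<in>{1..CARD('n)}. commute_on V (U_op e v i) (U_op e v j)) \<and>
       (\<exists>m. \<forall>t\<in>V. curve_eq e v t m))"

end

theory Submission imports Defs begin

text \<open>
  Put \<open>A(\<xi>) = 2 - u(\<xi>)\<close> and \<open>X\<^sub>z = \<Sum> z\<^sup>k \<partial>\<^sub>k\<close>. The equations for the \<open>\<partial>\<^sub>k\<close> telescope to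
  \<open>2 (1/z - 1/\<xi>) X\<^sub>z A(\<xi>) = A(z) A'(\<xi>) - A'(z) A(\<xi>)\<close>. Together with the third order equation this makes
  the coefficients of the curve constant, and turns \<open>X\<^sub>z P(\<xi>, \<eta>)\<close> into an expression that is symmetric
  in \<open>z, \<xi>, \<eta>\<close>, i.e. \<open>\<partial>\<^sub>k p\<^sub>i\<^sub>j = \<partial>\<^sub>i p\<^sub>k\<^sub>j\<close>. As \<open>p\<^sub>i\<^sub>j\<close> is symmetric, two applications of the Poincare
  lemma on the simply connected domain give \<open>log w\<close>. It generates the potentials \<open>u\<^sub>k\<close> because
  \<open>p\<^sub>1\<^sub>k = u\<^sub>k\<close>, and two solutions have the same logarithmic derivatives, hence are proportional.
\<close>

section \<open>Differential calculus over the field\<close>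

text \<open>The symmetric value of the generating derivation on P consists of two kinds of terms in
  1/z, 1/\<xi>, 1/\<eta>: the 3 by 3 determinant with rows (A, A', A'') at the three points over the
  alternating product of differences, and a cyclic sum of terms A' A A, each over two of the
  differences. It arises because \<mu> is constant in t, and because every term of the derivative of
  Q gains a factor 1/\<xi> - 1/\<eta>, which lowers the double pole.

  The obstacle is that the p's are defined only through a quotient by the square of \<xi> - \<eta>,
  so neither their existence nor their smoothness is evident. The division is therefore carried out
  monomial by monomial: a symmetrized monomial minus twice its polarization is an explicit multiple
  of this square, with coefficients independent of t. Each p is thus a constant linear combination
  of differential polynomials in the u's, and the division-free identity can even be evaluated at
  \<xi> = 0, which gives the first row.

  That w is special is a separate matter: each U_i is d_i L minus a first-order operator, and the
  commutators reduce to recursions for the coefficients of A.\<close>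

definition has_grad :: "('k::real_normed_field ^ 'n::finite \<Rightarrow> 'k) \<Rightarrow> ('n \<Rightarrow> 'k) \<Rightarrow> 'k ^ 'n \<Rightarrow> bool" where
  "has_grad f c t \<longleftrightarrow> (f has_derivative (\<lambda>h. \<Sum>i\<in>UNIV. c i * h $ i)) (at t)"

lemma norm_axis_le: "norm (axis i z :: 'k::real_normed_field ^ 'n::finite) \<le> norm z"
proof -
  have "norm (axis i z :: 'k ^ 'n) \<le> (\<Sum>j\<in>UNIV. norm ((axis i z :: 'k ^ 'n) $ j))"
    unfolding norm_vec_def by (rule L2_set_le_sum) simp
  also have "\<dots> = (\<Sum>j\<in>UNIV. if j = i then norm z else 0)"
    by (rule sum.cong) (auto simp: axis_def)
  finally show ?thesis by simp
qed

lemma bounded_linear_axis: "bounded_linear (axis i :: 'k::real_normed_field \<Rightarrow> 'k ^ 'n::finite)"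
proof (rule bounded_linear_intro[where K=1])
  fix x y :: 'k and r :: real
  show "(axis i (x + y) :: 'k ^ 'n) = axis i x + axis i y"
    by (simp add: axis_def vec_eq_iff)
  show "(axis i (r *\<^sub>R x) :: 'k ^ 'n) = r *\<^sub>R axis i x"
    by (simp add: axis_def vec_eq_iff)
  show "norm (axis i x :: 'k ^ 'n) \<le> norm x * 1" by (simp add: norm_axis_le)
qed

lemma sum_axis: "(\<Sum>j\<in>UNIV. c j * (axis i z :: 'k::real_normed_field ^ 'n::finite) $ j) = c i * z"
proof -
  have "(\<Sum>j\<in>UNIV. c j * (axis i z :: 'k ^ 'n) $ j) = (\<Sum>j\<in>UNIV. if j = i then c i * z else 0)"
    by (rule sum.cong) (auto simp: axis_def)
  then show ?thesis by simp
qed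

lemma has_grad_DERIV:
  assumes "has_grad f c (t + axis i z)"
  shows "((\<lambda>z. f (t + axis i z)) has_field_derivative c i) (at z)"
proof -
  have "((\<lambda>z. t + axis i z) has_derivative axis i) (at z)"
    using has_derivative_add[OF has_derivative_const bounded_linear_imp_has_derivative[OF bounded_linear_axis]]
    by simp
  from has_derivative_compose[OF this assms[unfolded has_grad_def]]
  show ?thesis
    by (simp add: sum_axis has_field_derivative_def)
qed

lemma has_grad_partial:
  assumes "has_grad f c t" shows "partial i f t = c i"
  unfolding partial_def
proof (rule DERIV_imp_deriv)
  show "((\<lambda>z. f (t + axis i z)) has_field_derivative c i) (at 0)"
    using assms by (intro has_grad_DERIV) (simp add: axis_eq_0_iff[THEN iffD2])
qed

lemma field_differentiable_on_iff:
  "field_differentiable_on f S \<longleftrightarrow> (\<forall>t\<in>S. has_grad f (\<lambda>i. partial i f t) t)"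
proof
  assume L: "field_differentiable_on f S"
  show "\<forall>t\<in>S. has_grad f (\<lambda>i. partial i f t) t"
  proof
    fix t assume "t \<in> S"
    then obtain c :: "'a ^ 'b" where c: "has_grad f (\<lambda>i. c $ i) t"
      using L unfolding field_differentiable_on_def has_grad_def by blast
    have "(\<lambda>i. partial i f t) = (\<lambda>i. c $ i)" using has_grad_partial[OF c] by blast
    then show "has_grad f (\<lambda>i. partial i f t) t" using c by simp
  qed
next
  assume R: "\<forall>t\<in>S. has_grad f (\<lambda>i. partial i f t) t"
  show "field_differentiable_on f S"
    unfolding field_differentiable_on_def
  proof
    fix t assume "t \<in> S"
    then have "(f has_derivative (\<lambda>h. \<Sum>i\<in>UNIV. (\<chi> i. partial i f t) $ i * h $ i)) (at t)"
      using R by (simp add: has_grad_def)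
    then show "\<exists>c :: 'a ^ 'b. (f has_derivative (\<lambda>h. \<Sum>i\<in>UNIV. c $ i * h $ i)) (at t)" by blast
  qed
qed

lemma has_grad_const: "has_grad (\<lambda>t. c) (\<lambda>i. 0) t"
  by (simp add: has_grad_def)

lemma has_grad_add:
  assumes "has_grad f c t" "has_grad g d t"
  shows "has_grad (\<lambda>t. f t + g t) (\<lambda>i. c i + d i) t"
  using has_derivative_add[OF assms[unfolded has_grad_def]]
  by (simp add: has_grad_def distrib_right sum.distrib)

lemma has_grad_mult:
  assumes "has_grad f c t" "has_grad g d t"
  shows "has_grad (\<lambda>t. f t * g t) (\<lambda>i. f t * d i + c i * g t) t"
  using has_derivative_mult[OF assms[unfolded has_grad_def]]
  by (simp add: has_grad_def algebra_simps sum.distrib sum_distrib_left)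

lemma has_grad_chain:
  assumes "has_grad f c t" "(g has_field_derivative d) (at (f t))"
  shows "has_grad (\<lambda>t. g (f t)) (\<lambda>i. d * c i) t"
  using has_derivative_compose[OF assms(1)[unfolded has_grad_def] assms(2)[unfolded has_field_derivative_def]]
  by (simp add: has_grad_def sum_distrib_left ac_simps)

lemma has_grad_zero_const:
  assumes "open S" "connected S" "\<And>t. t \<in> S \<Longrightarrow> has_grad f (\<lambda>i. 0) t" "x \<in> S" "y \<in> S"
  shows "f x = f y"
  by (rule has_derivative_zero_unique_connected[OF assms(1,2) _ assms(4,5)])
     (use assms(3) in \<open>simp add: has_grad_def\<close>)

lemma partial_cong:
  assumes "open S" "t \<in> S" "\<And>s. s \<in> S \<Longrightarrow> f s = g s"
  shows "partial i f t = partial i g t"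
proof -
  have "((\<lambda>z. t + axis i z) \<longlongrightarrow> t + axis i 0) (nhds (0::'a))"
    by (intro tendsto_add tendsto_const bounded_linear.tendsto[OF bounded_linear_axis] filterlim_ident)
  from topological_tendstoD[OF this \<open>open S\<close>] \<open>t \<in> S\<close>
  have "\<forall>\<^sub>F z in nhds 0. t + axis i z \<in> S"
    by (simp add: axis_eq_0_iff[THEN iffD2])
  then have "\<forall>\<^sub>F z in nhds 0. f (t + axis i z) = g (t + axis i z)"
    by eventually_elim (rule assms(3))
  then show ?thesis unfolding partial_def by (rule deriv_cong_ev) simp
qed

lemma field_differentiable_on_cong:
  assumes "open S" "\<And>s. s \<in> S \<Longrightarrow> f s = g s" "field_differentiable_on f S"
  shows "field_differentiable_on g S"
  using assms(3) unfolding field_differentiable_on_def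
  by (meson assms(1,2) has_derivative_transform_within_open)

lemma smooth_on_partial: "smooth_on f S \<Longrightarrow> smooth_on (partial i f) S"
  unfolding smooth_on_def
proof
  fix "is" assume "\<forall>is. field_differentiable_on (foldr partial is f) S"
  from this[rule_format, of "is @ [i]"]
  show "field_differentiable_on (foldr partial is (partial i f)) S" by simp
qed

lemma smooth_on_imp_has_grad: "smooth_on f S \<Longrightarrow> t \<in> S \<Longrightarrow> has_grad f (\<lambda>i. partial i f t) t"
  unfolding smooth_on_def field_differentiable_on_iff by (drule spec[of _ "[]"]) simp

text \<open>Smoothness by coinduction: the largest class of differentiable functions closed under
  partial derivatives, up to equality on the open set.\<close>

lemma smooth_on_coinduct:
  assumes "open S" "f \<in> C"
    and diff: "\<And>f. f \<in> C \<Longrightarrow> field_differentiable_on f S"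
    and part: "\<And>f i. f \<in> C \<Longrightarrow> \<exists>g\<in>C. \<forall>t\<in>S. partial i f t = g t"
  shows "smooth_on f S"
proof -
  have "\<exists>g\<in>C. \<forall>t\<in>S. foldr partial is f t = g t" for "is"
  proof (induction "is")
    case Nil
    then show ?case using \<open>f \<in> C\<close> by auto
  next
    case (Cons i "is")
    then obtain g where g: "g \<in> C" "\<forall>t\<in>S. foldr partial is f t = g t" by blast
    from part[OF g(1)] obtain h where h: "h \<in> C" "\<forall>t\<in>S. partial i g t = h t" by blast
    have "\<forall>t\<in>S. foldr partial (i # is) f t = h t"
      using partial_cong[OF \<open>open S\<close>, of _ "foldr partial is f" g i] g h by simp
    then show ?case using h by blast
  qed
  note * = this
  show ?thesis unfolding smooth_on_def
  proof
    fix "is"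
    obtain g where "g \<in> C" "\<And>t. t \<in> S \<Longrightarrow> g t = foldr partial is f t"
      using *[of "is"] by force
    then show "field_differentiable_on (foldr partial is f) S"
      using field_differentiable_on_cong[OF \<open>open S\<close>] diff by blast
  qed
qed

text \<open>By the Leibniz rule the derivatives of a product are no longer products, but they stay
  in the algebra generated by the smooth functions. This algebra is the invariant class for the
  coinduction rule.\<close>

inductive_set smooth_alg :: "('k::real_normed_field ^ 'n::finite) set \<Rightarrow> ('k ^ 'n \<Rightarrow> 'k) set" for S where
  base: "smooth_on f S \<Longrightarrow> f \<in> smooth_alg S"
| const: "(\<lambda>t. c) \<in> smooth_alg S"
| add: "f \<in> smooth_alg S \<Longrightarrow> g \<in> smooth_alg S \<Longrightarrow> (\<lambda>t. f t + g t) \<in> smooth_alg S"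
| mult: "f \<in> smooth_alg S \<Longrightarrow> g \<in> smooth_alg S \<Longrightarrow> (\<lambda>t. f t * g t) \<in> smooth_alg S"

lemma smooth_alg_grad: "f \<in> smooth_alg S \<Longrightarrow> t \<in> S \<Longrightarrow> has_grad f (\<lambda>i. partial i f t) t"
proof (induction rule: smooth_alg.induct)
  case (base f)
  then show ?case by (intro smooth_on_imp_has_grad)
next
  case (const c)
  show ?case using has_grad_const[of c t] by (simp add: has_grad_partial[OF has_grad_const])
next
  case (add f g)
  note g = has_grad_add[OF add.IH[OF add.prems]]
  show ?case using g by (simp add: has_grad_partial[OF g])
next
  case (mult f g)
  note g = has_grad_mult[OF mult.IH[OF mult.prems]]
  show ?case using g by (simp add: has_grad_partial[OF g])
qed

lemma smooth_alg_smooth: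
  assumes "open S" "f \<in> smooth_alg S"
  shows "smooth_on f S"
proof (rule smooth_on_coinduct[OF assms])
  show "field_differentiable_on f S" if "f \<in> smooth_alg S" for f
    using smooth_alg_grad[OF that] by (simp add: field_differentiable_on_iff)
  show "\<exists>g\<in>smooth_alg S. \<forall>t\<in>S. partial i f t = g t" if "f \<in> smooth_alg S" for f i
    using that
  proof (induction rule: smooth_alg.induct)
    case (base f)
    then show ?case using smooth_on_partial smooth_alg.base by blast
  next
    case (const c)
    have "partial i (\<lambda>t. c) t = 0" for t by (rule has_grad_partial[OF has_grad_const])
    then show ?case using smooth_alg.const by metis
  next
    case (add f g)
    then obtain f' g' where "f' \<in> smooth_alg S" "g' \<in> smooth_alg S"
      "\<forall>t\<in>S. partial i f t = f' t" "\<forall>t\<in>S. partial i g t = g' t" by blast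
    moreover have "\<forall>t\<in>S. partial i (\<lambda>t. f t + g t) t = partial i f t + partial i g t"
      using has_grad_partial[OF has_grad_add[OF smooth_alg_grad smooth_alg_grad]] add.hyps by blast
    ultimately show ?case by (intro bexI[of _ "\<lambda>t. f' t + g' t"] smooth_alg.add) auto
  next
    case (mult f g)
    then obtain f' g' where "f' \<in> smooth_alg S" "g' \<in> smooth_alg S"
      "\<forall>t\<in>S. partial i f t = f' t" "\<forall>t\<in>S. partial i g t = g' t" by blast
    moreover have "\<forall>t\<in>S. partial i (\<lambda>t. f t * g t) t = f t * partial i g t + partial i f t * g t"
      using has_grad_partial[OF has_grad_mult[OF smooth_alg_grad smooth_alg_grad]] mult.hyps by blast
    ultimately show ?case using mult.hyps
      by (intro bexI[of _ "\<lambda>t. f t * g' t + f' t * g t"] smooth_alg.add smooth_alg.mult) auto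
  qed
qed

lemma smooth_on_cong:
  assumes "open S" "smooth_on f S" "\<And>t. t \<in> S \<Longrightarrow> f t = g t"
  shows "smooth_on g S"
  unfolding smooth_on_def
proof
  fix js
  have "foldr partial js f t = foldr partial js g t" if "t \<in> S" for t
    using that
  proof (induction js arbitrary: t)
    case (Cons i js)
    then show ?case using partial_cong[OF \<open>open S\<close>, of t "foldr partial js f" "foldr partial js g"] by simp
  qed (use assms(3) in auto)
  moreover have "field_differentiable_on (foldr partial js f) S"
    using assms(2) by (simp add: smooth_on_def)
  ultimately show "field_differentiable_on (foldr partial js g) S"
    by (rule field_differentiable_on_cong[OF \<open>open S\<close>])
qed

section \<open>Symmetry of mixed second derivatives\<close>

lemma has_grad_approx:
  assumes "has_grad f c t" "0 < \<epsilon>"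
  shows "\<exists>\<delta>>0. \<forall>v. norm v < \<delta> \<longrightarrow> norm (f (t + v) - f t - (\<Sum>i\<in>UNIV. c i * v $ i)) \<le> \<epsilon> * norm v"
proof -
  from assms(1) have "\<forall>\<epsilon>>0. \<exists>\<delta>>0. \<forall>y. norm (y - t) < \<delta> \<longrightarrow>
     norm (f y - f t - (\<Sum>i\<in>UNIV. c i * (y - t) $ i)) \<le> \<epsilon> * norm (y - t)"
    unfolding has_grad_def has_derivative_at_alt by (rule conjunct2)
  with assms(2) obtain \<delta> where "\<delta> > 0" and d: "\<forall>y. norm (y - t) < \<delta> \<longrightarrow>
     norm (f y - f t - (\<Sum>i\<in>UNIV. c i * (y - t) $ i)) \<le> \<epsilon> * norm (y - t)" by meson
  have "norm (f (t + v) - f t - (\<Sum>i\<in>UNIV. c i * v $ i)) \<le> \<epsilon> * norm v" if "norm v < \<delta>" for v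
    using d[rule_format, of "t + v"] that by simp
  with \<open>\<delta> > 0\<close> show ?thesis by blast
qed

text \<open>The second difference is the increment in direction \<open>i\<close> of a difference of
  two translates of \<open>f\<close>. The derivative of the latter is a difference of values of
  \<open>partial i f\<close>, so differentiability of \<open>partial i f\<close> at the single point
  \<open>t\<close> and the mean value bound control it.\<close>

lemma second_difference_approx:
  fixes f :: "'k::real_normed_field ^ 'n::finite \<Rightarrow> 'k"
  assumes "open S" "t \<in> S" and f: "\<forall>s\<in>S. has_grad f (\<lambda>i. partial i f s) s"
    and c: "has_grad (partial i f) c t" and "0 < \<epsilon>"
  shows "\<exists>\<delta>>0. \<forall>r. 0 < r \<and> r < \<delta> \<longrightarrow>
    norm (f (t + axis j (of_real r) + axis i (of_real r)) - f (t + axis j (of_real r))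
      - f (t + axis i (of_real r)) + f t - of_real r * of_real r * c j) \<le> \<epsilon> * r\<^sup>2"
proof -
  obtain d1 where "d1 > 0" and d1: "\<And>s. norm (s - t) < d1 \<Longrightarrow> s \<in> S"
    using assms(1,2)[unfolded open_dist dist_norm] by (meson assms(2))
  \<comment> \<open>The two points compared below lie within 2r and r of \<open>t\<close>, so the
    errors add up to three quarters of \<epsilon> r.\<close>
  have "\<epsilon> / 4 > 0" using \<open>\<epsilon> > 0\<close> by simp
  from has_grad_approx[OF c this] obtain d2 where "d2 > 0" and
    d2: "\<And>v. norm v < d2 \<Longrightarrow> norm (partial i f (t + v) - partial i f t - (\<Sum>i\<in>UNIV. c i * v $ i)) \<le> \<epsilon> / 4 * norm v"
    by blast
  define d where "d = min d1 d2 / 2"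
  have "d > 0" using \<open>d1 > 0\<close> \<open>d2 > 0\<close> by (simp add: d_def)
  moreover have "norm (f (t + axis j (of_real r) + axis i (of_real r)) - f (t + axis j (of_real r))
      - f (t + axis i (of_real r)) + f t - of_real r * of_real r * c j) \<le> \<epsilon> * r\<^sup>2"
    if r: "0 < r" "r < d" for r
  proof -
    define a where "a = t + axis j (of_real r)"
    \<comment> \<open>The linear term is the expected value: in \<phi>' the contributions
      \<open>c i * z\<close> of the two points cancel, and only approximation errors remain.\<close>
    define \<phi> where "\<phi> z = f (a + axis i z) - f (t + axis i z) - z * (of_real r * c j)" for z
    define \<phi>' where "\<phi>' z = partial i f (a + axis i z) - partial i f (t + axis i z) - of_real r * c j" for z
    have nj: "norm (axis j (of_real r) :: 'k ^ 'n) \<le> r"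
      using norm_axis_le[of j "of_real r :: 'k"] r by simp
    have b: "norm (axis i z :: 'k ^ 'n) \<le> r"
      "norm (axis j (of_real r) + axis i z :: 'k ^ 'n) \<le> 2 * r" if "norm z \<le> r" for z
    proof -
      show "norm (axis i z :: 'k ^ 'n) \<le> r"
        using norm_axis_le[of i z] that by (rule order_trans)
      with nj show "norm (axis j (of_real r) + axis i z :: 'k ^ 'n) \<le> 2 * r"
        using norm_triangle_ineq[of "axis j (of_real r) :: 'k ^ 'n" "axis i z"] by linarith
    qed
    have "norm (\<phi> (of_real r) - \<phi> 0) \<le> \<epsilon> * r * norm (of_real r - 0 :: 'k)"
    proof (rule field_differentiable_bound[where S="cball 0 r"])
      fix z :: 'k assume "z \<in> cball 0 r"
      then have z: "norm z \<le> r" by simp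
      have "a + axis i z \<in> S" "t + axis i z \<in> S"
        using b[OF z] r by (auto intro!: d1 simp: a_def d_def)
      note d = this[THEN f[rule_format], THEN has_grad_DERIV]
      have "((\<lambda>z. z * (of_real r * c j)) has_field_derivative of_real r * c j) (at z)"
        by (auto intro!: derivative_eq_intros)
      from DERIV_diff[OF DERIV_diff[OF d] this]
      show "(\<phi> has_field_derivative \<phi>' z) (at z within cball 0 r)"
        unfolding \<phi>_def \<phi>'_def
        by (rule has_field_derivative_at_within)
      have A: "norm (partial i f (a + axis i z) - partial i f t - (c j * of_real r + c i * z)) \<le> \<epsilon> / 4 * (2 * r)"
      proof -
        have "norm (axis j (of_real r) + axis i z :: 'k ^ 'n) < d2" using b(2)[OF z] r by (simp add: d_def)
        from d2[OF this] have "norm (partial i f (a + axis i z) - partial i f t - (c j * of_real r + c i * z))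
          \<le> \<epsilon> / 4 * norm (axis j (of_real r) + axis i z :: 'k ^ 'n)"
          by (simp add: a_def add.assoc distrib_left sum.distrib sum_axis)
        also have "\<dots> \<le> \<epsilon> / 4 * (2 * r)"
          using \<open>\<epsilon> > 0\<close> b(2)[OF z] by (intro mult_left_mono) auto
        finally show ?thesis .
      qed
      have B: "norm (partial i f (t + axis i z) - partial i f t - c i * z) \<le> \<epsilon> / 4 * r"
      proof -
        have "norm (axis i z :: 'k ^ 'n) < d2" using b(1)[OF z] r by (simp add: d_def)
        from d2[OF this] have "norm (partial i f (t + axis i z) - partial i f t - c i * z)
          \<le> \<epsilon> / 4 * norm (axis i z :: 'k ^ 'n)"
          by (simp add: sum_axis)
        also have "\<dots> \<le> \<epsilon> / 4 * r"
          using \<open>\<epsilon> > 0\<close> b(1)[OF z] by (intro mult_left_mono) auto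
        finally show ?thesis .
      qed
      have "\<phi>' z = (partial i f (a + axis i z) - partial i f t - (c j * of_real r + c i * z))
          - (partial i f (t + axis i z) - partial i f t - c i * z)"
        by (simp add: \<phi>'_def)
      then have "norm (\<phi>' z) \<le> \<epsilon> / 4 * (2 * r) + \<epsilon> / 4 * r"
        using A B by (simp only:) (rule norm_triangle_le_diff, rule add_mono)
      also have "\<dots> \<le> \<epsilon> * r" using \<open>\<epsilon> > 0\<close> r by simp
      finally show "norm (\<phi>' z) \<le> \<epsilon> * r" .
    qed (use r in auto)
    moreover have "axis i 0 = (0 :: 'k ^ 'n)" by simp
    ultimately show ?thesis using r
      by (simp add: \<phi>_def a_def algebra_simps power2_eq_square)
  qed
  ultimately show ?thesis by blast
qed

text \<open>Exchanging \<open>i\<close> and \<open>j\<close> does not change the second difference,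
  so both mixed derivatives are limits of the same quantity divided by r^2. This is Young's form of
  the theorem, with first partials differentiable at \<open>t\<close>.\<close>

lemma partial_commute_at:
  fixes f :: "'k::real_normed_field ^ 'n::finite \<Rightarrow> 'k"
  assumes "open S" "t \<in> S" and f: "\<forall>s\<in>S. has_grad f (\<lambda>i. partial i f s) s"
    and c: "has_grad (partial i f) c t" and d: "has_grad (partial j f) d t"
  shows "c j = d i"
proof (rule ccontr)
  assume "c j \<noteq> d i"
  \<comment> \<open>Two errors of size \<epsilon> r^2 cannot bridge a gap of 3 \<epsilon>
    r^2.\<close>
  define \<epsilon> where "\<epsilon> = norm (c j - d i) / 3"
  have "\<epsilon> > 0" using \<open>c j \<noteq> d i\<close> by (simp add: \<epsilon>_def)
  obtain d1 where d1: "d1 > 0" "\<forall>r. 0 < r \<and> r < d1 \<longrightarrow>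
    norm (f (t + axis j (of_real r) + axis i (of_real r)) - f (t + axis j (of_real r))
      - f (t + axis i (of_real r)) + f t - of_real r * of_real r * c j) \<le> \<epsilon> * r\<^sup>2"
    using second_difference_approx[OF assms(1-3) c \<open>\<epsilon> > 0\<close>, of j] by blast
  obtain d2 where d2: "d2 > 0" "\<forall>r. 0 < r \<and> r < d2 \<longrightarrow>
    norm (f (t + axis i (of_real r) + axis j (of_real r)) - f (t + axis i (of_real r))
      - f (t + axis j (of_real r)) + f t - of_real r * of_real r * d i) \<le> \<epsilon> * r\<^sup>2"
    using second_difference_approx[OF assms(1-3) d \<open>\<epsilon> > 0\<close>, of i] by blast
  define r where "r = min d1 d2 / 2"
  have r: "0 < r" "r < d1" "r < d2" using d1(1) d2(1) by (auto simp: r_def)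
  define X where "X = f (t + axis i (of_real r) + axis j (of_real r)) - f (t + axis i (of_real r))
      - f (t + axis j (of_real r)) + f t"
  have 1: "norm (X - of_real r * of_real r * c j) \<le> \<epsilon> * r\<^sup>2"
    using d1(2)[rule_format, of r] r by (simp add: X_def algebra_simps)
  have 2: "norm (X - of_real r * of_real r * d i) \<le> \<epsilon> * r\<^sup>2"
    using d2(2)[rule_format, of r] r by (simp add: X_def)
  have "r\<^sup>2 * (3 * \<epsilon>) = norm (of_real r * of_real r * (c j - d i))"
    using r by (simp add: norm_mult \<epsilon>_def power2_eq_square)
  also have "\<dots> = norm ((X - of_real r * of_real r * d i) - (X - of_real r * of_real r * c j))"
    by (simp add: algebra_simps)
  also have "\<dots> \<le> \<epsilon> * r\<^sup>2 + \<epsilon> * r\<^sup>2"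
    by (rule norm_triangle_le_diff) (rule add_mono[OF 2 1])
  finally have "\<epsilon> * r\<^sup>2 \<le> 0" by simp
  moreover have "\<epsilon> * r\<^sup>2 > 0" using \<open>\<epsilon> > 0\<close> r by simp
  ultimately show False by simp
qed

lemma smooth_on_partial_commute:
  assumes "open S" "smooth_on f S" "t \<in> S"
  shows "partial i (partial j f) t = partial j (partial i f) t"
  using partial_commute_at[OF assms(1,3) ballI[OF smooth_on_imp_has_grad[OF assms(2)]]
      smooth_on_imp_has_grad[OF smooth_on_partial[OF assms(2)] assms(3), of j]
      smooth_on_imp_has_grad[OF smooth_on_partial[OF assms(2)] assms(3), of i]] by simp

section \<open>Primitives of locally exact forms\<close>

text \<open>A family of local primitives \<open>f x\<close> on balls of radius \<open>r x\<close>; a lift of a map \<open>h\<close> is the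
  analytic continuation of the primitive along \<open>h\<close>.\<close>

locale local_primitives =
  fixes \<omega> :: "'a::real_normed_vector \<Rightarrow> 'a \<Rightarrow> 'b::real_normed_vector"
    and U :: "'a set" and r :: "'a \<Rightarrow> real" and f :: "'a \<Rightarrow> 'a \<Rightarrow> 'b"
  assumes r_pos: "x \<in> U \<Longrightarrow> r x > 0" and ball_U: "x \<in> U \<Longrightarrow> ball x (r x) \<subseteq> U"
    and primitive: "x \<in> U \<Longrightarrow> t \<in> ball x (r x) \<Longrightarrow> (f x has_derivative \<omega> t) (at t)"
begin

definition incr :: "'a \<Rightarrow> 'a \<Rightarrow> 'b \<Rightarrow> bool" where
  "incr x y d \<longleftrightarrow> y \<in> ball x (r x) \<and> d = f x y - f x x"

definition lift :: "('c::metric_space \<Rightarrow> 'a) \<Rightarrow> ('c \<Rightarrow> 'b) \<Rightarrow> 'c set \<Rightarrow> bool" where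
  "lift h H S \<longleftrightarrow> (\<forall>p\<in>S. \<exists>\<delta>>0. \<forall>q\<in>S. dist q p < \<delta> \<longrightarrow> incr (h p) (h q) (H q - H p))"

text \<open>Two primitives of the same form differ by a constant on the intersection of the balls,
  which is convex and hence connected.\<close>

lemma compat:
  assumes "x \<in> U" "y \<in> U" "p \<in> ball x (r x)" "p \<in> ball y (r y)" "q \<in> ball x (r x)" "q \<in> ball y (r y)"
  shows "f x q - f x p = f y q - f y p"
proof -
  define B where "B = ball x (r x) \<inter> ball y (r y)"
  have "f x p - f y p = f x q - f y q"
  proof (rule has_derivative_zero_unique_connected[where f="\<lambda>t. f x t - f y t"])
    show "open B" "p \<in> B" "q \<in> B" using assms by (auto simp: B_def)
    show "connected B" unfolding B_def
      by (intro convex_connected convex_Int convex_ball)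
    fix t assume "t \<in> B"
    then have "(f x has_derivative \<omega> t) (at t)" "(f y has_derivative \<omega> t) (at t)"
      using primitive assms by (auto simp: B_def)
    from has_derivative_diff[OF this]
    show "((\<lambda>t. f x t - f y t) has_derivative (\<lambda>x. 0)) (at t)" by simp
  qed
  then show ?thesis by (simp add: algebra_simps)
qed

text \<open>Near each point both lifts have the increment prescribed by \<open>incr\<close>, so
  their difference is locally constant.\<close>

lemma lift_unique:
  assumes "connected S" "lift h H S" "lift h H' S" "p \<in> S" "q \<in> S"
  shows "H p - H' p = H q - H' q"
proof (rule connected_local_const[where f="\<lambda>p. H p - H' p", OF assms(1,4,5)], rule ballI)
  fix a assume "a \<in> S"
  obtain d1 where d1: "d1 > 0" "\<forall>q\<in>S. dist q a < d1 \<longrightarrow> incr (h a) (h q) (H q - H a)"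
    using assms(2) \<open>a \<in> S\<close> unfolding lift_def by blast
  obtain d2 where d2: "d2 > 0" "\<forall>q\<in>S. dist q a < d2 \<longrightarrow> incr (h a) (h q) (H' q - H' a)"
    using assms(3) \<open>a \<in> S\<close> unfolding lift_def by blast
  have "H a - H' a = H b - H' b" if "b \<in> S" "dist b a < min d1 d2" for b
  proof -
    have "H b - H a = H' b - H' a"
      using d1 d2 that unfolding incr_def by simp
    then show ?thesis by (simp add: algebra_simps)
  qed
  moreover have "min d1 d2 > 0" using d1 d2 by simp
  ultimately show "\<forall>\<^sub>F b in at a within S. H a - H' a = H b - H' b"
    unfolding eventually_at by blast
qed

lemma lift_subset: "lift h H S \<Longrightarrow> T \<subseteq> S \<Longrightarrow> lift h H T"
  unfolding lift_def by (meson subsetD)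

lemma lift_shift: "lift h H S \<Longrightarrow> lift h (\<lambda>q. H q + c) S"
  unfolding lift_def by simp

lemma lift_compose:
  assumes "lift h H S" "continuous_on T \<phi>" "\<phi> ` T \<subseteq> S"
  shows "lift (h \<circ> \<phi>) (H \<circ> \<phi>) T"
  unfolding lift_def
proof
  fix p assume "p \<in> T"
  then obtain \<delta> where d: "\<delta> > 0" "\<forall>q\<in>S. dist q (\<phi> p) < \<delta> \<longrightarrow> incr (h (\<phi> p)) (h q) (H q - H (\<phi> p))"
    using assms(1,3) unfolding lift_def by blast
  obtain e where "e > 0" "\<forall>q\<in>T. dist q p < e \<longrightarrow> dist (\<phi> q) (\<phi> p) < \<delta>"
    using assms(2) \<open>p \<in> T\<close> d(1) unfolding continuous_on_iff by blast
  then show "\<exists>\<delta>>0. \<forall>q\<in>T. dist q p < \<delta> \<longrightarrow> incr ((h \<circ> \<phi>) p) ((h \<circ> \<phi>) q) ((H \<circ> \<phi>) q - (H \<circ> \<phi>) p)"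
    using d(2) assms(3) by (intro exI[of _ e]) (auto simp: image_subset_iff)
qed

lemma lift_cong:
  assumes "lift h H S" "\<And>q. q \<in> S \<Longrightarrow> h q = h' q" "\<And>q. q \<in> S \<Longrightarrow> H q = H' q"
  shows "lift h' H' S"
  unfolding lift_def
proof
  fix p assume "p \<in> S"
  then show "\<exists>\<delta>>0. \<forall>q\<in>S. dist q p < \<delta> \<longrightarrow> incr (h' p) (h' q) (H' q - H' p)"
    using assms(1)[unfolded lift_def, rule_format, OF \<open>p \<in> S\<close>] assms(2,3) by simp
qed

lemma lift_primitive:
  assumes "continuous_on S h" "x \<in> U" "h ` S \<subseteq> ball x (r x)"
  shows "lift h (\<lambda>q. f x (h q)) S"
  unfolding lift_def
proof
  fix p assume "p \<in> S"
  then have hp: "h p \<in> ball x (r x)" "h p \<in> U" using assms(3) ball_U[OF assms(2)] by auto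
  obtain e where e: "e > 0" "\<forall>q\<in>S. dist q p < e \<longrightarrow> dist (h q) (h p) < r (h p)"
    using assms(1) \<open>p \<in> S\<close> r_pos[OF hp(2)] unfolding continuous_on_iff by blast
  have "incr (h p) (h q) (f x (h q) - f x (h p))" if "q \<in> S" "dist q p < e" for q
  proof -
    have 1: "h q \<in> ball (h p) (r (h p))" using e(2) that dist_commute[of "h p"] by simp
    have 2: "h p \<in> ball (h p) (r (h p))" using r_pos[OF hp(2)] by simp
    have 3: "h q \<in> ball x (r x)" using assms(3) that by auto
    show ?thesis unfolding incr_def
      using 1 compat[OF assms(2) hp(2) hp(1) 2 3 1] by simp
  qed
  with e(1) show "\<exists>\<delta>>0. \<forall>q\<in>S. dist q p < \<delta> \<longrightarrow> incr (h p) (h q) (f x (h q) - f x (h p))" by blast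
qed

lemma lift_local:
  assumes "continuous_on S h" "h ` S \<subseteq> U" "p \<in> S"
  shows "\<exists>\<delta>>0. \<exists>H. lift h H (S \<inter> ball p \<delta>)"
proof -
  have "h p \<in> U" using assms by auto
  obtain e where e: "e > 0" "\<forall>q\<in>S. dist q p < e \<longrightarrow> dist (h q) (h p) < r (h p)"
    using assms(1,3) r_pos[OF \<open>h p \<in> U\<close>] unfolding continuous_on_iff by blast
  have "lift h (\<lambda>q. f (h p) (h q)) (S \<inter> ball p e)"
  proof (rule lift_primitive[OF _ \<open>h p \<in> U\<close>])
    show "continuous_on (S \<inter> ball p e) h" using assms(1) by (rule continuous_on_subset) auto
    show "h ` (S \<inter> ball p e) \<subseteq> ball (h p) (r (h p))"
      using e(2) by (auto simp: dist_commute)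
  qed
  with e(1) show ?thesis by blast
qed

text \<open>Connectedness of the intersection lets one constant match the two lifts. Closedness
  handles points in only one of the sets: near them the other set is empty, so its condition is
  vacuous.\<close>

lemma lift_glue:
  assumes "closed A" "closed B" "connected (A \<inter> B)" "lift h H1 A" "lift h H2 B"
  shows "\<exists>H. lift h H (A \<union> B)"
proof -
  obtain c where c: "\<forall>q\<in>A \<inter> B. H1 q = H2 q + c"
  proof (cases "A \<inter> B = {}")
    case False
    then obtain p where p: "p \<in> A \<inter> B" by blast
    have "H1 q = H2 q + (H1 p - H2 p)" if "q \<in> A \<inter> B" for q
      using lift_unique[OF assms(3) lift_subset[OF assms(4)] lift_subset[OF assms(5)] p that]
      by (auto simp: algebra_simps)
    then show ?thesis using that by blast
  qed (use that in auto)
  define H where "H q = (if q \<in> A then H1 q else H2 q + c)" for q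
  have A: "lift h H A" by (rule lift_cong[OF assms(4)]) (auto simp: H_def)
  have B: "lift h H B" by (rule lift_cong[OF lift_shift[OF assms(5), of c]]) (use c in \<open>auto simp: H_def\<close>)
  have *: "\<exists>\<delta>>0. \<forall>q\<in>C. dist q p < \<delta> \<longrightarrow> incr (h p) (h q) (H q - H p)"
    if "closed C" "lift h H C" for C p
  proof (cases "p \<in> C")
    case True
    then show ?thesis using that(2) unfolding lift_def by blast
  next
    case False
    have "open (- C)" using that(1) by blast
    moreover have "p \<in> - C" using False by blast
    ultimately obtain e where "e > 0" "ball p e \<subseteq> - C"
      using open_contains_ball by blast
    then show ?thesis by (intro exI[of _ e]) (auto simp: dist_commute subset_iff)
  qed
  have "lift h H (A \<union> B)" unfolding lift_def
  proof
    fix p assume "p \<in> A \<union> B"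
    obtain d1 where d1: "d1 > 0" "\<forall>q\<in>A. dist q p < d1 \<longrightarrow> incr (h p) (h q) (H q - H p)"
      using *[OF assms(1) A] by blast
    obtain d2 where d2: "d2 > 0" "\<forall>q\<in>B. dist q p < d2 \<longrightarrow> incr (h p) (h q) (H q - H p)"
      using *[OF assms(2) B] by blast
    show "\<exists>\<delta>>0. \<forall>q\<in>A \<union> B. dist q p < \<delta> \<longrightarrow> incr (h p) (h q) (H q - H p)"
      using d1 d2 by (intro exI[of _ "min d1 d2"]) auto
  qed
  then show ?thesis by blast
qed

text \<open>Bisection of the horizontal side at a fixed height; it plays the role of a Lebesgue
  number. Each gluing replaces the two strip heights by their minimum.\<close>

lemma lift_strip:
  assumes h: "continuous_on ({0..1} \<times> {0..1}) h" "h ` ({0..1} \<times> {0..1}) \<subseteq> U"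
    and y: "y \<in> {0..1::real}"
  shows "\<exists>\<delta>>0. \<exists>H. lift h H ({0..1::real} \<times> ({y-\<delta>..y+\<delta>} \<inter> {0..1}))"
proof -
  have "0 \<le> (0::real) \<longrightarrow> (1::real) \<le> 1 \<longrightarrow>
      (\<exists>\<delta>>0. \<exists>H. lift h H ({0..1} \<times> ({y-\<delta>..y+\<delta>} \<inter> {0..1})))"
    using zero_le_one[where 'a=real]
  proof (induction rule: Bolzano[where P="\<lambda>a b. 0 \<le> a \<longrightarrow> b \<le> 1 \<longrightarrow>
      (\<exists>\<delta>>0. \<exists>H. lift h H ({a..b} \<times> ({y-\<delta>..y+\<delta>} \<inter> {0..1})))", where a=0 and b=1])
    case (trans a b c)
    show ?case
    proof (intro impI)
      assume "0 \<le> a" "c \<le> 1"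
      with trans obtain d1 H1 d2 H2 where 1: "d1 > 0" "lift h H1 ({a..b} \<times> ({y-d1..y+d1} \<inter> {0..1}))"
        and 2: "d2 > 0" "lift h H2 ({b..c} \<times> ({y-d2..y+d2} \<inter> {0..1}))"
        by auto
      define d where "d = min d1 d2"
      define J where "J = {y-d..y+d} \<inter> {0..1}"
      have "\<exists>H. lift h H ({a..b} \<times> J \<union> {b..c} \<times> J)"
      proof (rule lift_glue)
        show "closed ({a..b} \<times> J)" "closed ({b..c} \<times> J)"
          by (auto simp: J_def intro!: closed_Times)
        have "{a..b} \<times> J \<inter> {b..c} \<times> J = {b} \<times> J" using trans by auto
        also have "convex \<dots>" unfolding J_def by (intro convex_Times convex_Int) auto
        finally show "connected ({a..b} \<times> J \<inter> {b..c} \<times> J)"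
          by (rule convex_connected)
        show "lift h H1 ({a..b} \<times> J)"
          by (rule lift_subset[OF 1(2)]) (auto simp: J_def d_def)
        show "lift h H2 ({b..c} \<times> J)"
          by (rule lift_subset[OF 2(2)]) (auto simp: J_def d_def)
      qed
      moreover have "{a..b} \<times> J \<union> {b..c} \<times> J = {a..c} \<times> J" using trans by auto
      ultimately show "\<exists>\<delta>>0. \<exists>H. lift h H ({a..c} \<times> ({y-\<delta>..y+\<delta>} \<inter> {0..1}))"
        using 1(1) 2(1) by (intro exI[of _ d]) (auto simp: J_def d_def)
    qed
  next
    case (local x)
    have "(x, y) \<in> {0..1} \<times> {0..1}" using local y by auto
    from lift_local[OF h this] obtain d H where d: "d > 0"
      and H: "lift h H (({0..1} \<times> {0..1}) \<inter> ball (x, y) d)" by blast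
    have "\<exists>\<delta>>0. \<exists>H. lift h H ({a..b} \<times> ({y-\<delta>..y+\<delta>} \<inter> {0..1}))"
      if "a \<le> x" "x \<le> b" "b - a < d / 3" "0 \<le> a" "b \<le> 1" for a b
    proof -
      \<comment> \<open>Each coordinate is off by at most d/3, the first strictly less, so the sum
        of the two deviations stays below d.\<close>
      have "{a..b} \<times> ({y-d/3..y+d/3} \<inter> {0..1}) \<subseteq> ({0..1} \<times> {0..1}) \<inter> ball (x, y) d"
      proof safe
        fix s t assume st: "s \<in> {a..b}" "t \<in> {y-d/3..y+d/3}" "t \<in> {0..1}"
        show "s \<in> {0..1}" using st that by auto
        have "dist (x, y) (s, t) \<le> \<bar>x - s\<bar> + \<bar>y - t\<bar>"
          unfolding dist_Pair_Pair dist_real_def by (rule sqrt_sum_squares_le_sum_abs[THEN order_trans]) simp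
        also have "\<dots> < d" using st that d by auto
        finally show "(s, t) \<in> ball (x, y) d" by simp
      qed
      from lift_subset[OF H this] show ?thesis using d by (intro exI[of _ "d/3"]) auto
    qed
    then show ?case using d by (intro exI[of _ "d/3"]) auto
  qed
  then show ?thesis by simp
qed

text \<open>Bisection of the vertical side; the strips provide the local case, and neighbours meet
  in a horizontal segment.\<close>

lemma lift_square:
  assumes h: "continuous_on ({0..1} \<times> {0..1}) h" "h ` ({0..1} \<times> {0..1}) \<subseteq> U"
  shows "\<exists>H. lift h H ({0..1::real} \<times> {0..1::real})"
proof -
  have "0 \<le> (0::real) \<longrightarrow> (1::real) \<le> 1 \<longrightarrow> (\<exists>H. lift h H ({0..1} \<times> {0..1}))"
    using zero_le_one[where 'a=real]
  proof (induction rule: Bolzano[where P="\<lambda>a b. 0 \<le> a \<longrightarrow> b \<le> 1 \<longrightarrow>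
      (\<exists>H. lift h H ({0..1} \<times> {a..b}))", where a=0 and b=1])
    case (trans a b c)
    show ?case
    proof (intro impI)
      assume "0 \<le> a" "c \<le> 1"
      with trans obtain H1 H2 where 1: "lift h H1 ({0..1} \<times> {a..b})" "lift h H2 ({0..1} \<times> {b..c})"
        by auto
      have "\<exists>H. lift h H ({0..1} \<times> {a..b} \<union> {0..1} \<times> {b..c})"
      proof (rule lift_glue[OF _ _ _ 1])
        show "closed ({0..1::real} \<times> {a..b})" "closed ({0..1::real} \<times> {b..c})"
          by (auto intro!: closed_Times)
        have "{0..1} \<times> {a..b} \<inter> {0..1} \<times> {b..c} = {0..1::real} \<times> {b}" using trans by auto
        also have "convex \<dots>" by (intro convex_Times) auto
        finally show "connected ({0..1::real} \<times> {a..b} \<inter> {0..1} \<times> {b..c})"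
          by (rule convex_connected)
      qed
      moreover have "{0..1} \<times> {a..b} \<union> {0..1} \<times> {b..c} = {0..1::real} \<times> {a..c}" using trans by auto
      ultimately show "\<exists>H. lift h H ({0..1} \<times> {a..c})" by simp
    qed
  next
    case (local y)
    then have "y \<in> {0..1}" by auto
    from lift_strip[OF h this] obtain d H where d: "d > 0"
      and H: "lift h H ({0..1} \<times> ({y-d..y+d} \<inter> {0..1}))" by blast
    have "\<exists>H. lift h H ({0..1} \<times> {a..b})"
      if "a \<le> y" "y \<le> b" "b - a < d" "0 \<le> a" "b \<le> 1" for a b
    proof -
      have "{0..1} \<times> {a..b} \<subseteq> {0..1} \<times> ({y-d..y+d} \<inter> {0..1})" using that by auto
      from lift_subset[OF H this] show ?thesis by blast
    qed
    then show ?case using d by (intro exI[of _ d]) auto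
  qed
  then show ?thesis by simp
qed

text \<open>A path is viewed as a map on the square that ignores the first coordinate.\<close>

lemma lift_path:
  assumes "path g" "path_image g \<subseteq> U"
  shows "\<exists>G. lift g G {0..1}"
proof -
  have "continuous_on ({0..1} \<times> {0..1}) (g \<circ> snd :: real \<times> real \<Rightarrow> 'a)"
    using assms(1) unfolding path_def
    by (intro continuous_on_compose continuous_on_snd continuous_on_id) (auto elim: continuous_on_subset)
  moreover have "(g \<circ> snd :: real \<times> real \<Rightarrow> 'a) ` ({0..1} \<times> {0..1}) \<subseteq> U"
    using assms(2) by (auto simp: path_image_def)
  ultimately obtain H where "lift (g \<circ> snd) H ({0..1::real} \<times> {0..1::real})"
    using lift_square by blast
  then have "lift ((g \<circ> snd) \<circ> (\<lambda>s. (0::real, s))) (H \<circ> (\<lambda>s. (0, s))) {0..1::real}"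
    by (rule lift_compose) (auto intro!: continuous_intros)
  then show ?thesis by (auto simp: o_def)
qed

text \<open>In the square the first coordinate is the homotopy parameter. On the sides where the
  second one is 0 or 1 the homotopy is constant, hence so is its lift, and the increments along the
  other two sides agree.\<close>

lemma lift_homotopic:
  assumes "homotopic_paths U g g'" "lift g G {0..1}" "lift g' G' {0..1}"
  shows "G 1 - G 0 = G' 1 - G' 0"
proof -
  obtain h where h: "continuous_on ({0..1} \<times> {0..1}) h" "h \<in> ({0..1} \<times> {0..1}) \<rightarrow> U"
    and h0: "\<And>x. x \<in> {0..1} \<Longrightarrow> h (0, x) = g x" and h1: "\<And>x. x \<in> {0..1} \<Longrightarrow> h (1, x) = g' x"
    and he: "\<And>t. t \<in> {0..1::real} \<Longrightarrow> h (t, 0) = g 0 \<and> h (t, 1) = g 1"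
    using assms(1) unfolding homotopic_paths by (auto simp: pathstart_def pathfinish_def)
  from h(2) have "h ` ({0..1} \<times> {0..1}) \<subseteq> U" by blast
  then obtain H where H: "lift h H ({0..1} \<times> {0..1})"
    using lift_square[OF h(1)] by blast
  have u: "connected {0..1::real}" by simp
  have 0: "(0::real) \<in> {0..1}" and 1: "(1::real) \<in> {0..1}" by auto
  have a: "lift (h \<circ> Pair t) (H \<circ> Pair t) {0..1}" if "t \<in> {0..1}" for t
    by (rule lift_compose[OF H]) (use that in \<open>auto intro!: continuous_intros\<close>)
  have "lift g (\<lambda>x. H (0, x)) {0..1}" "lift g' (\<lambda>x. H (1, x)) {0..1}"
    using lift_cong[OF a[OF 0]] lift_cong[OF a[OF 1]] h0 h1 by auto
  from lift_unique[OF u assms(2) this(1) 1 0] lift_unique[OF u assms(3) this(2) 1 0]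
  have e1: "G 1 - G 0 = H (0, 1) - H (0, 0)" "G' 1 - G' 0 = H (1, 1) - H (1, 0)"
    by (auto simp: algebra_simps)
  have b: "lift (\<lambda>t. h (t, y)) (\<lambda>t. H (t, y)) {0..1}" if "y \<in> {0..1}" for y
  proof -
    have "lift (h \<circ> (\<lambda>t. (t, y))) (H \<circ> (\<lambda>t. (t, y))) {0..1}"
      by (rule lift_compose[OF H]) (use that in \<open>auto intro!: continuous_intros\<close>)
    then show ?thesis by (simp add: o_def)
  qed
  have "H (1, y) = H (0, y)" if y: "y = 0 \<or> y = 1" for y
  proof -
    have yy: "y \<in> {0..1}" using y by auto
    have const: "h (t, y) = h (0, y)" if "t \<in> {0..1}" for t using y he[OF that] he[OF 0] by auto
    have hU: "h (0, y) \<in> U" using h(2) yy by auto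
    have "lift (\<lambda>t. h (0, y)) (\<lambda>t. f (h (0, y)) (h (0, y))) {0..1::real}"
      by (rule lift_primitive) (use hU r_pos in \<open>auto intro!: continuous_intros\<close>)
    moreover have "lift (\<lambda>t. h (0, y)) (\<lambda>t. H (t, y)) {0..1}"
      by (rule lift_cong[OF b[OF yy] const refl])
    ultimately show ?thesis using lift_unique[OF u _ _ 1 0] by fastforce
  qed
  then show ?thesis using e1 by simp
qed

lemma lift_join:
  assumes "lift (g1 +++ g2) G {0..1}" "lift g1 G1 {0..1}" "lift g2 G2 {0..1}"
    and "pathfinish g1 = pathstart g2"
  shows "G 1 - G 0 = (G1 1 - G1 0) + (G2 1 - G2 0)"
proof -
  have u: "connected {0..1::real}" by simp
  have 0: "(0::real) \<in> {0..1}" and 1: "(1::real) \<in> {0..1}" by auto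
  have "lift ((g1 +++ g2) \<circ> (\<lambda>s. s / 2)) (G \<circ> (\<lambda>s. s / 2)) {0..1}"
    by (rule lift_compose[OF assms(1)]) (auto intro!: continuous_intros)
  then have "lift g1 (\<lambda>s. G (s / 2)) {0..1}"
    by (rule lift_cong) (auto simp: joinpaths_def)
  from lift_unique[OF u this assms(2) 1 0] have a: "G (1/2) - G 0 = G1 1 - G1 0"
    by (simp add: algebra_simps)
  have "lift ((g1 +++ g2) \<circ> (\<lambda>s. (s + 1) / 2)) (G \<circ> (\<lambda>s. (s + 1) / 2)) {0..1}"
    by (rule lift_compose[OF assms(1)]) (auto intro!: continuous_intros)
  then have "lift g2 (\<lambda>s. G ((s + 1) / 2)) {0..1}"
    by (rule lift_cong) (use assms(4) in \<open>auto simp: joinpaths_def pathfinish_def pathstart_def field_simps\<close>)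
  from lift_unique[OF u this assms(3) 1 0] have b: "G 1 - G (1/2) = G2 1 - G2 0"
    by (simp add: algebra_simps)
  from a b show ?thesis by (simp add: algebra_simps)
qed

text \<open>The primitive at \<open>x\<close> is the increment of a lift along any path from a base
  point; simple connectedness makes it independent of the path. Appending a segment inside a ball
  shows that it differs from the local primitive by a constant.\<close>

lemma global_primitive:
  assumes "simply_connected U"
  shows "\<exists>F. \<forall>x\<in>U. (F has_derivative \<omega> x) (at x)"
proof (cases "U = {}")
  case False
  then obtain a where "a \<in> U" by blast
  have pc: "path_connected U" and hom: "\<And>p q. path p \<Longrightarrow> path_image p \<subseteq> U \<Longrightarrow> path q \<Longrightarrow> path_image q \<subseteq> U
      \<Longrightarrow> pathstart q = pathstart p \<Longrightarrow> pathfinish q = pathfinish p \<Longrightarrow> homotopic_paths U p q"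
    using assms unfolding simply_connected_eq_homotopic_paths by auto
  \<comment> \<open>A relation at first: that the increment depends on \<open>x\<close> alone is the
    content of \<open>uni\<close>.\<close>
  define val where "val x d \<longleftrightarrow> (\<exists>g G. path g \<and> path_image g \<subseteq> U \<and> pathstart g = a \<and> pathfinish g = x
      \<and> lift g G {0..1} \<and> d = G 1 - G 0)" for x d
  have ex: "\<exists>d. val x d" if x: "x \<in> U" for x
  proof -
    obtain g where g: "path g" "path_image g \<subseteq> U" "pathstart g = a" "pathfinish g = x"
      using pc \<open>a \<in> U\<close> x unfolding path_connected_def by blast
    with lift_path[OF g(1,2)] show ?thesis unfolding val_def by blast
  qed
  have uni: "d = d'" if vd: "val x d" and vd': "val x d'" for x d d'
  proof -
    obtain g G where g: "path g" "path_image g \<subseteq> U" "pathstart g = a" "pathfinish g = x"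
      "lift g G {0..1}" "d = G 1 - G 0" using vd unfolding val_def by blast
    obtain g' G' where g': "path g'" "path_image g' \<subseteq> U" "pathstart g' = a" "pathfinish g' = x"
      "lift g' G' {0..1}" "d' = G' 1 - G' 0" using vd' unfolding val_def by blast
    have "homotopic_paths U g g'" using hom g g' by simp
    from lift_homotopic[OF this g(5) g'(5)] show ?thesis using g g' by simp
  qed
  define F where "F x = (THE d. val x d)" for x
  have F: "F x = d" if "val x d" for x d unfolding F_def using uni that by blast
  have step: "F y = f x y + (F x - f x x)" if x: "x \<in> U" and y: "y \<in> ball x (r x)" for x y
  proof -
    obtain d where d: "val x d" using ex[OF x] by blast
    then obtain g G where g: "path g" "path_image g \<subseteq> U" "pathstart g = a" "pathfinish g = x"
      "lift g G {0..1}" "d = G 1 - G 0" unfolding val_def by blast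
    define l where "l = linepath x y"
    have "x \<in> ball x (r x)" using r_pos[OF x] by simp
    then have seg: "closed_segment x y \<subseteq> ball x (r x)"
      using y by (intro closed_segment_subset convex_ball) auto
    have im: "l ` {0..1} \<subseteq> ball x (r x)" using seg
      by (simp add: l_def flip: path_image_def)
    have L: "lift l (\<lambda>s. f x (l s)) {0..1}"
      by (rule lift_primitive[OF _ x im]) (simp add: l_def continuous_on_linepath)
    have p: "path (g +++ l)" using g by (simp add: l_def)
    have pi: "path_image (g +++ l) \<subseteq> U"
      using g seg ball_U[OF x] by (simp add: l_def path_image_join)
    obtain K where K: "lift (g +++ l) K {0..1}" using lift_path[OF p pi] by blast
    have "val y (K 1 - K 0)" unfolding val_def
      using p pi K g by (intro exI[of _ "g +++ l"] exI[of _ K]) (auto simp: l_def)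
    moreover have "K 1 - K 0 = (G 1 - G 0) + (f x (l 1) - f x (l 0))"
      by (rule lift_join[OF K g(5) L]) (use g in \<open>auto simp: l_def\<close>)
    ultimately show ?thesis using F[OF d] F g(6)
      by (simp add: l_def linepath_def algebra_simps)
  qed
  have "(F has_derivative \<omega> x) (at x)" if x: "x \<in> U" for x
  proof (rule has_derivative_transform_within_open)
    show "((\<lambda>y. f x y + (F x - f x x)) has_derivative \<omega> x) (at x)"
      using has_derivative_add[OF primitive[OF x] has_derivative_const] r_pos[OF x] by simp
    show "open (ball x (r x))" "x \<in> ball x (r x)" using r_pos[OF x] by auto
    show "f x y + (F x - f x x) = F y" if "y \<in> ball x (r x)" for y using step[OF x that] by simp
  qed
  then show ?thesis by blast
qed simp

end

section \<open>The Poincare lemma on balls and on simply connected open sets\<close>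

lemma has_grad_continuous_on:
  assumes "\<And>t. t \<in> S \<Longrightarrow> has_grad f (c t) t"
  shows "continuous_on S f"
  by (rule has_derivative_continuous_on[where f'="\<lambda>t h. \<Sum>i\<in>UNIV. c t i * h $ i"])
     (use assms in \<open>auto simp: has_grad_def intro: has_derivative_at_withinI\<close>)

text \<open>The primitive is the integral of the form along the radius from \<open>x\<close> to
  \<open>t\<close>, differentiated under the integral sign.\<close>

lemma closed_form_primitive_ball:
  fixes c :: "'n::finite \<Rightarrow> 'k::{real_normed_field, euclidean_space} ^ 'n \<Rightarrow> 'k"
  assumes c: "\<And>i t. t \<in> ball x r \<Longrightarrow> has_grad (c i) (\<lambda>j. d i j t) t"
    and d: "\<And>i j. continuous_on (ball x r) (d i j)"
    and sym: "\<And>i j t. t \<in> ball x r \<Longrightarrow> d i j t = d j i t"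
  shows "\<exists>F. \<forall>t\<in>ball x r. has_grad F (\<lambda>i. c i t) t"
proof -
  define \<gamma> :: "'k ^ 'n \<Rightarrow> real \<Rightarrow> 'k ^ 'n" where "\<gamma> t s = x + s *\<^sub>R (t - x)" for t s
  define a where "a j t s = c j (\<gamma> t s) + s *\<^sub>R (\<Sum>i\<in>UNIV. d i j (\<gamma> t s) * (t - x) $ i)" for j t s
  define \<phi> where "\<phi> t s = (\<Sum>i\<in>UNIV. c i (\<gamma> t s) * (t - x) $ i)" for t s
  define pr :: "'n \<Rightarrow> ('k ^ 'n) \<Rightarrow>\<^sub>L 'k" where "pr j = Blinfun (\<lambda>h. h $ j)" for j
  have pr: "blinfun_apply (pr j) h = h $ j" for j h
    unfolding pr_def by (subst bounded_linear_Blinfun_apply) (auto intro: bounded_linear_vec_nth)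
  \<comment> \<open>The derivative of the integrand with respect to \<open>t\<close>, packaged as a
    bounded linear map because \<open>leibniz_rule\<close> asks for its continuity in this
    form.\<close>
  define fx where "fx t s = (\<Sum>j\<in>UNIV. blinfun_mult_right (a j t s) o\<^sub>L pr j)" for t s
  have fx: "blinfun_apply (fx t s) h = (\<Sum>j\<in>UNIV. a j t s * h $ j)" for t s h
    by (simp add: fx_def blinfun.sum_left pr)
  have \<gamma>_ball: "\<gamma> t s \<in> ball x r" if "t \<in> ball x r" "s \<in> {0..1}" for t s
  proof -
    have "dist x (\<gamma> t s) = s * dist x t"
      using that by (simp add: \<gamma>_def dist_norm norm_minus_commute)
    also have "\<dots> \<le> 1 * dist x t" using that by (intro mult_right_mono) auto
    finally show ?thesis using that by simp
  qed
  have \<gamma>_cont: "continuous_on S (\<lambda>p. \<gamma> (fst p) (snd p))" for S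
    unfolding \<gamma>_def by (intro continuous_intros)
  have comp_cont: "continuous_on (ball x r \<times> {0..1}) (\<lambda>p. g (\<gamma> (fst p) (snd p)))"
    if "continuous_on (ball x r) g" for g :: "'k ^ 'n \<Rightarrow> 'k"
    by (rule continuous_on_compose2[OF that \<gamma>_cont]) (use \<gamma>_ball in auto)
  have c_cont: "continuous_on (ball x r) (c i)" for i
    by (rule has_grad_continuous_on) (rule c)
  have nth: "continuous_on S (\<lambda>p. (fst p - x) $ i)" for S :: "(('k ^ 'n) \<times> real) set" and i
    by (intro continuous_intros)
  have a_cont: "continuous_on (ball x r \<times> {0..1}) (\<lambda>p. a j (fst p) (snd p))" for j
    unfolding a_def
    by (intro continuous_intros comp_cont c_cont d)
  have \<phi>_cont: "continuous_on (ball x r \<times> {0..1}) (\<lambda>p. \<phi> (fst p) (snd p))"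
    unfolding \<phi>_def by (intro continuous_intros comp_cont c_cont)
  have fx_cont: "continuous_on (ball x r \<times> cbox 0 1) (\<lambda>(t, s). fx t s)"
    unfolding fx_def split_beta box_real
    by (intro continuous_intros a_cont)
  have \<phi>_int: "\<phi> t integrable_on cbox 0 1" if "t \<in> ball x r" for t
  proof (rule integrable_continuous)
    have "continuous_on (cbox 0 1) (\<lambda>s. \<phi> (fst (t, s)) (snd (t, s)))"
      by (rule continuous_on_compose2[OF \<phi>_cont, where f="\<lambda>s. (t, s)"])
         (use that in \<open>auto intro!: continuous_intros\<close>)
    then show "continuous_on (cbox 0 1) (\<phi> t)" by simp
  qed
  have c_deriv: "((\<lambda>t. c i (\<gamma> t s)) has_derivative (\<lambda>h. \<Sum>j\<in>UNIV. d i j (\<gamma> t s) * (s *\<^sub>R h) $ j)) (at t)"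
    if "t \<in> ball x r" "s \<in> {0..1}" for i t s
  proof -
    have "((\<lambda>t. x + s *\<^sub>R (t - x)) has_derivative (\<lambda>h. 0 + s *\<^sub>R (h - 0))) (at t)"
      by (intro has_derivative_add has_derivative_const has_derivative_scaleR_right
          has_derivative_diff has_derivative_ident)
    then have 1: "((\<lambda>t. \<gamma> t s) has_derivative (\<lambda>h. s *\<^sub>R h)) (at t)"
      by (simp add: \<gamma>_def)
    have 2: "(c i has_derivative (\<lambda>h. \<Sum>j\<in>UNIV. d i j (\<gamma> t s) * h $ j)) (at (\<gamma> t s))"
      using c[OF \<gamma>_ball[OF that]] by (simp add: has_grad_def)
    from has_derivative_compose[OF 1 2] show ?thesis .
  qed
  have nth_deriv: "((\<lambda>t. (t - x) $ i) has_derivative (\<lambda>h. h $ i)) (at t)" for i t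
  proof -
    have "((\<lambda>t. t $ i - x $ i) has_derivative (\<lambda>h. h $ i - 0)) (at t)"
      by (intro has_derivative_diff has_derivative_const
          bounded_linear_imp_has_derivative bounded_linear_vec_nth)
    then show ?thesis by simp
  qed
  have \<phi>_deriv: "((\<lambda>t. \<phi> t s) has_derivative blinfun_apply (fx t s)) (at t within ball x r)"
    if "t \<in> ball x r" "s \<in> cbox 0 1" for t s
  proof -
    have s: "s \<in> {0..1}" using that by simp
    have "((\<lambda>t. \<phi> t s) has_derivative (\<lambda>h. \<Sum>i\<in>UNIV. c i (\<gamma> t s) * h $ i
        + (\<Sum>j\<in>UNIV. d i j (\<gamma> t s) * (s *\<^sub>R h) $ j) * (t - x) $ i)) (at t)"
      unfolding \<phi>_def
      by (intro has_derivative_sum has_derivative_mult c_deriv that(1) s nth_deriv)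
    also have "(\<lambda>h. \<Sum>i\<in>UNIV. c i (\<gamma> t s) * h $ i
        + (\<Sum>j\<in>UNIV. d i j (\<gamma> t s) * (s *\<^sub>R h) $ j) * (t - x) $ i) = blinfun_apply (fx t s)"
    proof
      fix h
      have "(\<Sum>i\<in>UNIV. (\<Sum>j\<in>UNIV. d i j (\<gamma> t s) * (s *\<^sub>R h) $ j) * (t - x) $ i)
          = (\<Sum>j\<in>UNIV. \<Sum>i\<in>UNIV. d i j (\<gamma> t s) * (s *\<^sub>R h) $ j * (t - x) $ i)"
        unfolding sum_distrib_right by (rule sum.swap)
      also have "\<dots> = (\<Sum>j\<in>UNIV. (s *\<^sub>R (\<Sum>i\<in>UNIV. d i j (\<gamma> t s) * (t - x) $ i)) * h $ j)"
        unfolding scaleR_sum_right sum_distrib_right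
        by (intro sum.cong refl) (simp only: vector_scaleR_component mult_scaleR_left mult_scaleR_right mult_ac)
      finally have *: "(\<Sum>i\<in>UNIV. (\<Sum>j\<in>UNIV. d i j (\<gamma> t s) * (s *\<^sub>R h) $ j) * (t - x) $ i) = \<dots>" .
      show "(\<Sum>i\<in>UNIV. c i (\<gamma> t s) * h $ i
        + (\<Sum>j\<in>UNIV. d i j (\<gamma> t s) * (s *\<^sub>R h) $ j) * (t - x) $ i) = blinfun_apply (fx t s) h"
        unfolding fx a_def sum.distrib * distrib_right ..
    qed
    finally show ?thesis by (rule has_derivative_at_withinI)
  qed
  define F where "F t = integral (cbox 0 1) (\<phi> t)" for t
  have "has_grad F (\<lambda>i. c i t) t" if t: "t \<in> ball x r" for t
  proof -
    have "(F has_derivative blinfun_apply (integral (cbox 0 1) (fx t))) (at t within ball x r)"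
      unfolding F_def
      by (rule leibniz_rule[where f=\<phi> and fx=fx and U="ball x r" and a=0 and b=1,
            OF \<phi>_deriv \<phi>_int fx_cont t convex_ball])
    then have F: "(F has_derivative blinfun_apply (integral (cbox 0 1) (fx t))) (at t)"
      by (simp only: at_within_open[OF t open_ball])
    have fx_int: "fx t integrable_on cbox 0 1"
    proof (rule integrable_continuous)
      have "continuous_on (cbox 0 1) (\<lambda>s. case (t, s) of (t, s) \<Rightarrow> fx t s)"
        by (rule continuous_on_compose2[OF fx_cont, where f="\<lambda>s. (t, s)"])
           (use t in \<open>auto intro!: continuous_intros\<close>)
      then show "continuous_on (cbox 0 1) (fx t)" by simp
    qed
    have "blinfun_apply (integral (cbox 0 1) (fx t)) h = (\<Sum>i\<in>UNIV. c i t * h $ i)" for h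
    proof -
      \<comment> \<open>By the symmetry of \<open>d\<close> the differentiated integrand, applied to
        \<open>h\<close>, is the exact derivative of \<open>G\<close> in \<open>s\<close>; the
        increment of \<open>G\<close> over the radius is the form at \<open>t\<close>.\<close>
      define G where "G s = s *\<^sub>R (\<Sum>j\<in>UNIV. c j (\<gamma> t s) * h $ j)" for s
      have "((\<lambda>s. blinfun_apply (fx t s) h) has_integral (G 1 - G 0)) {0..1}"
      proof (rule fundamental_theorem_of_calculus)
        fix s :: real assume s: "s \<in> {0..1}"
        have \<gamma>': "((\<lambda>s. \<gamma> t s) has_derivative (\<lambda>y. y *\<^sub>R (t - x))) (at s)"
        proof -
          have "((\<lambda>s. x + s *\<^sub>R (t - x)) has_derivative (\<lambda>y. 0 + y *\<^sub>R (t - x))) (at s)"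
            by (intro has_derivative_add has_derivative_const has_derivative_scaleR_left has_derivative_ident)
          then show ?thesis by (simp add: \<gamma>_def)
        qed
        have "(c j has_derivative (\<lambda>h. \<Sum>k\<in>UNIV. d j k (\<gamma> t s) * h $ k)) (at (\<gamma> t s))" for j
          using c[OF \<gamma>_ball[OF t s]] by (simp add: has_grad_def)
        from has_derivative_compose[OF \<gamma>' this]
        have cj: "((\<lambda>s. c j (\<gamma> t s)) has_derivative
            (\<lambda>y. \<Sum>k\<in>UNIV. d j k (\<gamma> t s) * (y *\<^sub>R (t - x)) $ k)) (at s)" for j .
        have "(G has_derivative (\<lambda>y. s *\<^sub>R (\<Sum>j\<in>UNIV. (\<Sum>k\<in>UNIV. d j k (\<gamma> t s) * (y *\<^sub>R (t - x)) $ k) * h $ j)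
            + y *\<^sub>R (\<Sum>j\<in>UNIV. c j (\<gamma> t s) * h $ j))) (at s)"
          unfolding G_def
          by (intro has_derivative_scaleR has_derivative_ident has_derivative_sum has_derivative_mult_left cj)
        also have "(\<lambda>y. s *\<^sub>R (\<Sum>j\<in>UNIV. (\<Sum>k\<in>UNIV. d j k (\<gamma> t s) * (y *\<^sub>R (t - x)) $ k) * h $ j)
            + y *\<^sub>R (\<Sum>j\<in>UNIV. c j (\<gamma> t s) * h $ j)) = (\<lambda>y. y *\<^sub>R blinfun_apply (fx t s) h)"
        proof
          fix y
          have "s *\<^sub>R (\<Sum>j\<in>UNIV. (\<Sum>k\<in>UNIV. d j k (\<gamma> t s) * (y *\<^sub>R (t - x)) $ k) * h $ j)
            = y *\<^sub>R (\<Sum>j\<in>UNIV. (s *\<^sub>R (\<Sum>i\<in>UNIV. d i j (\<gamma> t s) * (t - x) $ i)) * h $ j)"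
            unfolding scaleR_sum_right sum_distrib_right sym[OF \<gamma>_ball[OF t s]]
            by (intro sum.cong refl) (simp only: vector_scaleR_component mult_scaleR_left mult_scaleR_right
                scaleR_scaleR mult_ac)
          then show "s *\<^sub>R (\<Sum>j\<in>UNIV. (\<Sum>k\<in>UNIV. d j k (\<gamma> t s) * (y *\<^sub>R (t - x)) $ k) * h $ j)
            + y *\<^sub>R (\<Sum>j\<in>UNIV. c j (\<gamma> t s) * h $ j) = y *\<^sub>R blinfun_apply (fx t s) h"
            unfolding fx a_def distrib_right sum.distrib scaleR_add_right by simp
        qed
        finally show "(G has_vector_derivative blinfun_apply (fx t s) h) (at s within {0..1})"
          unfolding has_vector_derivative_def by (rule has_derivative_at_withinI)
      qed simp
      moreover have "G 1 - G 0 = (\<Sum>i\<in>UNIV. c i t * h $ i)"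
        by (simp add: G_def \<gamma>_def)
      ultimately have "integral (cbox 0 1) (\<lambda>s. blinfun_apply (fx t s) h) = (\<Sum>i\<in>UNIV. c i t * h $ i)"
        by (simp add: integral_unique)
      then show ?thesis using blinfun_apply_integral[OF fx_int, of h] by simp
    qed
    then have "blinfun_apply (integral (cbox 0 1) (fx t)) = (\<lambda>h. \<Sum>i\<in>UNIV. c i t * h $ i)" by blast
    with F show ?thesis by (simp add: has_grad_def)
  qed
  then show ?thesis by blast
qed

theorem closed_form_primitive:
  fixes c :: "'n::finite \<Rightarrow> 'k::{real_normed_field, euclidean_space} ^ 'n \<Rightarrow> 'k"
  assumes "open U" "simply_connected U" and smooth: "\<And>i. smooth_on (c i) U"
    and closed: "\<And>i j t. t \<in> U \<Longrightarrow> partial j (c i) t = partial i (c j) t"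
  shows "\<exists>F. \<forall>t\<in>U. has_grad F (\<lambda>i. c i t) t"
proof -
  have "\<forall>x\<in>U. \<exists>r F. r > 0 \<and> ball x r \<subseteq> U \<and> (\<forall>t\<in>ball x r. has_grad F (\<lambda>i. c i t) t)"
  proof
    fix x assume "x \<in> U"
    then obtain r where r: "r > 0" "ball x r \<subseteq> U"
      using \<open>open U\<close> open_contains_ball by blast
    have "\<exists>F. \<forall>t\<in>ball x r. has_grad F (\<lambda>i. c i t) t"
    proof (rule closed_form_primitive_ball[where d="\<lambda>i j. partial j (c i)"])
      show "has_grad (c i) (\<lambda>j. partial j (c i) t) t" if "t \<in> ball x r" for i t
        using smooth_on_imp_has_grad[OF smooth] that r by blast
      show "partial j (c i) t = partial i (c j) t" if "t \<in> ball x r" for i j t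
        using closed that r by blast
      show "continuous_on (ball x r) (partial j (c i))" for i j
        by (rule has_grad_continuous_on)
           (use smooth_on_imp_has_grad[OF smooth_on_partial[OF smooth]] r in blast)
    qed
    with r show "\<exists>r F. r > 0 \<and> ball x r \<subseteq> U \<and> (\<forall>t\<in>ball x r. has_grad F (\<lambda>i. c i t) t)" by blast
  qed
  from bchoice[OF this] obtain r where
    "\<forall>x\<in>U. \<exists>F. r x > 0 \<and> ball x (r x) \<subseteq> U \<and> (\<forall>t\<in>ball x (r x). has_grad F (\<lambda>i. c i t) t)" ..
  from bchoice[OF this] obtain f where
    f: "\<forall>x\<in>U. r x > 0 \<and> ball x (r x) \<subseteq> U \<and> (\<forall>t\<in>ball x (r x). has_grad (f x) (\<lambda>i. c i t) t)" ..
  interpret local_primitives "\<lambda>t h. \<Sum>i\<in>UNIV. c i t * h $ i" U r f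
    by unfold_locales (use f in \<open>auto simp: has_grad_def\<close>)
  from global_primitive[OF assms(2)] show ?thesis by (simp add: has_grad_def)
qed

section \<open>Derivations on an open set\<close>

text \<open>Derivatives are cut off outside \<open>U\<close>, so that identities valid on \<open>U\<close> between derivatives become
  equations between functions, which can be differentiated again by rewriting.\<close>

locale field_domain =
  fixes e :: "nat \<Rightarrow> 'n::finite" and U :: "('k::{real_normed_field, euclidean_space} ^ 'n) set"
  assumes bij: "bij_betw e {1..CARD('n)} UNIV" and open_U: "open U"
begin

definition D :: "nat \<Rightarrow> ('k ^ 'n \<Rightarrow> 'k) \<Rightarrow> 'k ^ 'n \<Rightarrow> 'k" where
  "D k f t = (if t \<in> U then pd e k f t else 0)"

abbreviation sm :: "('k ^ 'n \<Rightarrow> 'k) \<Rightarrow> bool" where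
  "sm f \<equiv> smooth_on f U"

lemma sm_alg: "f \<in> smooth_alg U \<longleftrightarrow> sm f"
  using smooth_alg_smooth[OF open_U] smooth_alg.base by blast

lemma sm_const [simp, intro]: "sm (\<lambda>t. c)"
  using smooth_alg.const sm_alg by blast

lemma sm_add [simp, intro]: "sm f \<Longrightarrow> sm g \<Longrightarrow> sm (\<lambda>t. f t + g t)"
  using smooth_alg.add sm_alg by blast

lemma sm_mult [simp, intro]: "sm f \<Longrightarrow> sm g \<Longrightarrow> sm (\<lambda>t. f t * g t)"
  using smooth_alg.mult sm_alg by blast

lemma sm_minus [simp, intro]: "sm f \<Longrightarrow> sm (\<lambda>t. - f t)"
  using sm_mult[of "\<lambda>t. -1" f] by simp

lemma sm_diff [simp, intro]: "sm f \<Longrightarrow> sm g \<Longrightarrow> sm (\<lambda>t. f t - g t)"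
  using sm_add[of f "\<lambda>t. - g t"] by simp

lemma sm_sum [simp, intro]: "(\<And>i. i \<in> I \<Longrightarrow> sm (f i)) \<Longrightarrow> sm (\<lambda>t. \<Sum>i\<in>I. f i t)"
  by (induction I rule: infinite_finite_induct) simp_all

lemma sm_cong: "sm f \<Longrightarrow> (\<And>t. t \<in> U \<Longrightarrow> f t = g t) \<Longrightarrow> sm g"
  by (rule smooth_on_cong[OF open_U])

lemma sm_D [simp, intro]:
  assumes "sm f" shows "sm (D k f)"
proof (cases "1 \<le> k \<and> k \<le> CARD('n)")
  case True
  show ?thesis
    by (rule sm_cong[OF smooth_on_partial[OF assms, of "e k"]]) (use True in \<open>simp add: D_def pd_def\<close>)
next
  case False
  show ?thesis
    by (rule sm_cong[OF sm_const[of 0]]) (use False in \<open>auto simp: D_def pd_def\<close>)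
qed

lemma D_outside: "\<not> (1 \<le> k \<and> k \<le> CARD('n)) \<Longrightarrow> D k f = (\<lambda>t. 0)"
  by (auto simp: D_def pd_def)

lemma D_0 [simp]: "D 0 f = (\<lambda>t. 0)"
  by (rule D_outside) simp

lemma D_cong: "(\<And>t. t \<in> U \<Longrightarrow> f t = g t) \<Longrightarrow> D k f = D k g"
  by (rule ext) (auto simp: D_def pd_def intro: partial_cong[OF open_U])

lemma D_out: "t \<notin> U \<Longrightarrow> D k f t = 0"
  by (simp add: D_def)

lemma D_eqI:
  assumes "\<And>t. t \<in> U \<Longrightarrow> has_grad f (\<lambda>i. c i t) t" "\<And>t. t \<in> U \<Longrightarrow> 1 \<le> k \<Longrightarrow> k \<le> CARD('n) \<Longrightarrow> h t = c (e k) t"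
    "\<And>t. t \<in> U \<Longrightarrow> \<not> (1 \<le> k \<and> k \<le> CARD('n)) \<Longrightarrow> h t = 0" "\<And>t. t \<notin> U \<Longrightarrow> h t = 0"
  shows "D k f = h"
proof
  fix t show "D k f t = h t"
    using has_grad_partial[OF assms(1), of t "e k"] assms(2-4)[of t] by (auto simp: D_def pd_def)
qed

lemma D_const [simp]: "D k (\<lambda>t. c) = (\<lambda>t. 0)"
  by (rule D_eqI[where c="\<lambda>i t. 0"]) (auto intro: has_grad_const)

lemma D_add [simp]:
  assumes "sm f" "sm g" shows "D k (\<lambda>t. f t + g t) = (\<lambda>t. D k f t + D k g t)"
  by (rule D_eqI[OF has_grad_add[OF smooth_on_imp_has_grad[OF assms(1)] smooth_on_imp_has_grad[OF assms(2)]]])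
     (auto simp: D_def pd_def)

lemma D_mult [simp]:
  assumes "sm f" "sm g" shows "D k (\<lambda>t. f t * g t) = (\<lambda>t. f t * D k g t + D k f t * g t)"
  by (rule D_eqI[OF has_grad_mult[OF smooth_on_imp_has_grad[OF assms(1)] smooth_on_imp_has_grad[OF assms(2)]]])
     (auto simp: D_def pd_def)

lemma D_minus [simp]: "sm f \<Longrightarrow> D k (\<lambda>t. - f t) = (\<lambda>t. - D k f t)"
  using D_mult[of "\<lambda>t. -1" f k] by simp

lemma D_diff [simp]:
  assumes "sm f" "sm g" shows "D k (\<lambda>t. f t - g t) = (\<lambda>t. D k f t - D k g t)"
  using D_add[of f "\<lambda>t. - g t" k] assms by simp

lemma D_sum [simp]:
  "(\<And>i. i \<in> I \<Longrightarrow> sm (f i)) \<Longrightarrow> D k (\<lambda>t. \<Sum>i\<in>I. f i t) = (\<lambda>t. \<Sum>i\<in>I. D k (f i) t)"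
  by (induction I rule: infinite_finite_induct) simp_all

lemma sm_divide_const [simp]: "sm f \<Longrightarrow> sm (\<lambda>t. f t / c)"
  using sm_mult[OF _ sm_const[of "1 / c"], of f] by simp

lemma D_divide_const [simp]: "sm f \<Longrightarrow> D k (\<lambda>t. f t / c) = (\<lambda>t. D k f t / c)"
  using D_mult[OF _ sm_const[of "1 / c"], of f k] by simp

lemma D_commute:
  assumes "sm f" shows "D i (D j f) = D j (D i f)"
proof (cases "(1 \<le> i \<and> i \<le> CARD('n)) \<and> (1 \<le> j \<and> j \<le> CARD('n))")
  case True
  have *: "D k (D l f) = (\<lambda>t. if t \<in> U then partial (e k) (partial (e l) f) t else 0)"
    if "1 \<le> k \<and> k \<le> CARD('n)" "1 \<le> l \<and> l \<le> CARD('n)" for k l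
  proof -
    have "D k (D l f) = D k (partial (e l) f)"
      by (rule D_cong) (use that in \<open>simp add: D_def pd_def\<close>)
    then show ?thesis using that by (auto simp: D_def pd_def)
  qed
  show ?thesis
    unfolding *[OF conjunct1[OF True] conjunct2[OF True]] *[OF conjunct2[OF True] conjunct1[OF True]]
    using smooth_on_partial_commute[OF open_U assms] by auto
next
  case False
  then show ?thesis using D_outside[of i] D_outside[of j] by auto
qed

text \<open>The generating derivation \<open>\<Sum> z\<^sup>k \<partial>\<^sub>k\<close>, in which the hierarchy takes the closed form \<open>X_A\<close>.\<close>

definition X :: "'k \<Rightarrow> ('k ^ 'n \<Rightarrow> 'k) \<Rightarrow> 'k ^ 'n \<Rightarrow> 'k" where
  "X z f t = (\<Sum>k\<le>CARD('n). z ^ k * D k f t)"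

lemma X_const [simp]: "X z (\<lambda>t. c) = (\<lambda>t. 0)"
  by (simp add: X_def fun_eq_iff)

lemma X_add [simp]: "sm f \<Longrightarrow> sm g \<Longrightarrow> X z (\<lambda>t. f t + g t) = (\<lambda>t. X z f t + X z g t)"
  by (simp add: X_def fun_eq_iff distrib_left sum.distrib)

lemma X_diff [simp]: "sm f \<Longrightarrow> sm g \<Longrightarrow> X z (\<lambda>t. f t - g t) = (\<lambda>t. X z f t - X z g t)"
  by (simp add: X_def fun_eq_iff right_diff_distrib sum_subtractf)

lemma X_mult [simp]: "sm f \<Longrightarrow> sm g \<Longrightarrow> X z (\<lambda>t. f t * g t) = (\<lambda>t. f t * X z g t + X z f t * g t)"
  by (simp add: X_def fun_eq_iff distrib_left sum.distrib sum_distrib_left sum_distrib_right mult_ac)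

lemma sm_X [simp, intro]: "sm f \<Longrightarrow> sm (X z f)"
  unfolding X_def[abs_def] by simp

lemma X_D: "sm f \<Longrightarrow> X z (D k f) = D k (X z f)"
  unfolding X_def[abs_def] by (simp add: D_commute[of f _ k])

end

text \<open>The generating identities hold only away from the zeros of their denominators; the
  finite set \<open>F\<close> absorbs those points.\<close>

lemma coeff_zero:
  fixes c :: "nat \<Rightarrow> 'a::{idom, ring_char_0}"
  assumes "finite F" "\<And>x. x \<notin> F \<Longrightarrow> (\<Sum>i\<le>N. c i * x ^ i) = 0" "i \<le> N"
  shows "c i = 0"
proof -
  define p where "p = (\<Sum>i\<le>N. monom (c i) i)"
  have p: "poly p x = (\<Sum>i\<le>N. c i * x ^ i)" for x
    by (simp add: p_def poly_sum poly_monom)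
  have "p = 0"
  proof (rule ccontr)
    assume "p \<noteq> 0"
    then have "finite {x. poly p x = 0}" by (rule poly_roots_finite)
    then have "finite ({x. poly p x = 0} \<union> F)" using assms(1) by simp
    moreover have "{x. poly p x = 0} \<union> F = UNIV" using assms(2) by (auto simp: p)
    ultimately show False using infinite_UNIV_char_0 by metis
  qed
  have "coeff p i = c i" using assms(3) by (simp add: p_def coeff_sum sum.If_cases)
  with \<open>p = 0\<close> show ?thesis by simp
qed

lemma coeff_eq:
  fixes c d :: "nat \<Rightarrow> 'a::{idom, ring_char_0}"
  assumes "finite F" "\<And>x. x \<notin> F \<Longrightarrow> (\<Sum>i\<le>N. c i * x ^ i) = (\<Sum>i\<le>N. d i * x ^ i)" "i \<le> N"
  shows "c i = d i"
proof -
  have "c i - d i = 0"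
    by (rule coeff_zero[OF assms(1) _ assms(3), of "\<lambda>i. c i - d i"])
       (use assms(2) in \<open>simp add: left_diff_distrib sum_subtractf\<close>)
  then show ?thesis by simp
qed

lemma sum_atMost_1:
  fixes f :: "nat \<Rightarrow> 'a::comm_monoid_add"
  shows "f 0 = 0 \<Longrightarrow> (\<Sum>j\<le>n. f j) = (\<Sum>j = 1..n. f j)"
  by (simp add: sum.atMost_shift sum.atLeast1_atMost_eq)

section \<open>The hierarchy in terms of coefficients\<close>

text \<open>Otherwise \<open>D 1\<close> and \<open>u 1\<close> are rewritten to \<open>D (Suc 0)\<close> and \<open>u (Suc 0)\<close>.\<close>

declare One_nat_def [simp del]

locale kdv = field_domain e U
  for e :: "nat \<Rightarrow> 'n::finite" and U :: "('k::{real_normed_field, euclidean_space} ^ 'n) set" +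
  fixes u :: "nat \<Rightarrow> 'k ^ 'n \<Rightarrow> 'k"
  assumes smooth_u: "i \<in> {1..CARD('n)} \<Longrightarrow> sm (u i)"
    and system: "kdv_system e u U"
begin

text \<open>The coefficients of A = 2 - u, continued by zero beyond g. With \<open>D 0\<close> and
  \<open>D k\<close> for k > g also zero, relations such as \<open>D_a_Suc\<close> and
  \<open>D_a_sym\<close> hold for all indices.\<close>

definition a :: "nat \<Rightarrow> 'k ^ 'n \<Rightarrow> 'k" where
  "a j = (\<lambda>t. if j = 0 then 2 else if j \<le> CARD('n) then - u j t else 0)"

definition A :: "'k \<Rightarrow> 'k ^ 'n \<Rightarrow> 'k" where
  "A x t = (\<Sum>j\<le>CARD('n). a j t * x ^ j)"

lemma N_pos: "1 \<le> CARD('n)"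
  using finite_UNIV_card_ge_0[where 'a='n] by (simp add: Suc_le_eq One_nat_def)

lemma sm_u1 [simp]: "sm (u 1)"
  using smooth_u[of 1] N_pos by auto

lemma sm_a [simp]: "sm (a j)"
proof -
  consider "j = 0" | "j \<in> {1..CARD('n)}" | "j > CARD('n)" by force
  then show ?thesis using smooth_u[of j] by cases (auto simp: a_def)
qed

lemma sm_A [simp]: "sm (A x)"
  unfolding A_def[abs_def] by simp

lemma D_A: "D k (A x) = (\<lambda>t. \<Sum>j\<le>CARD('n). D k (a j) t * x ^ j)"
  unfolding A_def[abs_def] by simp

lemma a_0: "a 0 = (\<lambda>t. 2)" and a_1: "a 1 = (\<lambda>t. - u 1 t)" and a_big: "j > CARD('n) \<Longrightarrow> a j = (\<lambda>t. 0)"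
  using N_pos by (auto simp: a_def)

lemma D_u1: "D k (u 1) = (\<lambda>t. - D k (a 1) t)"
  unfolding a_1 by simp

lemma a_u: "j \<in> {1..CARD('n)} \<Longrightarrow> a j = (\<lambda>t. - u j t)"
  by (auto simp: a_def)

lemma D_u: "j \<in> {1..CARD('n)} \<Longrightarrow> D k (u j) = (\<lambda>t. - D k (a j) t)"
  using smooth_u[of j] by (simp add: a_u)

lemma poly_gen: "poly (gen v (t :: 'k ^ 'n)) x = (\<Sum>j = 1..CARD('n). v j t * x ^ j)"
  unfolding gen_def poly_sum by (simp add: poly_monom)

lemma poly_gen_u: "2 - poly (gen u t) x = A x t"
proof -
  have "A x t = 2 + (\<Sum>j = 1..CARD('n). a j t * x ^ j)"
    unfolding A_def by (simp add: a_0 sum.atMost_shift sum.atLeast1_atMost_eq One_nat_def)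
  also have "(\<Sum>j = 1..CARD('n). a j t * x ^ j) = (\<Sum>j = 1..CARD('n). - (u j t * x ^ j))"
    by (rule sum.cong) (auto simp: a_def)
  finally show ?thesis by (simp add: poly_gen sum_negf)
qed

lemma coeff_gen_u: "coeff (2 - gen u t) j = a j t"
proof -
  have c2: "coeff (2 :: 'k poly) j = (if j = 0 then 2 else 0)"
    by (simp add: numeral_poly coeff_pCons split: nat.split)
  show ?thesis
    by (auto simp: gen_def coeff_sum a_def c2)
qed

lemma dx_u: "t \<in> U \<Longrightarrow> j \<in> {1..CARD('n)} \<Longrightarrow> dx e u j t = - D 1 (a j) t"
  using fun_cong[OF D_u[of j 1], of t] by (simp add: dx_def D_def)

lemma dx_cong: "(\<And>t. t \<in> U \<Longrightarrow> v j t = w t) \<Longrightarrow> t \<in> U \<Longrightarrow> dx e v j t = D 1 w t"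
  using fun_cong[OF D_cong[of "v j" w 1], of t] by (simp add: dx_def D_def)

lemma dx2_u: "t \<in> U \<Longrightarrow> j \<in> {1..CARD('n)} \<Longrightarrow> dx e (dx e u) j t = - D 1 (D 1 (a j)) t"
  using dx_cong[of "dx e u" j "\<lambda>t. - D 1 (a j) t" t] dx_u by simp

lemma dx3_u: "t \<in> U \<Longrightarrow> j \<in> {1..CARD('n)} \<Longrightarrow> dx e (dx e (dx e u)) j t = - D 1 (D 1 (D 1 (a j))) t"
  using dx_cong[of "dx e (dx e u)" j "\<lambda>t. - D 1 (D 1 (a j)) t" t] dx2_u by simp

lemma poly_gen_deriv:
  fixes t :: "'k ^ 'n"
  assumes "\<And>j. j \<in> {1..CARD('n)} \<Longrightarrow> v j t = - c j" "c 0 = 0"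
  shows "poly (gen v t) x = - (\<Sum>j\<le>CARD('n). c j * x ^ j)"
proof -
  have "(\<Sum>j\<le>CARD('n). c j * x ^ j) = (\<Sum>j = 1..CARD('n). c j * x ^ j)"
    by (rule sum_atMost_1) (simp add: assms(2))
  moreover have "poly (gen v t) x = (\<Sum>j = 1..CARD('n). - (c j * x ^ j))"
    unfolding poly_gen by (rule sum.cong) (simp_all add: assms(1))
  ultimately show ?thesis by (simp add: sum_negf)
qed

lemma poly_dx: "t \<in> U \<Longrightarrow> poly (gen (dx e u) t) x = - D 1 (A x) t"
  by (subst poly_gen_deriv[where c="\<lambda>j. D 1 (a j) t"]) (simp_all add: dx_u a_0 D_A)

lemma poly_dx2: "t \<in> U \<Longrightarrow> poly (gen (dx e (dx e u)) t) x = - D 1 (D 1 (A x)) t"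
  by (subst poly_gen_deriv[where c="\<lambda>j. D 1 (D 1 (a j)) t"]) (simp_all add: dx2_u a_0 D_A)

lemma poly_dx3: "t \<in> U \<Longrightarrow> poly (gen (dx e (dx e (dx e u))) t) x = - D 1 (D 1 (D 1 (A x))) t"
  by (subst poly_gen_deriv[where c="\<lambda>j. D 1 (D 1 (D 1 (a j))) t"]) (simp_all add: dx3_u a_0 D_A)

lemma poly_pd: "t \<in> U \<Longrightarrow> poly (gen (\<lambda>i. pd e k (u i)) t) x = - D k (A x) t"
proof (subst poly_gen_deriv[where c="\<lambda>j. D k (a j) t"])
  show "pd e k (u j) t = - D k (a j) t" if "t \<in> U" "j \<in> {1..CARD('n)}" for j
    using fun_cong[OF D_u[OF that(2), of k], of t] that(1) by (simp add: D_def)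
qed (simp_all add: a_0 D_A)

lemma A_third:
  assumes "x \<noteq> 0"
  shows "D 1 (D 1 (D 1 (A x))) = (\<lambda>t. 4 * (1 / x + u 1 t) * D 1 (A x) t + 2 * D 1 (u 1) t * A x t)"
proof
  fix t
  show "D 1 (D 1 (D 1 (A x))) t = 4 * (1 / x + u 1 t) * D 1 (A x) t + 2 * D 1 (u 1) t * A x t"
  proof (cases "t \<in> U")
    case True
    have "dx e u 1 t = D 1 (u 1) t" using True by (simp add: dx_def D_def)
    with system[unfolded kdv_system_def] assms True show ?thesis
      by (auto simp: poly_gen_u poly_dx poly_dx3 algebra_simps)
  qed (simp add: D_out)
qed

text \<open>The right-hand side of the equation for \<open>\<partial>\<^sub>k\<close>. It satisfies a first-order recursion in \<open>k\<close> and
  vanishes at \<open>k = g + 1\<close>, so that the equation holds for every \<open>k\<close> with \<open>\<partial>\<^sub>k = 0\<close> for \<open>k > g\<close>.\<close>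

definition W :: "'k \<Rightarrow> nat \<Rightarrow> 'k ^ 'n \<Rightarrow> 'k" where
  "W x k t = 1 / 2 * (\<Sum>j<k. (a j t * D 1 (A x) t - D 1 (a j) t * A x t) * x powi (int j - int k + 1))"

lemma W_Suc:
  assumes "x \<noteq> 0"
  shows "W x (Suc k) t = W x k t / x + 1 / 2 * (a k t * D 1 (A x) t - D 1 (a k) t * A x t)"
proof -
  have "x powi (int j - int (Suc k) + 1) = x powi (int j - int k + 1) / x" for j
  proof -
    have "int j - int (Suc k) + 1 = (int j - int k + 1) - 1" by simp
    then show ?thesis using assms power_int_diff[of x "int j - int k + 1" 1] by simp
  qed
  then show ?thesis unfolding W_def using assms by (simp add: sum_divide_distrib distrib_left mult.commute)
qed

lemma coeff_gen_dx: "t \<in> U \<Longrightarrow> coeff (gen (dx e u) t) j = - D 1 (a j) t"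
  by (cases "j = 0"; cases "j \<le> CARD('n)") (auto simp: gen_def coeff_sum dx_u a_0 a_big)

lemma D_A_W_in:
  assumes "x \<noteq> 0" "k \<in> {1..CARD('n)}" "t \<in> U"
  shows "D k (A x) t = W x k t"
proof -
  have "- D k (A x) t = D_op k (2 - gen u t) x * (- D 1 (A x) t) - D_op k (gen (dx e u) t) x * A x t"
    using system assms unfolding kdv_system_def
    by (metis poly_pd poly_dx poly_gen_u)
  then have "D k (A x) t = D_op k (2 - gen u t) x * D 1 (A x) t + D_op k (gen (dx e u) t) x * A x t"
    by (simp add: algebra_simps)
  also have "\<dots> = W x k t"
    unfolding D_op_def W_def coeff_gen_u coeff_gen_dx[OF assms(3)]
    by (simp add: algebra_simps sum_distrib_left sum_distrib_right sum_subtractf sum_negf)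
  finally show ?thesis .
qed

text \<open>At k = g + 1 the sums over \<open>j\<close> run through all coefficients, and the
  bracket becomes A A' - A' A.\<close>

lemma W_end:
  assumes "x \<noteq> 0"
  shows "W x (Suc CARD('n)) t = 0"
proof -
  have "W x (Suc CARD('n)) t = 1 / 2 * (\<Sum>j\<le>CARD('n). (a j t * D 1 (A x) t - D 1 (a j) t * A x t) * (x ^ j / x ^ CARD('n)))"
    unfolding W_def lessThan_Suc_atMost using assms
    by (simp add: power_int_diff power_int_add)
  also have "\<dots> = 1 / 2 * ((\<Sum>j\<le>CARD('n). a j t * x ^ j) * D 1 (A x) t - (\<Sum>j\<le>CARD('n). D 1 (a j) t * x ^ j) * A x t) / x ^ CARD('n)"
    by (simp add: sum_distrib_left sum_distrib_right sum_subtractf sum_divide_distrib left_diff_distrib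
        right_diff_distrib diff_divide_distrib mult_ac)
  also have "\<dots> = 0" by (simp add: D_A flip: A_def)
  finally show ?thesis .
qed

lemma D_A_W:
  assumes "x \<noteq> 0" "t \<in> U"
  shows "D k (A x) t = W x k t"
proof -
  consider "k = 0" | "k \<in> {1..CARD('n)}" | "k > CARD('n)" by force
  then show ?thesis
  proof cases
    case 1
    then show ?thesis by (simp add: W_def)
  next
    case 2
    then show ?thesis using D_A_W_in assms by blast
  next
    case 3
    have "W x (Suc CARD('n) + m) t = 0" for m
    proof (induction m)
      case (Suc m)
      have "Suc CARD('n) + m > CARD('n)" by simp
      from a_big[OF this] Suc.IH W_Suc[OF assms(1), of "Suc CARD('n) + m" t] show ?case by simp
    qed (use W_end[OF assms(1)] in simp)
    from this[of "k - Suc CARD('n)"] have "W x k t = 0" using 3 by simp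
    then show ?thesis using D_outside[of k "A x"] 3 by simp
  qed
qed

lemma D_A_Suc:
  assumes "x \<noteq> 0"
  shows "D (Suc k) (A x) t = D k (A x) t / x + 1 / 2 * (a k t * D 1 (A x) t - D 1 (a k) t * A x t)"
  by (cases "t \<in> U") (simp_all add: D_A_W W_Suc assms D_out)

text \<open>This is the coefficient of x^(m+1) in \<open>x\<close> times the recursion
  \<open>D_A_Suc\<close>.\<close>

lemma D_a_Suc: "D (Suc k) (a m) t - D k (a (Suc m)) t = 1 / 2 * (a k t * D 1 (a m) t - D 1 (a k) t * a m t)"
proof (cases "m \<le> CARD('n)")
  case False
  then show ?thesis by (simp add: a_big)
next
  case True
  \<comment> \<open>Multiplication by \<open>x\<close> shifts the coefficients by one, hence the
    index i - 1 and the value 0 at i = 0.\<close>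
  define c where "c i = (if i = 0 then 0 else D (Suc k) (a (i - 1)) t
      - 1 / 2 * (a k t * D 1 (a (i - 1)) t - D 1 (a k) t * a (i - 1) t))" for i
  define d where "d i = (if i \<le> CARD('n) then D k (a i) t else 0)" for i
  have "c (Suc m) = d (Suc m)"
  proof (rule coeff_eq[where F="{0}" and N="Suc CARD('n)"])
    fix x :: 'k assume "x \<notin> {0}"
    then have x: "x \<noteq> 0" by simp
    have "(\<Sum>i\<le>Suc CARD('n). c i * x ^ i) = (\<Sum>i\<le>CARD('n). c (Suc i) * x ^ Suc i)"
      by (subst sum.atMost_Suc_shift) (simp add: c_def)
    also have "\<dots> = x * (D (Suc k) (A x) t - 1 / 2 * (a k t * D 1 (A x) t - D 1 (a k) t * A x t))"
      unfolding D_A A_def c_def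
      by (simp add: sum_distrib_left sum_distrib_right sum_subtractf left_diff_distrib
        right_diff_distrib mult_ac)
    also have "\<dots> = D k (A x) t"
      using D_A_Suc[OF x, of k t] x by simp
    also have "\<dots> = (\<Sum>i\<le>Suc CARD('n). d i * x ^ i)"
      by (simp add: D_A d_def)
    finally show "(\<Sum>i\<le>Suc CARD('n). c i * x ^ i) = (\<Sum>i\<le>Suc CARD('n). d i * x ^ i)" .
  qed (use True in simp_all)
  moreover have "d (Suc m) = D k (a (Suc m)) t" using a_big[of "Suc m"] by (auto simp: d_def)
  ultimately show ?thesis by (simp add: c_def algebra_simps)
qed

text \<open>The right-hand side of \<open>D_a_Suc\<close> is antisymmetric in \<open>k\<close> and
  \<open>m\<close>, so the defect E(k, m) of the symmetry satisfies E(k, m + 1) = E(k + 1, m).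
  Descending to m = 0 gives zero, since \<open>a 0\<close> is constant and \<open>D 0\<close>
  vanishes.\<close>

lemma D_a_sym: "D k (a m) = D m (a k)"
proof
  fix t
  have "D k (a m) t - D m (a k) t = 0"
  proof (induction m arbitrary: k)
    case (Suc m)
    then show ?case using D_a_Suc[of k m t] D_a_Suc[of m k t] Suc.IH[of "Suc k"]
      by (simp add: algebra_simps)
  qed (simp add: a_0)
  then show "D k (a m) t = D m (a k) t" by simp
qed

end

section \<open>The generating derivation on A, on the curve equation and on Q\<close>

context kdv begin

text \<open>Summing the recursion against z^(k+1) shifts the index without boundary terms, as
  \<open>D 0\<close> and \<open>D (g + 1)\<close> vanish, and leaves a linear equation for
  \<open>S\<close>. The factor 1 / (2 (1/z - 1/x)) enters as a variable \<open>c\<close> with a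
  polynomial side condition, so that later identities can be left to \<open>algebra\<close>.\<close>

lemma X_A:
  assumes "x \<noteq> 0" "z \<noteq> 0" "z \<noteq> x" "2 * c * (1 / z - 1 / x) = 1"
  shows "X z (A x) = (\<lambda>t. c * (A z t * D 1 (A x) t - D 1 (A z) t * A x t))"
proof
  fix t
  define S where "S = X z (A x) t"
  have S0: "(\<Sum>k\<le>CARD('n). z ^ Suc k * D (Suc k) (A x) t) = S"
  proof -
    have "(\<Sum>k\<le>Suc CARD('n). z ^ k * D k (A x) t) = (\<Sum>k\<le>CARD('n). z ^ Suc k * D (Suc k) (A x) t)"
      by (subst sum.atMost_Suc_shift) simp
    moreover have "(\<Sum>k\<le>Suc CARD('n). z ^ k * D k (A x) t) = S"
      by (simp add: S_def X_def D_outside)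
    ultimately show ?thesis by simp
  qed
  have "S = (\<Sum>k\<le>CARD('n). z ^ Suc k * (D k (A x) t / x + 1 / 2 * (a k t * D 1 (A x) t - D 1 (a k) t * A x t)))"
    using S0 D_A_Suc[OF assms(1)] by simp
  also have "\<dots> = z / x * S + z / 2 * (A z t * D 1 (A x) t - D 1 (A z) t * A x t)"
    unfolding S_def X_def D_A[of 1 z] A_def[of z]
    by (simp add: distrib_left right_diff_distrib left_diff_distrib sum.distrib sum_subtractf
        sum_distrib_left sum_distrib_right sum_divide_distrib diff_divide_distrib mult_ac)
  finally have "S = z / x * S + z / 2 * (A z t * D 1 (A x) t - D 1 (A z) t * A x t)" .
  then have "S * (1 / z - 1 / x) = 1 / 2 * (A z t * D 1 (A x) t - D 1 (A z) t * A x t)"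
    using assms(1,2) by (simp add: field_simps)
  then have "S = c * (A z t * D 1 (A x) t - D 1 (A z) t * A x t)"
    using assms(4) by algebra
  then show "X z (A x) t = c * (A z t * D 1 (A x) t - D 1 (A z) t * A x t)" by (simp add: S_def)
qed

text \<open>By the symmetry \<open>D_a_sym\<close>, the derivatives of \<open>a 1\<close> along all
  \<open>k\<close> are the x-derivatives of all \<open>a k\<close>.\<close>

lemma X_u1: "X z (u 1) = (\<lambda>t. - D 1 (A z) t)"
proof
  fix t
  have "D k (u 1) t = - D 1 (a k) t" for k
    using fun_cong[OF D_u1[of k], of t] D_a_sym[of k 1] by simp
  then show "X z (u 1) t = - D 1 (A z) t"
    by (simp add: X_def D_A sum_negf mult_ac)
qed

text \<open>The right-hand side of the curve equation, rewritten for A = 2 - u.\<close>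

definition K :: "'k \<Rightarrow> 'k ^ 'n \<Rightarrow> 'k" where
  "K x t = D 1 (A x) t * D 1 (A x) t - 2 * (A x t * D 1 (D 1 (A x)) t) + 4 * ((1 / x + u 1 t) * (A x t * A x t))"

lemma sm_K [simp]: "sm (K x)"
  unfolding K_def[abs_def] by simp

lemma X_K:
  assumes "x \<noteq> 0" "z \<noteq> 0" "z \<noteq> x"
  shows "X z (K x) t = 0"
proof -
  define c where "c = 1 / (2 * (1 / z - 1 / x))"
  have "1 / z - 1 / x \<noteq> 0" using assms by (simp add: field_simps)
  then have c: "2 * c * (1 / z - 1 / x) = 1" by (simp add: c_def)
  \<comment> \<open>The reciprocals become variables; after the third derivatives are eliminated the
    claim is a polynomial identity modulo \<open>c'\<close>.\<close>
  define \<alpha> where "\<alpha> = 1 / x"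
  define \<gamma> where "\<gamma> = 1 / z"
  note * = X_A[OF assms c] A_third[OF assms(1), folded \<alpha>_def] A_third[OF assms(2), folded \<gamma>_def]
  have c': "2 * c * (\<gamma> - \<alpha>) = 1" using c by (simp add: \<alpha>_def \<gamma>_def)
  show ?thesis
    unfolding K_def[abs_def] \<alpha>_def[symmetric]
    using c' by (simp add: X_D * X_u1) algebra
qed

text \<open>For fixed \<open>x\<close> the expression \<open>X z (K x)\<close> is a polynomial in
  \<open>z\<close> with these derivatives as coefficients, and it vanishes for all but two values of
  \<open>z\<close>.\<close>

lemma D_K:
  assumes "x \<noteq> 0"
  shows "D k (K x) = (\<lambda>t. 0)"
proof (cases "k \<le> CARD('n)")
  case True
  show ?thesis
  proof
    fix t
    show "D k (K x) t = 0"
    proof (rule coeff_zero[where F="{0, x}" and c="\<lambda>k. D k (K x) t" and N="CARD('n)"])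
      fix z assume "z \<notin> {0, x}"
      then have "z \<noteq> 0" "z \<noteq> x" by auto
      from X_K[OF assms this] show "(\<Sum>k\<le>CARD('n). D k (K x) t * z ^ k) = 0"
        by (simp add: X_def mult.commute)
    qed (use True in auto)
  qed
qed (simp add: D_outside)

definition Q :: "'k \<Rightarrow> 'k \<Rightarrow> 'k ^ 'n \<Rightarrow> 'k" where
  "Q x y t = D 1 (A x) t * D 1 (A y) t - A x t * D 1 (D 1 (A y)) t - D 1 (D 1 (A x)) t * A y t
     + 2 * (A x t * A y t * (1 / x + 1 / y + 2 * u 1 t))"

lemma sm_Q [simp]: "sm (Q x y)"
  unfolding Q_def[abs_def] by simp

text \<open>Minus the determinant with rows (A, A', A'') at \<open>z\<close>, \<open>x\<close>,
  \<open>y\<close>; it is alternating in the three points.\<close>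

definition Dt :: "'k \<Rightarrow> 'k \<Rightarrow> 'k \<Rightarrow> 'k ^ 'n \<Rightarrow> 'k" where
  "Dt z x y t = A z t * (D 1 (D 1 (A x)) t * D 1 (A y) t - D 1 (A x) t * D 1 (D 1 (A y)) t)
    + D 1 (A z) t * (A x t * D 1 (D 1 (A y)) t - D 1 (D 1 (A x)) t * A y t)
    + D 1 (D 1 (A z)) t * (D 1 (A x) t * A y t - A x t * D 1 (A y) t)"

text \<open>The third derivatives are eliminated by \<open>A_third\<close>, and the second
  derivatives that survive collect in the determinant. The summand - 4 stems from the derivative of
  \<open>u 1\<close>, by \<open>X_u1\<close>.\<close>

lemma X_Q:
  assumes "x \<noteq> 0" "y \<noteq> 0" "z \<noteq> 0" "z \<noteq> x" "z \<noteq> y"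
    and c: "2 * c * (1 / z - 1 / x) = 1" and d: "2 * d * (1 / z - 1 / y) = 1"
  shows "X z (Q x y) t = (c - d) * Dt z x y t
    + 2 * A z t * (1 / y - 1 / x) * (c * D 1 (A x) t * A y t - d * A x t * D 1 (A y) t)
    + D 1 (A z) t * A x t * A y t * ((c + d) * (4 / z - 2 / x - 2 / y) - 4)"
proof -
  define \<alpha> where "\<alpha> = 1 / x"
  define \<beta> where "\<beta> = 1 / y"
  define \<gamma> where "\<gamma> = 1 / z"
  have \<gamma>': "4 / z = 4 * \<gamma>" "2 / x = 2 * \<alpha>" "2 / y = 2 * \<beta>" by (simp_all add: \<alpha>_def \<beta>_def \<gamma>_def)
  note * = X_A[OF assms(1,3,4) c] X_A[OF assms(2,3,5) d]
    A_third[OF assms(1), folded \<alpha>_def] A_third[OF assms(2), folded \<beta>_def] A_third[OF assms(3), folded \<gamma>_def]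
  show ?thesis
    unfolding Q_def[abs_def] Dt_def \<gamma>' \<alpha>_def[symmetric] \<beta>_def[symmetric]
    by (simp add: X_D * X_u1) algebra
qed

text \<open>The value of the generating derivation on \<open>P(\<xi>, \<eta>)\<close>; its total symmetry is the closedness of
  the forms \<open>\<Sum> p\<^sub>i\<^sub>j dt\<^sub>i\<close>.\<close>

definition T :: "'k \<Rightarrow> 'k \<Rightarrow> 'k \<Rightarrow> 'k ^ 'n \<Rightarrow> 'k" where
  "T z x y t = - 1 / 4 * (Dt z x y t / (2 * ((1/x - 1/y) * (1/z - 1/x) * (1/z - 1/y)))
     + D 1 (A x) t * A z t * A y t / ((1/x - 1/z) * (1/x - 1/y))
     + D 1 (A y) t * A x t * A z t / ((1/y - 1/z) * (1/y - 1/x))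
     + D 1 (A z) t * A x t * A y t / ((1/z - 1/x) * (1/z - 1/y)))"

end

text \<open>With p = \<gamma> - \<alpha>, q = \<gamma> - \<beta> and r = q - p, the difference of
  the two weights is r / (2 p q), and the last bracket is r^2 / (p q). The middle term carries r
  explicitly, so every term cancels at least one factor of the double pole.\<close>

lemma T_alg:
  fixes \<alpha> \<beta> \<gamma> :: "'a::field_char_0"
  assumes "\<alpha> \<noteq> \<beta>" "\<gamma> \<noteq> \<alpha>" "\<gamma> \<noteq> \<beta>"
  shows "- (1 / (4 * (\<alpha> - \<beta>)\<^sup>2)) * ((1 / (2 * (\<gamma> - \<alpha>)) - 1 / (2 * (\<gamma> - \<beta>))) * Det
      + 2 * B * (\<beta> - \<alpha>) * (1 / (2 * (\<gamma> - \<alpha>)) * A' * E - 1 / (2 * (\<gamma> - \<beta>)) * A * E')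
      + B' * A * E * ((1 / (2 * (\<gamma> - \<alpha>)) + 1 / (2 * (\<gamma> - \<beta>))) * (4 * \<gamma> - 2 * \<alpha> - 2 * \<beta>) - 4))
    = - 1 / 4 * (Det / (2 * ((\<alpha> - \<beta>) * (\<gamma> - \<alpha>) * (\<gamma> - \<beta>)))
     + A' * B * E / ((\<alpha> - \<gamma>) * (\<alpha> - \<beta>)) + E' * A * B / ((\<beta> - \<gamma>) * (\<beta> - \<alpha>))
     + B' * A * E / ((\<gamma> - \<alpha>) * (\<gamma> - \<beta>)))"
proof -
  define p where "p = \<gamma> - \<alpha>"
  define q where "q = \<gamma> - \<beta>"
  define r where "r = \<alpha> - \<beta>"
  have nz: "p \<noteq> 0" "q \<noteq> 0" "r \<noteq> 0" and r: "r = q - p" using assms by (simp_all add: p_def q_def r_def)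
  have e: "\<alpha> - \<gamma> = - p" "\<beta> - \<gamma> = - q" "\<beta> - \<alpha> = - r" "4 * \<gamma> - 2 * \<alpha> - 2 * \<beta> = 2 * (p + q)"
    by (simp_all add: p_def q_def r_def)
  have 1: "1 / (2 * p) - 1 / (2 * q) = r / (2 * p * q)"
    using nz by (simp add: r field_simps)
  have 2: "(1 / (2 * p) + 1 / (2 * q)) * (2 * (p + q)) - 4 = r\<^sup>2 / (p * q)"
    using nz by (simp add: r field_simps power2_eq_square)
  have "1 / (4 * r\<^sup>2) * (r / (2 * p * q) * Det
      + 2 * B * (- r) * (1 / (2 * p) * A' * E - 1 / (2 * q) * A * E')
      + B' * A * E * (r\<^sup>2 / (p * q))) = 1 / 4 * (Det / (2 * (r * p * q))
     + A' * B * E / (- p * r) + E' * A * B / (- q * - r) + B' * A * E / (p * q))"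
    using nz by (simp add: field_simps power2_eq_square)
  then show ?thesis
    unfolding p_def[symmetric] q_def[symmetric] r_def[symmetric] e 1 2 by simp
qed

context kdv begin

lemma X_P:
  assumes "x \<noteq> 0" "y \<noteq> 0" "z \<noteq> 0" "z \<noteq> x" "z \<noteq> y" "x \<noteq> y"
  shows "- (x\<^sup>2 * y\<^sup>2 / (4 * (x - y)\<^sup>2)) * X z (Q x y) t = T z x y t"
proof -
  have ne: "1 / z - 1 / x \<noteq> 0" "1 / z - 1 / y \<noteq> 0" using assms by (simp_all add: field_simps)
  have ne': "1 / x \<noteq> 1 / y" "1 / z \<noteq> 1 / x" "1 / z \<noteq> 1 / y" using assms by (simp_all add: field_simps)
  have f: "x\<^sup>2 * y\<^sup>2 / (4 * (x - y)\<^sup>2) = 1 / (4 * (1 / x - 1 / y)\<^sup>2)"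
  proof -
    have "1 / x - 1 / y = (y - x) / (x * y)" using assms by (simp add: field_simps)
    then have "(1 / x - 1 / y)\<^sup>2 = (x - y)\<^sup>2 / (x\<^sup>2 * y\<^sup>2)"
      by (simp add: power_divide power_mult_distrib power2_commute)
    then show ?thesis by simp
  qed
  have c: "2 * (1 / (2 * (1 / z - 1 / x))) * (1 / z - 1 / x) = 1" using ne by simp
  have d: "2 * (1 / (2 * (1 / z - 1 / y))) * (1 / z - 1 / y) = 1" using ne by simp
  have g: "4 / z - 2 / x - 2 / y = 4 * (1 / z) - 2 * (1 / x) - 2 * (1 / y)" by simp
  show ?thesis
    unfolding X_Q[OF assms(1-5) c d] f T_def g
    by (rule T_alg[OF ne', of "Dt z x y t" "A z t" "D 1 (A x) t" "A y t" "A x t" "D 1 (A y) t" "D 1 (A z) t"])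
qed

text \<open>Numerator and denominator of the determinant term both change sign, and the other three
  terms are permuted. This transposition corresponds to exchanging the derivative index with the
  first index of p.\<close>

lemma T_swap: "T z x y t = T x z y t"
proof -
  have "Dt z x y t = - Dt x z y t" by (simp add: Dt_def algebra_simps)
  moreover have "(1/x - 1/y) * (1/z - 1/x) * (1/z - 1/y) = - ((1/z - 1/y) * (1/x - 1/z) * (1/x - 1/y))"
    by (simp add: algebra_simps)
  ultimately show ?thesis unfolding T_def by (simp add: mult_ac add_ac)
qed

end

section \<open>Bivariate polynomials\<close>

text \<open>The diagonal, where P is not given by its formula, is avoided by adding \<open>y\<close>
  to the exceptional set for \<open>x\<close>.\<close>

lemma coeff2_zero:
  fixes c :: "nat \<Rightarrow> nat \<Rightarrow> 'a::{idom, ring_char_0}"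
  assumes "finite F" "\<And>x y. x \<notin> F \<Longrightarrow> y \<notin> F \<Longrightarrow> x \<noteq> y \<Longrightarrow> (\<Sum>i\<le>M. (\<Sum>j\<le>M. c i j * y ^ j) * x ^ i) = 0"
    and "i \<le> M" "j \<le> M"
  shows "c i j = 0"
proof (rule coeff_zero[OF assms(1) _ assms(4)])
  fix y assume y: "y \<notin> F"
  show "(\<Sum>j\<le>M. c i j * y ^ j) = 0"
    by (rule coeff_zero[where F="insert y F" and c="\<lambda>i. \<Sum>j\<le>M. c i j * y ^ j", OF _ _ assms(3)])
       (use assms(1,2) y in auto)
qed

lemma coeff3_zero:
  fixes c :: "nat \<Rightarrow> nat \<Rightarrow> nat \<Rightarrow> 'a::{idom, ring_char_0}"
  assumes "finite F" "\<And>x y z. x \<notin> F \<Longrightarrow> y \<notin> F \<Longrightarrow> z \<notin> F \<Longrightarrow> x \<noteq> y \<Longrightarrow> z \<noteq> x \<Longrightarrow> z \<noteq> y \<Longrightarrow>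
      (\<Sum>k\<le>M. (\<Sum>i\<le>M. (\<Sum>j\<le>M. c k i j * y ^ j) * x ^ i) * z ^ k) = 0"
    and "k \<le> M" "i \<le> M" "j \<le> M"
  shows "c k i j = 0"
proof (rule coeff2_zero[OF assms(1) _ assms(4,5)])
  fix x y assume xy: "x \<notin> F" "y \<notin> F" "x \<noteq> y"
  show "(\<Sum>i\<le>M. (\<Sum>j\<le>M. c k i j * y ^ j) * x ^ i) = 0"
    by (rule coeff_zero[where F="insert x (insert y F)"
          and c="\<lambda>k. \<Sum>i\<le>M. (\<Sum>j\<le>M. c k i j * y ^ j) * x ^ i", OF _ _ assms(3)])
       (use assms(1,2) xy in auto)
qed

text \<open>Terms are grouped by total degree. With arbitrary \<open>h\<close> the same regrouping
  serves ordinary powers and polarizations.\<close>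

lemma sum_collect:
  fixes n :: "nat \<Rightarrow> nat \<Rightarrow> 'a::comm_ring_1"
  shows "(\<Sum>i\<le>M. \<Sum>j\<le>M. n i j * h (i + j))
    = (\<Sum>m\<le>2 * M. (\<Sum>i\<le>M. if m \<in> {i..i + M} then n i (m - i) else 0) * h m)"
proof -
  have "(\<Sum>j\<le>M. n i j * h (i + j)) = (\<Sum>m\<le>2 * M. if m \<in> {i..i + M} then n i (m - i) * h m else 0)"
    if "i \<le> M" for i
  proof -
    have "(\<Sum>j\<le>M. n i j * h (i + j)) = (\<Sum>m\<in>{i..i + M}. n i (m - i) * h m)"
      by (rule sum.reindex_bij_witness[of _ "\<lambda>m. m - i" "\<lambda>j. i + j"]) auto
    also have "\<dots> = (\<Sum>m\<in>{..2 * M} \<inter> {i..i + M}. n i (m - i) * h m)"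
      using that by (intro sum.cong) auto
    also have "\<dots> = (\<Sum>m\<le>2 * M. if m \<in> {i..i + M} then n i (m - i) * h m else 0)"
      by (rule sum.inter_restrict) simp
    finally show ?thesis .
  qed
  then have "(\<Sum>i\<le>M. \<Sum>j\<le>M. n i j * h (i + j))
      = (\<Sum>i\<le>M. \<Sum>m\<le>2 * M. if m \<in> {i..i + M} then n i (m - i) * h m else 0)"
    by simp
  also have "\<dots> = (\<Sum>m\<le>2 * M. \<Sum>i\<le>M. if m \<in> {i..i + M} then n i (m - i) * h m else 0)"
    by (rule sum.swap)
  also have "\<dots> = (\<Sum>m\<le>2 * M. (\<Sum>i\<le>M. if m \<in> {i..i + M} then n i (m - i) else 0) * h m)"
    unfolding sum_distrib_right by (intro sum.cong refl) simp
  finally show ?thesis .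
qed

text \<open>The symmetric polarization of \<open>x ^ m\<close> of lowest possible degree in each variable; the generating
  function \<open>\<mu>(\<xi>, \<eta>)\<close> is the image of the curve equation under it.\<close>

definition polarize :: "nat \<Rightarrow> 'a::field_char_0 \<Rightarrow> 'a \<Rightarrow> 'a" where
  "polarize m x y = (if even m then (x * y) ^ (m div 2) else (x + y) / 2 * (x * y) ^ (m div 2))"

text \<open>The strict degree bound in each variable is what later confines the indices of p to
  1..g.\<close>

definition bispan :: "nat \<Rightarrow> ('a::field_char_0 \<Rightarrow> 'a \<Rightarrow> 'a) \<Rightarrow> bool" where
  "bispan M H \<longleftrightarrow> (\<exists>s. \<forall>x y. H x y = (\<Sum>i<M. \<Sum>j<M. s i j * (x ^ i * y ^ j)))"

lemma bispan_monom:
  assumes "a < M" "b < M"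
  shows "bispan M (\<lambda>x y. x ^ a * y ^ b)"
proof -
  have "(\<Sum>i<M. \<Sum>j<M. (if i = a \<and> j = b then 1 else 0) * (x ^ i * y ^ j)) = x ^ a * y ^ b" for x y :: 'a
  proof -
    have "(\<Sum>i<M. \<Sum>j<M. (if i = a \<and> j = b then 1 else 0) * (x ^ i * y ^ j))
        = (\<Sum>i<M. \<Sum>j<M. if j = b then if i = a then x ^ i * y ^ j else 0 else 0)"
      by (intro sum.cong refl) auto
    also have "\<dots> = x ^ a * y ^ b"
      using assms by (simp only: sum.delta finite_lessThan lessThan_iff if_True)
    finally show ?thesis .
  qed
  then show ?thesis unfolding bispan_def
    by (intro exI[of _ "\<lambda>i j. if i = a \<and> j = b then 1 else 0"] allI) (rule sym)
qed

lemma bispan_zero: "bispan M (\<lambda>x y. 0)"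
  unfolding bispan_def by (rule exI[of _ "\<lambda>i j. 0"]) simp

lemma bispan_add: "bispan M H \<Longrightarrow> bispan M H' \<Longrightarrow> bispan M (\<lambda>x y. H x y + H' x y)"
  unfolding bispan_def
proof (elim exE)
  fix s s' assume "\<forall>x y. H x y = (\<Sum>i<M. \<Sum>j<M. s i j * (x ^ i * y ^ j))"
    "\<forall>x y. H' x y = (\<Sum>i<M. \<Sum>j<M. s' i j * (x ^ i * y ^ j))"
  then show "\<exists>s. \<forall>x y. H x y + H' x y = (\<Sum>i<M. \<Sum>j<M. s i j * (x ^ i * y ^ j))"
    by (intro exI[of _ "\<lambda>i j. s i j + s' i j"]) (simp add: distrib_right sum.distrib)
qed

lemma bispan_sum: "(\<And>i. i \<in> I \<Longrightarrow> bispan M (H i)) \<Longrightarrow> bispan M (\<lambda>x y. \<Sum>i\<in>I. H i x y)"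
  by (induction I rule: infinite_finite_induct) (simp_all add: bispan_zero bispan_add)

text \<open>Splitting d into its upper and lower halves yields two factors, each divisible by x - y;
  this is the source of the square.\<close>

lemma power_sum_minus_polarize:
  fixes x y :: "'a::field_char_0"
  shows "x ^ d + y ^ d - 2 * polarize d x y
    = (x ^ (d - d div 2) - y ^ (d - d div 2)) * (x ^ (d div 2) - y ^ (d div 2))"
proof (cases "even d")
  case True
  then obtain k where d: "d = k + k" by (auto elim: evenE simp: mult_2)
  then have e: "d div 2 = k" "d - k = k" by auto
  have p: "polarize d x y = x ^ k * y ^ k" using True e by (simp add: polarize_def power_mult_distrib)
  show ?thesis unfolding e p unfolding d power_add by algebra
next
  case False
  then obtain k where d: "d = Suc (k + k)" by (auto elim: oddE simp: mult_2)
  then have e: "d div 2 = k" "d - k = Suc k" by auto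
  have p: "2 * polarize d x y = (x + y) * (x ^ k * y ^ k)"
    using False e by (simp add: polarize_def power_mult_distrib)
  show ?thesis unfolding e p unfolding d power_add power_Suc by algebra
qed

lemma polarize_add_even: "polarize (2 * i + d) x y = (x * y) ^ i * polarize d x y"
  by (simp add: polarize_def power_add)

text \<open>After (xy)^i is split off, both factors of \<open>power_sum_minus_polarize\<close> are
  geometric sums times x - y. The quotient has degree i + (c - 1) + (f - 1) = j - 2 in each variable
  when both sums are nonempty, which is below M.\<close>

lemma symmetrized_monom_le:
  fixes i j :: nat
  assumes "i \<le> j" "j \<le> Suc M"
  shows "\<exists>H :: 'a::field_char_0 \<Rightarrow> 'a \<Rightarrow> 'a. bispan M H \<and>
    (\<forall>x y. x ^ i * y ^ j + x ^ j * y ^ i - 2 * polarize (i + j) x y = (x - y)\<^sup>2 * H x y)"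
proof -
  define d where "d = j - i"
  define f where "f = d div 2"
  define c where "c = d - f"
  define H :: "'a \<Rightarrow> 'a \<Rightarrow> 'a" where "H x y = (\<Sum>k<c. \<Sum>l<f. x ^ (i + k + l) * y ^ (i + (c - Suc k) + (f - Suc l)))" for x y
  have j: "j = i + d" and cf: "c + f = d" using assms(1) by (auto simp: d_def c_def f_def)
  have "bispan M H" unfolding H_def
  proof (intro bispan_sum bispan_monom)
    fix k l assume "k \<in> {..<c}" "l \<in> {..<f}"
    then show "i + k + l < M" "i + (c - Suc k) + (f - Suc l) < M"
      using assms(2) j cf by auto
  qed
  moreover have "x ^ i * y ^ j + x ^ j * y ^ i - 2 * polarize (i + j) x y = (x - y)\<^sup>2 * H x y" for x y
  proof -
    have "x ^ i * y ^ j + x ^ j * y ^ i - 2 * polarize (i + j) x y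
        = (x * y) ^ i * (x ^ d + y ^ d - 2 * polarize d x y)"
    proof -
      have "2 * i + d = i + j" by (simp add: j)
      from polarize_add_even[of i d x y, unfolded this]
      have p: "polarize (i + j) x y = x ^ i * y ^ i * polarize d x y" by (simp only: power_mult_distrib)
      show ?thesis
        unfolding p unfolding j power_add power_mult_distrib by algebra
    qed
    also have "\<dots> = (x * y) ^ i * ((x ^ c - y ^ c) * (x ^ f - y ^ f))"
      by (simp add: power_sum_minus_polarize c_def f_def)
    also have "\<dots> = (x - y)\<^sup>2 * ((x * y) ^ i * ((\<Sum>k<c. y ^ (c - Suc k) * x ^ k) * (\<Sum>l<f. y ^ (f - Suc l) * x ^ l)))"
      unfolding power_diff_sumr2[of x c y] power_diff_sumr2[of x f y] power2_eq_square
      by (simp only: mult_ac)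
    also have "(x * y) ^ i * ((\<Sum>k<c. y ^ (c - Suc k) * x ^ k) * (\<Sum>l<f. y ^ (f - Suc l) * x ^ l)) = H x y"
      unfolding H_def sum_product unfolding sum_distrib_left
      by (intro sum.cong refl) (simp only: power_add power_mult_distrib mult_ac)
    finally show ?thesis .
  qed
  ultimately show ?thesis by blast
qed

lemma symmetrized_monom:
  assumes "i \<le> Suc M" "j \<le> Suc M"
  shows "\<exists>s. \<forall>x y :: 'a::field_char_0. x ^ i * y ^ j + x ^ j * y ^ i - 2 * polarize (i + j) x y
    = (x - y)\<^sup>2 * (\<Sum>a<M. \<Sum>b<M. s a b * (x ^ a * y ^ b))"
proof -
  have "\<exists>H :: 'a \<Rightarrow> 'a \<Rightarrow> 'a. bispan M H \<and>
    (\<forall>x y. x ^ i * y ^ j + x ^ j * y ^ i - 2 * polarize (i + j) x y = (x - y)\<^sup>2 * H x y)"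
  proof (cases "i \<le> j")
    case True
    then show ?thesis using symmetrized_monom_le assms by blast
  next
    case False
    then have "j \<le> i" by simp
    from symmetrized_monom_le[OF this assms(1), where 'a='a]
    obtain H :: "'a \<Rightarrow> 'a \<Rightarrow> 'a" where "bispan M H"
      "\<forall>x y. x ^ j * y ^ i + x ^ i * y ^ j - 2 * polarize (j + i) x y = (x - y)\<^sup>2 * H x y" by blast
    then show ?thesis unfolding add.commute[of j i] by (intro exI[of _ H]) (simp add: add.commute)
  qed
  then obtain H :: "'a \<Rightarrow> 'a \<Rightarrow> 'a" where H: "bispan M H"
    "\<forall>x y. x ^ i * y ^ j + x ^ j * y ^ i - 2 * polarize (i + j) x y = (x - y)\<^sup>2 * H x y" by blast
  from H(1) obtain s where "\<forall>x y. H x y = (\<Sum>a<M. \<Sum>b<M. s a b * (x ^ a * y ^ b))"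
    unfolding bispan_def ..
  with H(2) show ?thesis by (intro exI[of _ s]) simp
qed

lemma sum_even_odd:
  fixes h :: "nat \<Rightarrow> 'a::comm_monoid_add"
  shows "(\<Sum>i = 1..2 * M. h i) = (\<Sum>i = 1..M. h (2 * i)) + (\<Sum>i<M. h (2 * i + 1))"
  by (induction M) (simp_all add: add_ac One_nat_def)

section \<open>The coefficients of the basic generating function\<close>

lemma sum_sum_product:
  fixes f h :: "nat \<Rightarrow> 'a::comm_ring_1"
  shows "(\<Sum>i\<le>M. \<Sum>j\<le>M. (f i * h j) * (x ^ i * y ^ j)) = (\<Sum>i\<le>M. f i * x ^ i) * (\<Sum>j\<le>M. h j * y ^ j)"
  unfolding sum_product by (simp add: mult_ac)

lemma sum_swap3:
  "(\<Sum>a\<in>I. \<Sum>b\<in>J. \<Sum>k\<in>L. f a b k) = (\<Sum>k\<in>L. \<Sum>a\<in>I. \<Sum>b\<in>J. f a b k)"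
proof -
  have "(\<Sum>a\<in>I. \<Sum>b\<in>J. \<Sum>k\<in>L. f a b k) = (\<Sum>a\<in>I. \<Sum>k\<in>L. \<Sum>b\<in>J. f a b k)"
    by (rule sum.cong[OF refl], rule sum.swap)
  also have "\<dots> = (\<Sum>k\<in>L. \<Sum>a\<in>I. \<Sum>b\<in>J. f a b k)" by (rule sum.swap)
  finally show ?thesis .
qed

lemma sum_sum_exchange:
  fixes n :: "'b \<Rightarrow> 'c \<Rightarrow> 'a::comm_ring_1"
  shows "(\<Sum>a\<in>I. \<Sum>b\<in>J. (\<Sum>k\<in>I'. \<Sum>l\<in>J'. n k l * s k l a b) * m a b)
    = (\<Sum>k\<in>I'. \<Sum>l\<in>J'. n k l * (\<Sum>a\<in>I. \<Sum>b\<in>J. s k l a b * m a b))"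
proof -
  have "(\<Sum>a\<in>I. \<Sum>b\<in>J. (\<Sum>k\<in>I'. \<Sum>l\<in>J'. n k l * s k l a b) * m a b)
      = (\<Sum>a\<in>I. \<Sum>b\<in>J. \<Sum>k\<in>I'. \<Sum>l\<in>J'. n k l * (s k l a b * m a b))"
    by (simp only: sum_distrib_right mult.assoc)
  also have "\<dots> = (\<Sum>k\<in>I'. \<Sum>a\<in>I. \<Sum>b\<in>J. \<Sum>l\<in>J'. n k l * (s k l a b * m a b))"
    by (rule sum_swap3)
  also have "\<dots> = (\<Sum>k\<in>I'. \<Sum>l\<in>J'. \<Sum>a\<in>I. \<Sum>b\<in>J. n k l * (s k l a b * m a b))"
    by (rule sum.cong[OF refl], rule sum_swap3)
  finally show ?thesis by (simp only: sum_distrib_left)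
qed

context kdv begin

definition sh :: "(nat \<Rightarrow> 'k ^ 'n \<Rightarrow> 'k) \<Rightarrow> nat \<Rightarrow> 'k ^ 'n \<Rightarrow> 'k" where
  "sh c i = (\<lambda>t. if i = 0 then 0 else c (i - 1) t)"

lemma sm_sh [simp]: "(\<And>j. sm (c j)) \<Longrightarrow> sm (sh c i)"
  by (cases "i = 0") (simp_all add: sh_def)

lemma sum_sh: "(\<Sum>i\<le>Suc M. sh c i t * x ^ i) = x * (\<Sum>j\<le>M. c j t * x ^ j)"
  unfolding sum.atMost_Suc_shift by (simp add: sh_def sum_distrib_left mult_ac)

text \<open>Shifting indices stands for multiplication by \<open>\<xi>\<close>; the symmetrization of
  \<open>\<Sum> n\<^sub>i\<^sub>j \<xi>\<^sup>i \<eta>\<^sup>j\<close> is \<open>2 \<xi> \<eta> Q(\<xi>, \<eta>)\<close>, and its diagonal is \<open>\<xi>\<^sup>2\<close> times the right-hand side of the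
  curve equation.\<close>

definition n :: "nat \<Rightarrow> nat \<Rightarrow> 'k ^ 'n \<Rightarrow> 'k" where
  "n i j t = sh (\<lambda>j. D 1 (a j)) i t * sh (\<lambda>j. D 1 (a j)) j t
    - 2 * (sh a i t * sh (\<lambda>j. D 1 (D 1 (a j))) j t)
    + 4 * (a i t * sh a j t) + 4 * (u 1 t * (sh a i t * sh a j t))"

lemma sm_n: "sm (n i j)"
  unfolding n_def[abs_def] by simp

lemma sum_n:
  "(\<Sum>i\<le>Suc CARD('n). \<Sum>j\<le>Suc CARD('n). n i j t * (x ^ i * y ^ j))
    = x * D 1 (A x) t * (y * D 1 (A y) t) - 2 * (x * A x t * (y * D 1 (D 1 (A y)) t))
      + 4 * (A x t * (y * A y t)) + 4 * (u 1 t * (x * A x t * (y * A y t)))"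
proof -
  have n: "n i j t * (x ^ i * y ^ j) = (sh (\<lambda>j. D 1 (a j)) i t * sh (\<lambda>j. D 1 (a j)) j t) * (x ^ i * y ^ j)
    - 2 * ((sh a i t * sh (\<lambda>j. D 1 (D 1 (a j))) j t) * (x ^ i * y ^ j))
    + 4 * ((a i t * sh a j t) * (x ^ i * y ^ j)) + 4 * (u 1 t * ((sh a i t * sh a j t) * (x ^ i * y ^ j)))" for i j
    by (simp add: n_def algebra_simps)
  have A: "(\<Sum>i\<le>Suc CARD('n). a i t * x ^ i) = A x t"
    by (simp add: A_def a_big)
  have A1: "(\<Sum>j\<le>CARD('n). D 1 (a j) t * x ^ j) = D 1 (A x) t" for x
    by (simp add: D_A)
  have A2: "(\<Sum>j\<le>CARD('n). D 1 (D 1 (a j)) t * x ^ j) = D 1 (D 1 (A x)) t" for x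
    by (simp add: D_A)
  show ?thesis
    unfolding n sum.distrib sum_subtractf sum_distrib_left[of "2", symmetric] sum_distrib_left[of "4", symmetric]
      sum_distrib_left[of "u 1 t", symmetric] sum_sum_product sum_sh A A1 A2 A_def[symmetric] ..
qed

text \<open>The coefficient of x^m in x^2 times \<open>K x\<close>.\<close>

definition nu :: "nat \<Rightarrow> 'k ^ 'n \<Rightarrow> 'k" where
  "nu m t = (\<Sum>i\<le>Suc CARD('n). if m \<in> {i..i + Suc CARD('n)} then n i (m - i) t else 0)"

lemma sum_n_collect:
  "(\<Sum>i\<le>Suc CARD('n). \<Sum>j\<le>Suc CARD('n). n i j t * h (i + j)) = (\<Sum>m\<le>2 * Suc CARD('n). nu m t * h m)"
  unfolding nu_def by (rule sum_collect)

lemma sum_nu: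
  assumes "x \<noteq> 0"
  shows "(\<Sum>m\<le>2 * Suc CARD('n). nu m t * x ^ m) = x\<^sup>2 * K x t"
proof -
  have "(\<Sum>m\<le>2 * Suc CARD('n). nu m t * x ^ m)
    = (\<Sum>i\<le>Suc CARD('n). \<Sum>j\<le>Suc CARD('n). n i j t * (x ^ i * x ^ j))"
    unfolding sum_n_collect[of t "\<lambda>m. x ^ m", symmetric] by (simp only: power_add)
  also have "\<dots> = x\<^sup>2 * K x t"
    unfolding sum_n K_def using assms by (simp add: field_simps power2_eq_square)
  finally show ?thesis .
qed

text \<open>The value 16 is 4 times the square of \<open>a 0\<close> and produces the pole 4/\<xi>
  of the curve. In degree 2 the contributions -16 u_1 and 16 u_1 cancel, so the curve has no
  constant term.\<close>

lemma nu_low: "nu 0 t = 0" "nu 1 t = 16" "nu 2 t = 0"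
proof -
  have r: "nu m t = (\<Sum>i\<in>{0, 1, 2}. if m \<in> {i..i + Suc CARD('n)} then n i (m - i) t else 0)" if "m \<le> 2" for m
    unfolding nu_def
  proof (rule sum.mono_neutral_right)
    show "{0, 1, 2} \<subseteq> {..Suc CARD('n)}" using N_pos by auto
  qed (use that in auto)
  have a0: "a 0 = (\<lambda>t. 2)" "a (Suc 0) t = - u 1 t" using a_0 a_1 by (simp_all add: One_nat_def)
  show "nu 0 t = 0" by (subst r) (simp_all add: n_def sh_def)
  show "nu 1 t = 16" using N_pos by (subst r) (simp_all add: n_def sh_def a0)
  show "nu 2 t = 0" using N_pos by (subst r) (simp_all add: n_def sh_def a0 a_1 numeral_2_eq_2 One_nat_def)
qed

definition mcurve :: "'k ^ 'n \<Rightarrow> nat \<Rightarrow> 'k" where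
  "mcurve t i = (if i \<in> {1..2 * CARD('n)} then nu (i + 2) t / 4 else 0)"

text \<open>The curve equation as an identity of coefficient sequences. Powers inserted for
  \<open>h\<close> give the equation itself, polarizations give \<mu>(\<xi>, \<eta>).\<close>

lemma sum_nu_mcurve:
  "(\<Sum>m\<le>2 * Suc CARD('n). nu m t * h m) = 16 * h 1 + 4 * (\<Sum>i = 1..2 * CARD('n). mcurve t i * h (i + 2))"
proof -
  have "(\<Sum>m\<le>2 * Suc CARD('n). nu m t * h m) = (\<Sum>m\<le>Suc (Suc (2 * CARD('n))). nu m t * h m)"
    by simp
  also have "\<dots> = nu 0 t * h 0 + nu 1 t * h 1 + (\<Sum>m\<le>2 * CARD('n). nu (m + 2) t * h (m + 2))"
    unfolding sum.atMost_Suc_shift by (simp add: One_nat_def)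
  also have "(\<Sum>m\<le>2 * CARD('n). nu (m + 2) t * h (m + 2)) = (\<Sum>m = 1..2 * CARD('n). nu (m + 2) t * h (m + 2))"
    by (rule sum_atMost_1) (use nu_low(3) in \<open>simp add: numeral_2_eq_2\<close>)
  also have "\<dots> = 4 * (\<Sum>i = 1..2 * CARD('n). mcurve t i * h (i + 2))"
    unfolding sum_distrib_left by (rule sum.cong) (auto simp: mcurve_def)
  finally show ?thesis by (simp add: nu_low)
qed

lemma curve_eq_iff:
  assumes "t \<in> U"
  shows "curve_eq e u t m \<longleftrightarrow> (\<forall>x. x \<noteq> 0 \<longrightarrow> 4 * (4 / x + (\<Sum>i = 1..2 * CARD('n). m i * x ^ i)) = K x t)"
proof -
  have "(- D 1 (A x) t)\<^sup>2 + 2 * - D 1 (D 1 (A x)) t * A x t + 4 * (1 / x + u 1 t) * (A x t)\<^sup>2 = K x t" for x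
    by (simp add: K_def power2_eq_square algebra_simps)
  then show ?thesis
    unfolding curve_eq_def poly_gen_u poly_dx[OF assms] poly_dx2[OF assms] by simp
qed

lemma curve_eq_mcurve:
  assumes "t \<in> U"
  shows "curve_eq e u t (mcurve t)"
  unfolding curve_eq_iff[OF assms]
proof (intro allI impI)
  fix x :: 'k assume x: "x \<noteq> 0"
  have "x\<^sup>2 * K x t = 16 * x + 4 * (\<Sum>i = 1..2 * CARD('n). mcurve t i * x ^ (i + 2))"
    using sum_nu[OF x, of t] sum_nu_mcurve[of t "\<lambda>m. x ^ m"] by simp
  also have "(\<Sum>i = 1..2 * CARD('n). mcurve t i * x ^ (i + 2)) = x\<^sup>2 * (\<Sum>i = 1..2 * CARD('n). mcurve t i * x ^ i)"
    unfolding sum_distrib_left by (rule sum.cong) (simp_all add: power_add power2_eq_square)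
  finally have "x\<^sup>2 * K x t = x\<^sup>2 * (4 * (4 / x + (\<Sum>i = 1..2 * CARD('n). mcurve t i * x ^ i)))"
    using x by (simp add: field_simps power2_eq_square)
  then show "4 * (4 / x + (\<Sum>i = 1..2 * CARD('n). mcurve t i * x ^ i)) = K x t" using x by simp
qed

lemma curve_mu: 
  assumes "t \<in> U"
  shows "curve_mu e u t = mcurve t"
  unfolding curve_mu_def
proof (rule the_equality)
  show "curve_eq e u t (mcurve t) \<and> (\<forall>i. i \<notin> {1..2 * CARD('n)} \<longrightarrow> mcurve t i = 0)"
    using curve_eq_mcurve[OF assms] by (auto simp: mcurve_def)
  fix m assume m: "curve_eq e u t m \<and> (\<forall>i. i \<notin> {1..2 * CARD('n)} \<longrightarrow> m i = 0)"
  have z: "m 0 = 0" "mcurve t 0 = 0" using m by (auto simp: mcurve_def)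
  have "m i = mcurve t i" if "i \<le> 2 * CARD('n)" for i
  proof (rule coeff_eq[where F="{0}", OF _ _ that])
    fix x :: 'k assume "x \<notin> {0}"
    then have "4 * (4 / x + (\<Sum>i = 1..2 * CARD('n). m i * x ^ i))
        = 4 * (4 / x + (\<Sum>i = 1..2 * CARD('n). mcurve t i * x ^ i))"
      using m curve_eq_mcurve[OF assms] unfolding curve_eq_iff[OF assms] by simp
    then show "(\<Sum>i\<le>2 * CARD('n). m i * x ^ i) = (\<Sum>i\<le>2 * CARD('n). mcurve t i * x ^ i)"
      using sum_atMost_1[of "\<lambda>i. m i * x ^ i"] sum_atMost_1[of "\<lambda>i. mcurve t i * x ^ i"] z by simp
  qed simp
  moreover have "m i = mcurve t i" if "\<not> i \<le> 2 * CARD('n)" for i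
    using m that by (simp add: mcurve_def)
  ultimately show "m = mcurve t" by blast
qed

text \<open>Polarization maps x^(i+2) to xy times the polarization of x^i, and 16 times that of x is
  8(x + y), which is 2xy(4/x + 4/y).\<close>

lemma mu_gen_eq:
  assumes "t \<in> U" "x \<noteq> 0" "y \<noteq> 0"
  shows "2 * (x * y) * mu_gen e u t x y
    = (\<Sum>i\<le>Suc CARD('n). \<Sum>j\<le>Suc CARD('n). n i j t * polarize (i + j) x y)"
proof -
  have "(\<Sum>i\<le>Suc CARD('n). \<Sum>j\<le>Suc CARD('n). n i j t * polarize (i + j) x y)
    = 16 * polarize 1 x y + 4 * (\<Sum>i = 1..2 * CARD('n). mcurve t i * polarize (i + 2) x y)"
    unfolding sum_n_collect[of t "\<lambda>m. polarize m x y"] sum_nu_mcurve ..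
  also have "polarize (i + 2) x y = x * y * polarize i x y" for i
    using polarize_add_even[of 1 i x y] by (simp add: add.commute)
  then have "(\<Sum>i = 1..2 * CARD('n). mcurve t i * polarize (i + 2) x y)
    = x * y * (\<Sum>i = 1..2 * CARD('n). mcurve t i * polarize i x y)"
    by (simp add: sum_distrib_left mult_ac)
  also have "(\<Sum>i = 1..2 * CARD('n). mcurve t i * polarize i x y)
    = (\<Sum>i = 1..CARD('n). mcurve t (2 * i) * x ^ i * y ^ i)
      + 1 / 2 * (\<Sum>i<CARD('n). mcurve t (2 * i + 1) * (x + y) * x ^ i * y ^ i)"
    unfolding sum_even_odd by (simp add: polarize_def power_mult_distrib sum_distrib_left mult_ac)
  finally have *: "(\<Sum>i\<le>Suc CARD('n). \<Sum>j\<le>Suc CARD('n). n i j t * polarize (i + j) x y)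
    = 16 * polarize 1 x y + 4 * (x * y * ((\<Sum>i = 1..CARD('n). mcurve t (2 * i) * x ^ i * y ^ i)
      + 1 / 2 * (\<Sum>i<CARD('n). mcurve t (2 * i + 1) * (x + y) * x ^ i * y ^ i)))" .
  show ?thesis
    unfolding * mu_gen_def curve_mu[OF assms(1)] using assms(2,3)
    by (simp add: polarize_def field_simps)
qed

text \<open>The quotients by (x - y)^2 are chosen once as constants independent of t, so that p
  inherits smoothness from \<open>n\<close>.\<close>

definition Sc :: "nat \<Rightarrow> nat \<Rightarrow> nat \<Rightarrow> nat \<Rightarrow> 'k" where
  "Sc = (SOME S. \<forall>i j. i \<le> Suc CARD('n) \<longrightarrow> j \<le> Suc CARD('n) \<longrightarrow>
    (\<forall>x y :: 'k. x ^ i * y ^ j + x ^ j * y ^ i - 2 * polarize (i + j) x y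
    = (x - y)\<^sup>2 * (\<Sum>a<CARD('n). \<Sum>b<CARD('n). S i j a b * (x ^ a * y ^ b))))"

lemma Sc:
  assumes "i \<le> Suc CARD('n)" "j \<le> Suc CARD('n)"
  shows "x ^ i * y ^ j + x ^ j * y ^ i - 2 * polarize (i + j) x y
    = (x - y)\<^sup>2 * (\<Sum>a<CARD('n). \<Sum>b<CARD('n). Sc i j a b * (x ^ a * y ^ b))"
proof -
  have "\<forall>i j. \<exists>s. i \<le> Suc CARD('n) \<longrightarrow> j \<le> Suc CARD('n) \<longrightarrow>
    (\<forall>x y :: 'k. x ^ i * y ^ j + x ^ j * y ^ i - 2 * polarize (i + j) x y
    = (x - y)\<^sup>2 * (\<Sum>a<CARD('n). \<Sum>b<CARD('n). s a b * (x ^ a * y ^ b)))"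
    using symmetrized_monom by blast
  then have "\<exists>S. \<forall>i j. i \<le> Suc CARD('n) \<longrightarrow> j \<le> Suc CARD('n) \<longrightarrow>
    (\<forall>x y :: 'k. x ^ i * y ^ j + x ^ j * y ^ i - 2 * polarize (i + j) x y
    = (x - y)\<^sup>2 * (\<Sum>a<CARD('n). \<Sum>b<CARD('n). S i j a b * (x ^ a * y ^ b)))"
    unfolding choice_iff .
  from someI_ex[OF this, folded Sc_def] assms show ?thesis by blast
qed

text \<open>Up to sign, the symmetrized and polarized sums of \<open>n\<close> make up 2xy(2\<mu> -
  Q); the prefactor of P leaves xy/8 for the quotient. Hence the constant - 1 / 8, and the index
  shift from the factor xy.\<close>

definition p :: "nat \<Rightarrow> nat \<Rightarrow> 'k ^ 'n \<Rightarrow> 'k" where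
  "p i j t = (if i \<in> {1..CARD('n)} \<and> j \<in> {1..CARD('n)} then
    (\<Sum>k\<le>Suc CARD('n). \<Sum>l\<le>Suc CARD('n). n k l t * (- 1 / 8 * Sc k l (i - 1) (j - 1))) else 0)"

lemma sm_p: "sm (p i j)"
  by (cases "i \<in> {1..CARD('n)} \<and> j \<in> {1..CARD('n)}")
     (simp_all only: p_def[abs_def] if_True if_False simp_thms sm_sum sm_mult sm_n sm_const)

lemma p_0: "p 0 j t = 0" "p i 0 t = 0"
  by (simp_all add: p_def)

definition Psum :: "'k \<Rightarrow> 'k \<Rightarrow> 'k ^ 'n \<Rightarrow> 'k" where
  "Psum x y t = (\<Sum>i\<le>CARD('n). (\<Sum>j\<le>CARD('n). p i j t * y ^ j) * x ^ i)"

text \<open>Free of division, hence valid also at x = 0, where \<open>p_1\<close> evaluates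
  it.\<close>

lemma Psum_eq:
  "8 * (x - y)\<^sup>2 * (\<Sum>i<CARD('n). (\<Sum>j<CARD('n). p (Suc i) (Suc j) t * y ^ j) * x ^ i)
    = - (\<Sum>k\<le>Suc CARD('n). \<Sum>l\<le>Suc CARD('n). n k l t * (x ^ k * y ^ l + x ^ l * y ^ k - 2 * polarize (k + l) x y))"
proof -
  have "(\<Sum>i<CARD('n). (\<Sum>j<CARD('n). p (Suc i) (Suc j) t * y ^ j) * x ^ i)
    = (\<Sum>i<CARD('n). \<Sum>j<CARD('n). (\<Sum>k\<le>Suc CARD('n). \<Sum>l\<le>Suc CARD('n). n k l t * (- 1 / 8 * Sc k l i j)) * (x ^ i * y ^ j))"
    unfolding sum_distrib_right[of _ _ "x ^ _"] by (intro sum.cong refl) (auto simp: p_def One_nat_def mult_ac)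
  also have "\<dots> = (\<Sum>k\<le>Suc CARD('n). \<Sum>l\<le>Suc CARD('n). n k l t * (\<Sum>i<CARD('n). \<Sum>j<CARD('n). (- 1 / 8 * Sc k l i j) * (x ^ i * y ^ j)))"
    by (rule sum_sum_exchange)
  finally have e: "(\<Sum>i<CARD('n). (\<Sum>j<CARD('n). p (Suc i) (Suc j) t * y ^ j) * x ^ i) = \<dots>" .
  have "- 8 * (x - y)\<^sup>2 * (n k l t * (\<Sum>i<CARD('n). \<Sum>j<CARD('n). (- 1 / 8 * Sc k l i j) * (x ^ i * y ^ j)))
      = n k l t * (x ^ k * y ^ l + x ^ l * y ^ k - 2 * polarize (k + l) x y)"
    if "k \<in> {..Suc CARD('n)}" "l \<in> {..Suc CARD('n)}" for k l
  proof -
    have "(\<Sum>i<CARD('n). \<Sum>j<CARD('n). (- 1 / 8 * Sc k l i j) * (x ^ i * y ^ j))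
        = - 1 / 8 * (\<Sum>i<CARD('n). \<Sum>j<CARD('n). Sc k l i j * (x ^ i * y ^ j))"
      unfolding sum_distrib_left by (simp only: mult.assoc)
    moreover have "x ^ k * y ^ l + x ^ l * y ^ k - 2 * polarize (k + l) x y
      = (x - y)\<^sup>2 * (\<Sum>i<CARD('n). \<Sum>j<CARD('n). Sc k l i j * (x ^ i * y ^ j))"
      using that by (intro Sc) auto
    ultimately show ?thesis by simp
  qed
  then have "- 8 * (x - y)\<^sup>2 * (\<Sum>k\<le>Suc CARD('n). \<Sum>l\<le>Suc CARD('n). n k l t * (\<Sum>i<CARD('n). \<Sum>j<CARD('n). (- 1 / 8 * Sc k l i j) * (x ^ i * y ^ j)))
    = (\<Sum>k\<le>Suc CARD('n). \<Sum>l\<le>Suc CARD('n). n k l t * (x ^ k * y ^ l + x ^ l * y ^ k - 2 * polarize (k + l) x y))"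
    unfolding sum_distrib_left by (intro sum.cong refl)
  then show ?thesis unfolding e by (simp only: minus_mult_left[symmetric] minus_equation_iff)
qed

lemma Psum_shift: "Psum x y t = x * y * (\<Sum>i<CARD('n). (\<Sum>j<CARD('n). p (Suc i) (Suc j) t * y ^ j) * x ^ i)"
  unfolding Psum_def sum.atMost_shift
  by (simp add: p_0 sum_distrib_left sum_distrib_right mult_ac)

lemma sum_n_sym:
  assumes "x \<noteq> 0" "y \<noteq> 0"
  shows "(\<Sum>i\<le>Suc CARD('n). \<Sum>j\<le>Suc CARD('n). n i j t * (x ^ i * y ^ j + x ^ j * y ^ i)) = 2 * (x * y) * Q x y t"
proof -
  have "(\<Sum>i\<le>Suc CARD('n). \<Sum>j\<le>Suc CARD('n). n i j t * (x ^ i * y ^ j + x ^ j * y ^ i))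
    = (\<Sum>i\<le>Suc CARD('n). \<Sum>j\<le>Suc CARD('n). n i j t * (x ^ i * y ^ j))
      + (\<Sum>i\<le>Suc CARD('n). \<Sum>j\<le>Suc CARD('n). n i j t * (y ^ i * x ^ j))"
    unfolding sum.distrib[symmetric] by (intro sum.cong refl) (simp only: distrib_left mult_ac)
  also have "\<dots> = 2 * (x * y) * Q x y t"
    unfolding sum_n Q_def using assms by (simp add: field_simps)
  finally show ?thesis .
qed

lemma P_gen_eq_Q:
  assumes "t \<in> U"
  shows "P_gen e u t x y = x\<^sup>2 * y\<^sup>2 / (4 * (x - y)\<^sup>2) * (2 * mu_gen e u t x y - Q x y t)"
  unfolding P_gen_def Q_gen_def poly_gen_u poly_dx[OF assms] poly_dx2[OF assms] Q_def
  by (simp add: algebra_simps)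

lemma P_gen_eq_Psum:
  assumes "t \<in> U" "x \<noteq> 0" "y \<noteq> 0" "x \<noteq> y"
  shows "P_gen e u t x y = Psum x y t"
proof -
  define R where "R = (\<Sum>i<CARD('n). (\<Sum>j<CARD('n). p (Suc i) (Suc j) t * y ^ j) * x ^ i)"
  have "8 * (x - y)\<^sup>2 * R = 2 * (\<Sum>i\<le>Suc CARD('n). \<Sum>j\<le>Suc CARD('n). n i j t * polarize (i + j) x y)
      - (\<Sum>i\<le>Suc CARD('n). \<Sum>j\<le>Suc CARD('n). n i j t * (x ^ i * y ^ j + x ^ j * y ^ i))"
  proof -
    have "n i j t * (x ^ i * y ^ j + x ^ j * y ^ i - 2 * polarize (i + j) x y)
      = n i j t * (x ^ i * y ^ j + x ^ j * y ^ i) - 2 * (n i j t * polarize (i + j) x y)" for i j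
      by (simp add: algebra_simps)
    then show ?thesis
      unfolding R_def Psum_eq by (simp only: sum_subtractf sum_distrib_left minus_diff_eq)
  qed
  also have "\<dots> = 2 * (x * y) * (2 * mu_gen e u t x y - Q x y t)"
    unfolding mu_gen_eq[OF assms(1-3), symmetric] sum_n_sym[OF assms(2,3)] by (simp add: algebra_simps)
  finally have "2 * (x * y * (2 * mu_gen e u t x y - Q x y t)) = 2 * (4 * (x - y)\<^sup>2 * R)"
    by algebra
  then have "x * y * (2 * mu_gen e u t x y - Q x y t) = 4 * (x - y)\<^sup>2 * R"
    by (rule mult_left_cancel[THEN iffD1, rotated]) simp
  then have "2 * mu_gen e u t x y - Q x y t = 4 * (x - y)\<^sup>2 * R / (x * y)"
    using assms(2,3) by (simp add: eq_divide_eq mult_ac)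
  then show ?thesis
    unfolding P_gen_eq_Q[OF assms(1)] Psum_shift R_def[symmetric]
    using assms(2-4) by (simp add: power2_eq_square)
qed

lemma p_coeff_eq:
  assumes "t \<in> U"
  shows "p_coeff e u t = (\<lambda>i j. p i j t)"
  unfolding p_coeff_def
proof (rule the_equality)
  have Ps: "Psum x y t = (\<Sum>i = 1..CARD('n). \<Sum>j = 1..CARD('n). p i j t * x ^ i * y ^ j)" for x y
  proof -
    have "(\<Sum>j\<le>CARD('n). p i j t * y ^ j) = (\<Sum>j = 1..CARD('n). p i j t * y ^ j)" for i
      by (rule sum_atMost_1) (simp add: p_0)
    moreover have "Psum x y t = (\<Sum>i = 1..CARD('n). (\<Sum>j\<le>CARD('n). p i j t * y ^ j) * x ^ i)"
      unfolding Psum_def by (rule sum_atMost_1) (simp add: p_0)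
    ultimately show ?thesis by (simp add: sum_distrib_right sum_distrib_left mult_ac)
  qed
  show "(\<forall>\<xi> \<eta>. \<xi> \<noteq> 0 \<longrightarrow> \<eta> \<noteq> 0 \<longrightarrow> \<xi> \<noteq> \<eta> \<longrightarrow>
        P_gen e u t \<xi> \<eta> = (\<Sum>i = 1..CARD('n). \<Sum>j = 1..CARD('n). p i j t * \<xi> ^ i * \<eta> ^ j)) \<and>
    (\<forall>i j. i \<notin> {1..CARD('n)} \<or> j \<notin> {1..CARD('n)} \<longrightarrow> p i j t = 0)"
    using P_gen_eq_Psum[OF assms] by (auto simp: Ps p_def)
  fix q assume q: "(\<forall>\<xi> \<eta>. \<xi> \<noteq> 0 \<longrightarrow> \<eta> \<noteq> 0 \<longrightarrow> \<xi> \<noteq> \<eta> \<longrightarrow>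
        P_gen e u t \<xi> \<eta> = (\<Sum>i = 1..CARD('n). \<Sum>j = 1..CARD('n). q i j * \<xi> ^ i * \<eta> ^ j)) \<and>
    (\<forall>i j. i \<notin> {1..CARD('n)} \<or> j \<notin> {1..CARD('n)} \<longrightarrow> q i j = 0)"
  have "q i j - p i j t = 0" if "i \<le> CARD('n)" "j \<le> CARD('n)" for i j
  proof (rule coeff2_zero[where F="{0}", OF _ _ that])
    fix x y :: 'k assume xy: "x \<notin> {0}" "y \<notin> {0}" "x \<noteq> y"
    have "(\<Sum>i\<le>CARD('n). (\<Sum>j\<le>CARD('n). (q i j - p i j t) * y ^ j) * x ^ i)
      = (\<Sum>i = 1..CARD('n). (\<Sum>j\<le>CARD('n). (q i j - p i j t) * y ^ j) * x ^ i)"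
      by (rule sum_atMost_1) (use q in \<open>simp add: p_0\<close>)
    also have "\<dots> = (\<Sum>i = 1..CARD('n). (\<Sum>j = 1..CARD('n). (q i j - p i j t) * y ^ j) * x ^ i)"
    proof (rule sum.cong[OF refl])
      fix i
      have "(\<Sum>j\<le>CARD('n). (q i j - p i j t) * y ^ j) = (\<Sum>j = 1..CARD('n). (q i j - p i j t) * y ^ j)"
        by (rule sum_atMost_1) (use q in \<open>simp add: p_0\<close>)
      then show "(\<Sum>j\<le>CARD('n). (q i j - p i j t) * y ^ j) * x ^ i
        = (\<Sum>j = 1..CARD('n). (q i j - p i j t) * y ^ j) * x ^ i" by simp
    qed
    also have "(\<Sum>i = 1..CARD('n). (\<Sum>j = 1..CARD('n). (q i j - p i j t) * y ^ j) * x ^ i)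
      = (\<Sum>i = 1..CARD('n). \<Sum>j = 1..CARD('n). q i j * x ^ i * y ^ j)
        - (\<Sum>i = 1..CARD('n). \<Sum>j = 1..CARD('n). p i j t * x ^ i * y ^ j)"
      unfolding sum_subtractf[symmetric] sum_distrib_right by (intro sum.cong refl) (simp add: algebra_simps)
    also have "\<dots> = 0"
      using q xy P_gen_eq_Psum[OF assms, of x y] by (simp add: Ps)
    finally show "(\<Sum>i\<le>CARD('n). (\<Sum>j\<le>CARD('n). (q i j - p i j t) * y ^ j) * x ^ i) = 0" .
  qed simp
  moreover have "q i j = p i j t" if "\<not> (i \<le> CARD('n) \<and> j \<le> CARD('n))" for i j
    using q that by (auto simp: p_def)
  ultimately show "q = (\<lambda>i j. p i j t)" by (intro ext) (metis right_minus_eq)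
qed

end

section \<open>Symmetry, first row and closedness of the coefficients p\<close>

context kdv begin

lemma Psum_sym:
  assumes "x \<noteq> y"
  shows "Psum x y t = Psum y x t"
proof -
  define R where "R x y = (\<Sum>i<CARD('n). (\<Sum>j<CARD('n). p (Suc i) (Suc j) t * y ^ j) * x ^ i)" for x y
  have pol: "polarize m y x = polarize m x y" for m
    by (simp add: polarize_def add.commute mult.commute)
  have "8 * (x - y)\<^sup>2 * R x y = 8 * (y - x)\<^sup>2 * R y x"
    unfolding R_def Psum_eq by (simp only: pol mult.commute add.commute)
  then have "R x y = R y x"
    using assms by (simp add: power2_commute)
  then show ?thesis unfolding Psum_shift R_def by (simp add: mult.commute)
qed

lemma p_sym: "p i j t = p j i t"
proof (cases "i \<le> CARD('n) \<and> j \<le> CARD('n)")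
  case True
  have "p i j t - p j i t = 0"
  proof (rule coeff2_zero[where F="{0}" and M="CARD('n)" and c="\<lambda>i j. p i j t - p j i t"])
    fix x y :: 'k assume "x \<noteq> y"
    have "(\<Sum>i\<le>CARD('n). (\<Sum>j\<le>CARD('n). (p i j t - p j i t) * y ^ j) * x ^ i)
      = Psum x y t - (\<Sum>i\<le>CARD('n). \<Sum>j\<le>CARD('n). p j i t * y ^ j * x ^ i)"
      unfolding Psum_def by (simp add: left_diff_distrib sum_subtractf sum_distrib_right)
    also have "(\<Sum>i\<le>CARD('n). \<Sum>j\<le>CARD('n). p j i t * y ^ j * x ^ i)
      = (\<Sum>j\<le>CARD('n). \<Sum>i\<le>CARD('n). p j i t * y ^ j * x ^ i)"
      by (rule sum.swap)
    also have "\<dots> = Psum y x t"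
      unfolding Psum_def by (simp add: sum_distrib_right sum_distrib_left mult_ac)
    finally show "(\<Sum>i\<le>CARD('n). (\<Sum>j\<le>CARD('n). (p i j t - p j i t) * y ^ j) * x ^ i) = 0"
      using Psum_sym[OF \<open>x \<noteq> y\<close>] by simp
  qed (use True in simp_all)
  then show ?thesis by simp
qed (auto simp: p_def)

text \<open>At x = 0 only the row p_1j survives on the left of \<open>Psum_eq\<close>. The
  right-hand side becomes 16y - 8yA(y), so the row has generating function 2 - A(y) = u(y).\<close>

lemma p_1: "j \<in> {1..CARD('n)} \<Longrightarrow> p 1 j t = u j t"
proof -
  assume j: "j \<in> {1..CARD('n)}"
  have "p 1 j t = (if j = 0 then 0 else - a j t)"
  proof (rule coeff_eq[where F="{0}" and c="\<lambda>j. p 1 j t" and N="CARD('n)"])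
    fix y :: 'k assume "y \<notin> {0}"
    then have y: "y \<noteq> 0" by simp
    define R where "R = (\<Sum>j<CARD('n). p 1 (Suc j) t * y ^ j)"
    have R: "(\<Sum>i<CARD('n). (\<Sum>j<CARD('n). p (Suc i) (Suc j) t * y ^ j) * 0 ^ i) = R"
    proof -
      have "(\<Sum>i<CARD('n). (\<Sum>j<CARD('n). p (Suc i) (Suc j) t * y ^ j) * 0 ^ i)
        = (\<Sum>i<CARD('n). if i = 0 then R else 0)"
        by (intro sum.cong refl) (simp add: R_def One_nat_def)
      then show ?thesis by simp
    qed
    \<comment> \<open>Of the polarizations of positive degree only that of degree 1, with value y/2,
      is nonzero at x = 0.\<close>
    have pol: "polarize (m + 2) 0 y = 0" for m
      by (simp add: polarize_def)
    have "8 * (0 - y)\<^sup>2 * R = - (\<Sum>k\<le>Suc CARD('n). \<Sum>l\<le>Suc CARD('n).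
        n k l t * (0 ^ k * y ^ l + 0 ^ l * y ^ k - 2 * polarize (k + l) 0 y))"
      using Psum_eq[of 0 y t] unfolding R .
    also have "(\<Sum>k\<le>Suc CARD('n). \<Sum>l\<le>Suc CARD('n).
        n k l t * (0 ^ k * y ^ l + 0 ^ l * y ^ k - 2 * polarize (k + l) 0 y))
      = (\<Sum>k\<le>Suc CARD('n). \<Sum>l\<le>Suc CARD('n). n k l t * (0 ^ k * y ^ l))
        + (\<Sum>k\<le>Suc CARD('n). \<Sum>l\<le>Suc CARD('n). n k l t * (y ^ k * 0 ^ l))
        - 2 * (\<Sum>k\<le>Suc CARD('n). \<Sum>l\<le>Suc CARD('n). n k l t * polarize (k + l) 0 y)"
      unfolding sum.distrib[symmetric] sum_subtractf[symmetric] sum_distrib_left[of 2]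
      by (intro sum.cong refl) (simp only: right_diff_distrib distrib_left mult_ac)
    also have "\<dots> = 4 * (A 0 t * (y * A y t)) - 16 * y"
      unfolding sum_n sum_n_collect[of t "\<lambda>m. polarize m 0 y"] sum_nu_mcurve pol
      by (simp add: polarize_def)
    also have "A 0 t = (\<Sum>j\<le>CARD('n). if j = 0 then 2 else 0)"
      unfolding A_def by (intro sum.cong refl) (simp add: a_0)
    finally have "8 * y * (y * R) = 8 * y * (2 - A y t)"
      by (simp add: power2_eq_square algebra_simps)
    then have e: "y * R = 2 - A y t" using y by simp
    have "(\<Sum>j\<le>CARD('n). p 1 j t * y ^ j) = y * R"
      unfolding sum.atMost_shift R_def by (simp add: p_0 sum_distrib_left mult_ac)
    also have "\<dots> = (\<Sum>j\<le>CARD('n). (if j = 0 then 0 else - a j t) * y ^ j)"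
      unfolding e A_def sum.atMost_shift by (simp add: a_0 sum_negf)
    finally show "(\<Sum>j\<le>CARD('n). p 1 j t * y ^ j) = (\<Sum>j\<le>CARD('n). (if j = 0 then 0 else - a j t) * y ^ j)" .
  qed (use j in simp_all)
  then show ?thesis using j by (simp add: a_u)
qed

lemma partial_eq_D: "t \<in> U \<Longrightarrow> k \<in> {1..CARD('n)} \<Longrightarrow> partial (e k) f t = D k f t"
  by (simp add: D_def pd_def)

lemma has_grad_D:
  assumes "sm f" "t \<in> U"
  shows "has_grad f (\<lambda>i. D (inv_into {1..CARD('n)} e i) f t) t"
proof -
  have "partial i f t = D (inv_into {1..CARD('n)} e i) f t" for i
  proof -
    have i: "i \<in> e ` {1..CARD('n)}" using bij by (simp add: bij_betw_def)
    from partial_eq_D[OF assms(2) inv_into_into[OF i], of f] f_inv_into_f[OF i] show ?thesis by simp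
  qed
  then have "(\<lambda>i. partial i f t) = (\<lambda>i. D (inv_into {1..CARD('n)} e i) f t)" by blast
  with smooth_on_imp_has_grad[OF assms] show ?thesis by simp
qed

lemma K_const:
  assumes "connected U" "x \<noteq> 0" "s \<in> U" "t \<in> U"
  shows "K x s = K x t"
proof (rule has_grad_zero_const[OF open_U assms(1) _ assms(3,4)])
  show "has_grad (K x) (\<lambda>i. 0) r" if "r \<in> U" for r
    using has_grad_D[OF sm_K that, of x] by (simp add: D_K[OF assms(2)])
qed

lemma curve_eq_const:
  assumes "connected U" "s \<in> U" "t \<in> U"
  shows "curve_eq e u s m \<longleftrightarrow> curve_eq e u t m"
  unfolding curve_eq_iff[OF assms(2)] curve_eq_iff[OF assms(3)]
  using K_const[OF assms(1) _ assms(2,3)] by simp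

lemma mu_gen_const:
  assumes "connected U" "s \<in> U" "t \<in> U"
  shows "mu_gen e u s = mu_gen e u t"
proof -
  have "curve_mu e u s = curve_mu e u t"
    unfolding curve_mu_def curve_eq_const[OF assms] ..
  then show ?thesis by (simp add: mu_gen_def fun_eq_iff)
qed

text \<open>On a connected domain \<mu> does not depend on t, so only Q contributes to the
  derivative of P.\<close>

lemma X_Psum:
  assumes "connected U" "t \<in> U" "x \<noteq> 0" "y \<noteq> 0" "z \<noteq> 0" "z \<noteq> x" "z \<noteq> y" "x \<noteq> y"
  shows "X z (Psum x y) t = T z x y t"
proof -
  define c where "c = x\<^sup>2 * y\<^sup>2 / (4 * (x - y)\<^sup>2)"
  have "Psum x y s = c * (2 * mu_gen e u t x y - Q x y s)" if "s \<in> U" for s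
    using P_gen_eq_Psum[OF that assms(3,4,8)] P_gen_eq_Q[OF that, of x y] mu_gen_const[OF assms(1) that assms(2)]
    by (simp add: c_def)
  then have "D k (Psum x y) = D k (\<lambda>s. c * (2 * mu_gen e u t x y - Q x y s))" for k
    by (rule D_cong)
  then have "X z (Psum x y) t = X z (\<lambda>s. c * (2 * mu_gen e u t x y - Q x y s)) t"
    by (simp only: X_def)
  also have "\<dots> = - c * X z (Q x y) t" by simp
  finally show ?thesis using X_P[OF assms(3-8)] by (simp add: c_def)
qed

lemma X_Psum_expand:
  "X z (Psum x y) t = (\<Sum>k\<le>CARD('n). (\<Sum>i\<le>CARD('n). (\<Sum>j\<le>CARD('n). D k (p i j) t * y ^ j) * x ^ i) * z ^ k)"
  unfolding X_def Psum_def[abs_def] by (simp add: sm_p mult.commute)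

text \<open>Both sides are coefficients of z^k x^i y^j, in \<open>X z (Psum x y)\<close> and
  \<open>X x (Psum z y)\<close> respectively, and these agree by \<open>T_swap\<close>.\<close>

lemma D_p_sym:
  assumes "connected U"
  shows "D k (p i j) = D i (p k j)"
proof
  fix t
  show "D k (p i j) t = D i (p k j) t"
  proof (cases "t \<in> U \<and> k \<le> CARD('n) \<and> i \<le> CARD('n) \<and> j \<le> CARD('n)")
    case True
    have "D k (p i j) t - D i (p k j) t = 0"
    proof (rule coeff3_zero[where F="{0}" and M="CARD('n)" and c="\<lambda>k i j. D k (p i j) t - D i (p k j) t"])
      fix x y z :: 'k assume h: "x \<notin> {0}" "y \<notin> {0}" "z \<notin> {0}" "x \<noteq> y" "z \<noteq> x" "z \<noteq> y"
      define S where "S k i = (\<Sum>j\<le>CARD('n). D i (p k j) t * y ^ j)" for k i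
      have "X z (Psum x y) t = X x (Psum z y) t"
        using X_Psum[OF assms, of t x y z] X_Psum[OF assms, of t z y x] T_swap[of z x y t] h True by auto
      also have "\<dots> = (\<Sum>i\<le>CARD('n). \<Sum>k\<le>CARD('n). S k i * z ^ k * x ^ i)"
        unfolding X_Psum_expand S_def[symmetric] by (simp only: sum_distrib_right)
      also have "\<dots> = (\<Sum>k\<le>CARD('n). \<Sum>i\<le>CARD('n). S k i * z ^ k * x ^ i)"
        by (rule sum.swap)
      also have "\<dots> = (\<Sum>k\<le>CARD('n). (\<Sum>i\<le>CARD('n). S k i * x ^ i) * z ^ k)"
        by (simp only: sum_distrib_right sum_distrib_left mult_ac)
      finally show "(\<Sum>k\<le>CARD('n). (\<Sum>i\<le>CARD('n). (\<Sum>j\<le>CARD('n). (D k (p i j) t - D i (p k j) t) * y ^ j) * x ^ i) * z ^ k) = 0"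
        unfolding X_Psum_expand S_def by (simp add: left_diff_distrib sum_subtractf)
    qed (use True in simp_all)
    then show ?thesis by simp
  next
    case False
    have z: "p i j = (\<lambda>t. 0)" if "CARD('n) < i \<or> CARD('n) < j" for i j
      using that by (auto simp: p_def)
    from False have "t \<notin> U \<or> CARD('n) < k \<or> CARD('n) < i \<or> CARD('n) < j" by (simp add: not_le)
    then show ?thesis
      by (elim disjE) (simp_all add: D_out D_outside z)
  qed
qed

section \<open>The commuting operators\<close>

text \<open>The Lenard-type recursion hidden in the third order equation, read off after
  multiplication by \<open>x\<close>, hence the shifted index in \<open>c\<close>.\<close>

lemma a_third:
  assumes "i \<le> CARD('n)"
  shows "D 1 (D 1 (D 1 (a i))) t = 4 * D 1 (a (Suc i)) t + 4 * (u 1 t * D 1 (a i) t) + 2 * (D 1 (u 1) t * a i t)"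
proof -
  define c where "c m = (if m = 0 then 0 else D 1 (D 1 (D 1 (a (m - 1)))) t
      - 4 * (u 1 t * D 1 (a (m - 1)) t) - 2 * (D 1 (u 1) t * a (m - 1) t))" for m
  define d where "d m = 4 * D 1 (a m) t" for m
  have "c (Suc i) = d (Suc i)"
  proof (rule coeff_eq[where F="{0}" and N="Suc CARD('n)"])
    fix x :: 'k assume "x \<notin> {0}"
    then have x: "x \<noteq> 0" by simp
    have "(\<Sum>m\<le>Suc CARD('n). c m * x ^ m) = (\<Sum>m\<le>CARD('n). c (Suc m) * x ^ Suc m)"
      by (subst sum.atMost_Suc_shift) (simp add: c_def)
    also have "\<dots> = x * (D 1 (D 1 (D 1 (A x))) t - 4 * (u 1 t * D 1 (A x) t) - 2 * (D 1 (u 1) t * A x t))"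
      unfolding D_A A_def c_def
      by (simp add: sum_distrib_left sum_subtractf left_diff_distrib right_diff_distrib mult_ac)
    also have "\<dots> = 4 * D 1 (A x) t"
      using fun_cong[OF A_third[OF x], of t] x by (simp add: field_simps)
    also have "\<dots> = (\<Sum>m\<le>Suc CARD('n). d m * x ^ m)"
      by (simp add: D_A d_def a_big sum_distrib_left mult_ac)
    finally show "(\<Sum>m\<le>Suc CARD('n). c m * x ^ m) = (\<Sum>m\<le>Suc CARD('n). d m * x ^ m)" .
  qed (use assms in simp_all)
  then show ?thesis by (simp add: c_def d_def algebra_simps)
qed

definition Lo :: "('k ^ 'n \<Rightarrow> 'k) \<Rightarrow> 'k ^ 'n \<Rightarrow> 'k" where
  "Lo f = (\<lambda>t. D 1 (D 1 f) t - u 1 t * f t)"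

definition No :: "nat \<Rightarrow> ('k ^ 'n \<Rightarrow> 'k) \<Rightarrow> 'k ^ 'n \<Rightarrow> 'k" where
  "No i f = (\<lambda>t. D (Suc i) f t + 1 / 4 * (D 1 (a i) t * f t) - 1 / 2 * (a i t * D 1 f t))"

lemma sm_Lo [simp]: "sm f \<Longrightarrow> sm (Lo f)"
  by (simp add: Lo_def)

lemma sm_No [simp]: "sm f \<Longrightarrow> sm (No i f)"
  by (simp add: No_def)

lemma D_i_u1: "D i (u 1) = (\<lambda>t. - D 1 (a i) t)"
  using D_u1[of i] D_a_sym[of i 1] by simp

text \<open>The third derivative of \<open>a i\<close> is traded by \<open>a_third\<close> for the
  x-derivative of \<open>a (Suc i)\<close>, which cancels the derivative of \<open>u 1\<close> along
  Suc i.\<close>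

lemma Lo_No:
  assumes "sm f" "i \<le> CARD('n)"
  shows "Lo (No i f) t = No i (Lo f) t - D 1 (a i) t * Lo f t"
proof -
  note c = D_commute[of _ "Suc i" 1]
  have e: "D 1 (u 1) t = - D 1 (a 1) t" using D_u1 by simp
  show ?thesis
    using a_third[OF assms(2), of t] assms(1) D_i_u1[of "Suc i"] unfolding Lo_def No_def e
    by (simp add: c D_u1) (simp add: field_simps)
qed

lemma Lo_D:
  assumes "sm f"
  shows "Lo (D i f) = (\<lambda>t. D i (Lo f) t - D 1 (a i) t * f t)"
proof
  fix t
  note c = D_commute[of _ i 1]
  show "Lo (D i f) t = D i (Lo f) t - D 1 (a i) t * f t"
    using assms unfolding Lo_def by (simp add: c D_i_u1 algebra_simps)
qed

lemma D_No:
  assumes "sm f"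
  shows "D k (No i f) t = No i (D k f) t + 1 / 4 * (D k (D 1 (a i)) t * f t) - 1 / 2 * (D k (a i) t * D 1 f t)"
  using assms D_commute[OF assms, of k "Suc i"] D_commute[OF assms, of k 1]
  unfolding No_def by (simp add: field_simps)

text \<open>The bracket of the two first-order operators vanishes by the relation for
  \<open>D (Suc i) (a j) - D (Suc j) (a i)\<close>, which follows from \<open>D_a_Suc\<close> and
  \<open>D_a_sym\<close>, and by its x-derivative.\<close>

lemma No_No:
  assumes "sm f"
  shows "No i (No j f) t = No j (No i f) t"
proof -
  have 1: "D (Suc i) (a j) = (\<lambda>t. D (Suc j) (a i) t + 1 / 2 * (a i t * D 1 (a j) t - D 1 (a i) t * a j t))"
  proof
    fix t show "D (Suc i) (a j) t = D (Suc j) (a i) t + 1 / 2 * (a i t * D 1 (a j) t - D 1 (a i) t * a j t)"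
      using D_a_Suc[of i j t] fun_cong[OF D_a_sym[of i "Suc j"], of t] by (simp add: field_simps)
  qed
  have 2: "D (Suc i) (D 1 (a j)) t = D (Suc j) (D 1 (a i)) t + 1 / 2 * (a i t * D 1 (D 1 (a j)) t - D 1 (D 1 (a i)) t * a j t)"
    unfolding D_commute[OF sm_a, of "Suc i" 1] D_commute[OF sm_a, of "Suc j" 1] 1
    by (simp add: field_simps)
  note c = D_commute[OF assms, of "Suc i" "Suc j"] D_commute[OF assms, of "Suc i" 1] D_commute[OF assms, of "Suc j" 1]
  show ?thesis
    using assms unfolding No_def
    by (simp add: c) (simp add: 2 fun_cong[OF 1, of t], simp add: field_simps)
qed

text \<open>\<open>\<U>\<^sub>i = \<partial>\<^sub>i \<L> - N\<^sub>i\<close> with first-order operators \<open>N\<^sub>i\<close> that commute pairwise, whereas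
  \<open>[\<L>, N\<^sub>i] = u\<^sub>i' \<L>\<close> and \<open>[\<L>, \<partial>\<^sub>i] = u\<^sub>i'\<close>.\<close>

definition Uo :: "nat \<Rightarrow> ('k ^ 'n \<Rightarrow> 'k) \<Rightarrow> 'k ^ 'n \<Rightarrow> 'k" where
  "Uo i f = (\<lambda>t. D i (Lo f) t - No i f t)"

lemma Lo_diff: "sm f \<Longrightarrow> sm g \<Longrightarrow> Lo (\<lambda>t. f t - g t) = (\<lambda>t. Lo f t - Lo g t)"
  by (simp add: Lo_def algebra_simps)

lemma No_diff: "sm f \<Longrightarrow> sm g \<Longrightarrow> No i (\<lambda>t. f t - g t) = (\<lambda>t. No i f t - No i g t)"
  by (simp add: No_def algebra_simps)

lemma Lo_Uo:
  assumes "sm f" "i \<le> CARD('n)"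
  shows "Lo (Uo i f) t = Uo i (Lo f) t"
proof -
  have "Lo (Uo i f) t = Lo (D i (Lo f)) t - Lo (No i f) t"
    unfolding Uo_def using assms by (simp add: Lo_diff)
  then show ?thesis
    using assms by (simp add: Lo_D Lo_No Uo_def)
qed

lemma Uo_Uo:
  assumes "sm f" "i \<le> CARD('n)" "j \<le> CARD('n)"
  shows "Uo i (Uo j f) t = Uo j (Uo i f) t"
proof -
  \<comment> \<open>In this normal form the terms with the factor \<open>D 1 (a j)\<close> coming
    from moving \<open>Lo\<close> past \<open>D j\<close> and past \<open>No j\<close> have
    cancelled. What remains is symmetric in \<open>i\<close> and \<open>j\<close> once
    \<open>D_a_sym\<close> and \<open>No_No\<close> are applied.\<close>
  have *: "Uo i (Uo j f) t = D i (D j (Lo (Lo f))) t - No j (D i (Lo f)) t - No i (D j (Lo f)) t + No i (No j f) t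
      - 1 / 4 * (D i (D 1 (a j)) t * Lo f t) + 1 / 2 * (D i (a j) t * D 1 (Lo f) t)"
    if "j \<le> CARD('n)" for i j
  proof -
    define g where "g = Lo f"
    have g: "sm g" using assms by (simp add: g_def)
    have LN: "Lo (No j f) = (\<lambda>t. No j g t - D 1 (a j) t * g t)"
      using Lo_No[OF assms(1) that] by (simp add: g_def fun_eq_iff)
    have "Uo i (Uo j f) t = D i (Lo (\<lambda>t. D j g t - No j f t)) t - No i (\<lambda>t. D j g t - No j f t) t"
      by (simp add: Uo_def g_def)
    also have "\<dots> = D i (\<lambda>t. D j (Lo g) t - D 1 (a j) t * g t - (No j g t - D 1 (a j) t * g t)) t
        - (No i (D j g) t - No i (No j f) t)"
      using assms(1) g by (simp only: Lo_diff No_diff Lo_D LN sm_D sm_No)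
    also have "(\<lambda>t. D j (Lo g) t - D 1 (a j) t * g t - (No j g t - D 1 (a j) t * g t)) = (\<lambda>t. D j (Lo g) t - No j g t)"
      by simp
    also have "D i (\<lambda>t. D j (Lo g) t - No j g t) t = D i (D j (Lo g)) t - D i (No j g) t"
      using g by simp
    finally show ?thesis
      using D_No[OF g, of i j t] by (simp add: g_def)
  qed
  show ?thesis
    unfolding *[OF assms(3)] *[OF assms(2)] No_No[OF assms(1), of i j]
      D_commute[OF sm_Lo[OF sm_Lo[OF assms(1)]], of i j] D_a_sym[of i j]
      D_commute[OF sm_a, of i 1] D_commute[OF sm_a, of j 1]
    by (simp add: algebra_simps)
qed

end

section \<open>Integration and uniqueness\<close>

lemma smooth_onI:
  assumes "field_differentiable_on f S" "\<And>i. smooth_on (partial i f) S"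
  shows "smooth_on f S"
  unfolding smooth_on_def
proof
  fix js
  show "field_differentiable_on (foldr partial js f) S"
  proof (cases js rule: rev_cases)
    case Nil
    then show ?thesis using assms(1) by simp
  next
    case (snoc ks k)
    have "field_differentiable_on (foldr partial ks (partial k f)) S"
      using assms(2)[of k] unfolding smooth_on_def by (rule spec)
    then show ?thesis by (simp add: snoc)
  qed
qed

section \<open>Passage to the actual operators and construction of w\<close>

context kdv begin

lemma pd_D: "t \<in> U \<Longrightarrow> (\<And>s. s \<in> U \<Longrightarrow> f s = h s) \<Longrightarrow> pd e k f t = D k h t"
  using fun_cong[OF D_cong[of f h k], of t] by (simp add: D_def)

lemma L_op_eq:
  assumes "\<And>s. s \<in> U \<Longrightarrow> v 1 s = u 1 s" "\<And>s. s \<in> U \<Longrightarrow> f s = f' s" "t \<in> U"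
  shows "L_op e v f t = Lo f' t"
proof -
  have "pd e 1 (pd e 1 f) t = D 1 (D 1 f') t"
    by (intro pd_D assms(2,3))
  then show ?thesis using assms by (simp add: L_op_def Lo_def)
qed

text \<open>After the product rule both sides carry the zeroth-order term -3/4 u_i' f, because the
  derivative of \<open>u 1\<close> along \<open>i\<close> is u_i'.\<close>

lemma U_op_eq:
  assumes v: "\<And>k s. k \<in> {1..CARD('n)} \<Longrightarrow> s \<in> U \<Longrightarrow> v k s = u k s"
    and f: "\<And>s. s \<in> U \<Longrightarrow> f s = f' s" "sm f'" and t: "t \<in> U" and i: "i \<in> {1..CARD('n)}"
  shows "U_op e v i f t = Uo i f' t"
proof -
  have v1: "v 1 s = u 1 s" if "s \<in> U" for s using v[of 1] that N_pos by simp
  have vi: "v i s = - a i s" if "s \<in> U" for s using v[OF i that] a_u[OF i] by simp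
  have 1: "pd e 1 (pd e 1 (pd e i f)) t = D 1 (D 1 (D i f')) t"
    by (intro pd_D f(1) t)
  have 2: "pd e i (\<lambda>s. v 1 s * f s) t = D i (\<lambda>s. u 1 s * f' s) t"
    by (rule pd_D[OF t]) (simp add: v1 f(1))
  have 3: "pd e 1 (\<lambda>s. v i s * f s) t = D 1 (\<lambda>s. - a i s * f' s) t"
    by (rule pd_D[OF t]) (simp add: vi f(1))
  have 4: "pd e k f t = D k f' t" for k
    by (rule pd_D[OF t f(1)])
  note c = D_commute[OF f(2), of i 1] D_commute[OF sm_D[OF f(2)], of i 1 1]
  show ?thesis
    unfolding U_op_def 1 2 3 4 v1[OF t] vi[OF t] Uo_def Lo_def No_def
    using f(2) by (simp add: c D_i_u1 Suc_eq_plus1[symmetric]) (simp add: field_simps)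
qed

lemma commute_L_U:
  assumes v: "\<And>k s. k \<in> {1..CARD('n)} \<Longrightarrow> s \<in> U \<Longrightarrow> v k s = u k s" and i: "i \<in> {1..CARD('n)}"
  shows "commute_on U (L_op e v) (U_op e v i)"
  unfolding commute_on_def
proof (intro allI impI ballI)
  fix f t assume f: "sm f" and t: "t \<in> U"
  have v1: "v 1 s = u 1 s" if "s \<in> U" for s using v[of 1] that N_pos by simp
  have Uf: "U_op e v i f s = Uo i f s" if "s \<in> U" for s
    by (rule U_op_eq) (use v f i that in simp_all)
  have Lf: "L_op e v f s = Lo f s" if "s \<in> U" for s
    by (rule L_op_eq) (use v1 that in simp_all)
  have "L_op e v (U_op e v i f) t = Lo (Uo i f) t"
    by (rule L_op_eq) (use v1 Uf t in simp_all)
  also have "\<dots> = Uo i (Lo f) t" using Lo_Uo[OF f] i by simp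
  also have "\<dots> = U_op e v i (L_op e v f) t"
    by (rule U_op_eq[symmetric]) (use v Lf f t i in simp_all)
  finally show "L_op e v (U_op e v i f) t = U_op e v i (L_op e v f) t" .
qed

lemma sm_Uo: "sm f \<Longrightarrow> sm (Uo i f)"
  unfolding Uo_def by simp

lemma commute_U_U:
  assumes v: "\<And>k s. k \<in> {1..CARD('n)} \<Longrightarrow> s \<in> U \<Longrightarrow> v k s = u k s"
    and i: "i \<in> {1..CARD('n)}" and j: "j \<in> {1..CARD('n)}"
  shows "commute_on U (U_op e v i) (U_op e v j)"
  unfolding commute_on_def
proof (intro allI impI ballI)
  fix f t assume f: "sm f" and t: "t \<in> U"
  have "U_op e v i (U_op e v j f) t = Uo i (Uo j f) t" if "i \<in> {1..CARD('n)}" "j \<in> {1..CARD('n)}" for i j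
  proof -
    have Uf: "U_op e v j f s = Uo j f s" if "s \<in> U" for s
      by (rule U_op_eq) (use v f \<open>j \<in> _\<close> that in simp_all)
    show ?thesis
      by (rule U_op_eq) (use v Uf sm_Uo[OF f] t that in simp_all)
  qed
  then show "U_op e v i (U_op e v j f) t = U_op e v j (U_op e v i f) t"
    using i j Uo_Uo[OF f] by simp
qed

lemma curve_eq_cong:
  assumes v: "\<And>k s. k \<in> {1..CARD('n)} \<Longrightarrow> s \<in> U \<Longrightarrow> v k s = u k s" and t: "t \<in> U"
  shows "curve_eq e v t m \<longleftrightarrow> curve_eq e u t m"
proof -
  have 1: "dx e v k s = dx e u k s" if "k \<in> {1..CARD('n)}" "s \<in> U" for k s
    unfolding dx_def using pd_D[of s "v k" "u k" 1] pd_D[of s "u k" "u k" 1] v that by simp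
  have 2: "dx e (dx e v) k s = dx e (dx e u) k s" if "k \<in> {1..CARD('n)}" "s \<in> U" for k s
    unfolding dx_def[of e "dx e _"]
    using pd_D[of s "dx e v k" "dx e u k" 1] pd_D[of s "dx e u k" "dx e u k" 1] 1 that by simp
  have g: "gen v t = gen u t" "gen (dx e v) t = gen (dx e u) t" "gen (dx e (dx e v)) t = gen (dx e (dx e u)) t"
    unfolding gen_def using v 1 2 t by (auto intro!: sum.cong)
  have "v 1 t = u 1 t" using v t N_pos by simp
  then show ?thesis unfolding curve_eq_def g by simp
qed

definition ei :: "'n \<Rightarrow> nat" where
  "ei = inv_into {1..CARD('n)} e"

lemma ei: "ei i \<in> {1..CARD('n)}" "e (ei i) = i"
proof -
  have i: "i \<in> e ` {1..CARD('n)}" using bij by (simp add: bij_betw_def)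
  show "ei i \<in> {1..CARD('n)}" "e (ei i) = i"
    using inv_into_into[OF i] f_inv_into_f[OF i] by (simp_all add: ei_def)
qed

lemma ei_e: "k \<in> {1..CARD('n)} \<Longrightarrow> ei (e k) = k"
  using bij by (simp add: ei_def bij_betw_def inv_into_f_f)

lemma partial_ei: "t \<in> U \<Longrightarrow> partial i f t = D (ei i) f t"
  using partial_eq_D[OF _ ei(1)[of i], of t f] ei(2)[of i] by simp

text \<open>Smoothness of the primitive is automatic: its partial derivatives are the given smooth
  coefficients.\<close>

lemma smooth_primitive:
  assumes "simply_connected U" "0 \<in> U" and c: "\<And>k. sm (c k)"
    and closed: "\<And>k l t. k \<in> {1..CARD('n)} \<Longrightarrow> l \<in> {1..CARD('n)} \<Longrightarrow> t \<in> U \<Longrightarrow> D k (c l) t = D l (c k) t"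
  obtains F where "sm F" "F 0 = 0" "\<And>t. t \<in> U \<Longrightarrow> has_grad F (\<lambda>i. c (ei i) t) t"
    "\<And>k t. k \<in> {1..CARD('n)} \<Longrightarrow> t \<in> U \<Longrightarrow> D k F t = c k t"
proof -
  have "partial j (c (ei i)) t = partial i (c (ei j)) t" if "t \<in> U" for i j t
    unfolding partial_ei[OF that] using closed[OF ei(1) ei(1) that] .
  then obtain G where G: "\<forall>t\<in>U. has_grad G (\<lambda>i. c (ei i) t) t"
    using closed_form_primitive[OF open_U assms(1), of "\<lambda>i. c (ei i)"] c by blast
  define F where "F t = G t + - G 0" for t
  have F: "has_grad F (\<lambda>i. c (ei i) t) t" if "t \<in> U" for t
    using has_grad_add[OF G[rule_format, OF that] has_grad_const[of "- G 0" t]] by (simp add: F_def[abs_def])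
  have P: "partial i F t = c (ei i) t" if "t \<in> U" for i t
    by (rule has_grad_partial[OF F[OF that]])
  have "sm F"
  proof (rule smooth_onI)
    show "field_differentiable_on F U"
      unfolding field_differentiable_on_iff using F P by simp
    show "sm (partial i F)" for i
      by (rule sm_cong[OF c[of "ei i"]]) (simp add: P)
  qed
  moreover have "D k F t = c k t" if "k \<in> {1..CARD('n)}" "t \<in> U" for k t
    using P[OF that(2), of "e k"] partial_eq_D[OF that(2,1), of F] ei_e[OF that(1)] by simp
  ultimately show ?thesis using that F by (simp add: F_def)
qed

lemma pd_eq_grad:
  assumes "has_grad f c t" "k \<in> {1..CARD('n)}"
  shows "pd e k f t = c (e k)"
  using has_grad_partial[OF assms(1), of "e k"] assms(2) by (simp add: pd_def)

theorem tau_exists_unique: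
  assumes sc: "simply_connected U" and U0: "0 \<in> U"
  shows "\<exists>w.
    (w_solution e (u 1) U w \<and> special e U w \<and>
     (\<forall>t\<in>U. \<forall>i\<in>{1..CARD('n)}. \<forall>j\<in>{1..CARD('n)}.
        2 * pd e i (pd_log e j w) t = - p_coeff e u t i j)) \<and>
    (\<forall>V w'. open V \<and> connected V \<and> 0 \<in> V \<and> V \<subseteq> U \<and>
       w_solution e (u 1) V w' \<and> special e V w' \<and>
       (\<forall>t\<in>V. \<forall>i\<in>{1..CARD('n)}. \<forall>j\<in>{1..CARD('n)}.
          2 * pd e i (pd_log e j w') t = - p_coeff e u t i j)
       \<longrightarrow> (\<forall>t\<in>V. w' t = w t))"
proof -
  have conn: "connected U" using sc by (rule simply_connected_imp_connected)
  \<comment> \<open>The primitive for index \<open>j\<close> is the future \<partial>_j log w: the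
    factor - 1/2 comes from the required second derivatives, the value 0 at the origin from the
    initial condition on \<partial>_j w.\<close>
  have "\<exists>F. sm F \<and> F 0 = 0 \<and> (\<forall>t\<in>U. has_grad F (\<lambda>i. - p (ei i) j t / 2) t)
      \<and> (\<forall>k\<in>{1..CARD('n)}. \<forall>t\<in>U. D k F t = - p k j t / 2)" for j
  proof (rule smooth_primitive[OF sc U0, of "\<lambda>k t. - p k j t / 2"])
    show "sm (\<lambda>t. - p k j t / 2)" for k by (simp add: sm_p)
    show "D k (\<lambda>t. - p l j t / 2) t = D l (\<lambda>t. - p k j t / 2) t" for k l t
      using D_p_sym[OF conn, of k l j] by (simp add: sm_p)
  qed blast
  then obtain \<alpha> where \<alpha>: "\<And>j. sm (\<alpha> j)" "\<And>j. \<alpha> j 0 = 0"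
    "\<And>j t. t \<in> U \<Longrightarrow> has_grad (\<alpha> j) (\<lambda>i. - p (ei i) j t / 2) t"
    "\<And>k j t. k \<in> {1..CARD('n)} \<Longrightarrow> t \<in> U \<Longrightarrow> D k (\<alpha> j) t = - p k j t / 2" by metis
  \<comment> \<open>The form built from the \<alpha> j is closed exactly because p is symmetric. The
    value 0 at the origin makes w(0) = 1.\<close>
  obtain \<phi> where \<phi>: "sm \<phi>" "\<phi> 0 = 0" "\<And>t. t \<in> U \<Longrightarrow> has_grad \<phi> (\<lambda>i. \<alpha> (ei i) t) t"
  proof (rule smooth_primitive[OF sc U0, of \<alpha>])
    show "D k (\<alpha> l) t = D l (\<alpha> k) t" if "k \<in> {1..CARD('n)}" "l \<in> {1..CARD('n)}" "t \<in> U" for k l t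
      using \<alpha>(4)[of k t l] \<alpha>(4)[of l t k] p_sym[of k l t] that by simp
  qed (use \<alpha>(1) in blast)+
  define w where "w t = exp (\<phi> t)" for t
  have w_grad: "has_grad w (\<lambda>i. w t * \<alpha> (ei i) t) t" if "t \<in> U" for t
    unfolding w_def[abs_def] by (rule has_grad_chain[OF \<phi>(3)[OF that] DERIV_exp])
  have w_pd: "pd e k w t = w t * \<alpha> k t" if "t \<in> U" "k \<in> {1..CARD('n)}" for k t
    using pd_eq_grad[OF w_grad[OF that(1)] that(2)] ei_e[OF that(2)] by simp
  have w_log: "pd_log e k w t = \<alpha> k t" if "t \<in> U" "k \<in> {1..CARD('n)}" for k t
    using w_pd[OF that] by (simp add: pd_log_def w_def)
  have w_p: "2 * pd e i (pd_log e j w) t = - p i j t"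
    if "t \<in> U" "i \<in> {1..CARD('n)}" "j \<in> {1..CARD('n)}" for i j t
    using pd_D[OF that(1), of "pd_log e j w" "\<alpha> j" i] w_log[OF _ that(3)] \<alpha>(4)[OF that(2,1)] by simp
  have one: "1 \<in> {1..CARD('n)}" using N_pos by simp
  have twice: "twice_differentiable_on w U"
    unfolding twice_differentiable_on_def
  proof
    have P: "partial i w t = w t * \<alpha> (ei i) t" if "t \<in> U" for i t
      by (rule has_grad_partial[OF w_grad[OF that]])
    show "field_differentiable_on w U"
      unfolding field_differentiable_on_iff using w_grad P by simp
    show "\<forall>i. field_differentiable_on (partial i w) U"
    proof
      fix i
      have "field_differentiable_on (\<lambda>t. w t * \<alpha> (ei i) t) U"
        unfolding field_differentiable_on_iff
      proof
        fix t assume t: "t \<in> U"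
        note g = has_grad_mult[OF w_grad[OF t] \<alpha>(3)[OF t, of "ei i"]]
        show "has_grad (\<lambda>t. w t * \<alpha> (ei i) t) (\<lambda>k. partial k (\<lambda>t. w t * \<alpha> (ei i) t) t) t"
          using g unfolding has_grad_partial[OF g] .
      qed
      then show "field_differentiable_on (partial i w) U"
        by (rule field_differentiable_on_cong[OF open_U, rotated]) (simp add: P)
    qed
  qed
  have sol: "w_solution e (u 1) U w"
    unfolding w_solution_def
  proof (intro conjI ballI)
    show "2 * pd e 1 (pd_log e 1 w) t = - u 1 t" if "t \<in> U" for t
      using w_p[OF that one one] p_1[OF one] by simp
    show "pd e k w 0 = 0" if "k \<in> {1..CARD('n)}" for k
      using w_pd[OF U0 that] \<alpha>(2) by simp
  qed (use twice \<phi>(2) in \<open>simp_all add: w_def\<close>)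
  have pot: "w_potential e w k t = u k t" if "k \<in> {1..CARD('n)}" "t \<in> U" for k t
    using w_p[OF that(2) one that(1)] p_1[OF that(1)] by (simp add: w_potential_def)
  have spec: "special e U w"
    unfolding special_def Let_def
  proof (intro conjI ballI exI)
    show "sm (w_potential e w k)" if "k \<in> {1..CARD('n)}" for k
      by (rule sm_cong[OF smooth_u[OF that]]) (simp add: pot[OF that])
    show "commute_on U (L_op e (w_potential e w)) (U_op e (w_potential e w) i)"
      if "i \<in> {1..CARD('n)}" for i
      by (rule commute_L_U[OF pot that])
    show "commute_on U (U_op e (w_potential e w) i) (U_op e (w_potential e w) j)"
      if "i \<in> {1..CARD('n)}" "j \<in> {1..CARD('n)}" for i j
      by (rule commute_U_U[OF pot that])
    \<comment> \<open>The constants of the curve at the origin serve for every t, since the curve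
      equation is the same throughout the connected set \<open>U\<close>.\<close>
    show "curve_eq e (w_potential e w) t (mcurve 0)" if "t \<in> U" for t
      using curve_eq_cong[OF pot that] curve_eq_const[OF conn that U0] curve_eq_mcurve[OF U0] by simp
  qed
  have uniq: "w' t = w t" if "open V" "connected V" "0 \<in> V" "V \<subseteq> U" and sol': "w_solution e (u 1) V w'"
    and p': "\<forall>t\<in>V. \<forall>i\<in>{1..CARD('n)}. \<forall>j\<in>{1..CARD('n)}. 2 * pd e i (pd_log e j w') t = - p_coeff e u t i j"
    and t: "t \<in> V" for V w' t
  proof -
    have VU: "s \<in> U" if "s \<in> V" for s using that \<open>V \<subseteq> U\<close> by blast
    have w'0: "w' 0 = 1" and pd0: "\<And>k. k \<in> {1..CARD('n)} \<Longrightarrow> pd e k w' 0 = 0"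
      and nz: "\<And>s. s \<in> V \<Longrightarrow> w' s \<noteq> 0"
      using sol' unfolding w_solution_def by auto
    have g1: "has_grad w' (\<lambda>i. partial i w' s) s"
      and g2: "has_grad (partial j w') (\<lambda>i. partial i (partial j w') s) s" if "s \<in> V" for s j
      using sol' that unfolding w_solution_def twice_differentiable_on_def field_differentiable_on_iff by auto
    have log: "pd_log e j w' s = \<alpha> j s" if j: "j \<in> {1..CARD('n)}" and s: "s \<in> V" for j s
    proof -
      have l: "pd_log e j w' = (\<lambda>r. partial (e j) w' r * inverse (w' r))"
        using j by (simp add: pd_log_def pd_def fun_eq_iff divide_inverse)
      \<comment> \<open>The prescribed second derivatives give the two logarithmic derivatives the
        same gradient on \<open>V\<close>; both vanish at the origin.\<close>
      have "pd_log e j w' s + - 1 * \<alpha> j s = pd_log e j w' 0 + - 1 * \<alpha> j 0"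
      proof (rule has_grad_zero_const[OF \<open>open V\<close> \<open>connected V\<close> _ s \<open>0 \<in> V\<close>])
        fix r assume r: "r \<in> V"
        obtain c where c: "has_grad (pd_log e j w') c r"
          unfolding l using has_grad_mult[OF g2[OF r, of "e j"] has_grad_chain[OF g1[OF r] DERIV_inverse[OF nz[OF r]]]]
          by blast
        have ci: "c i = - p (ei i) j r / 2" for i
        proof -
          have "2 * pd e (ei i) (pd_log e j w') r = - p (ei i) j r"
            using p' r ei(1)[of i] j p_coeff_eq[OF VU[OF r]] by simp
          moreover have "pd e (ei i) (pd_log e j w') r = c i"
            using pd_eq_grad[OF c ei(1)[of i]] ei(2)[of i] by simp
          ultimately have "2 * c i = - p (ei i) j r" by simp
          from arg_cong[OF this, of "\<lambda>x. x / 2"] show ?thesis by simp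
        qed
        have "has_grad (\<lambda>s. pd_log e j w' s + - 1 * \<alpha> j s)
          (\<lambda>i. c i + (- 1 * (- p (ei i) j r / 2) + 0 * \<alpha> j r)) r"
          by (intro has_grad_add c has_grad_mult[OF has_grad_const \<alpha>(3)[OF VU[OF r]]])
        then show "has_grad (\<lambda>s. pd_log e j w' s + - 1 * \<alpha> j s) (\<lambda>i. 0) r"
          by (simp add: ci)
      qed
      moreover have "pd_log e j w' 0 = 0" using pd0[OF j] by (simp add: pd_log_def)
      ultimately show ?thesis using \<alpha>(2) by simp
    qed
    \<comment> \<open>Equal logarithmic derivatives make the quotient of the two solutions locally
      constant. Multiplying by the exponential of -\<phi> expresses that quotient by a
      product.\<close>
    have "w' t * exp (- 1 * \<phi> t) = w' 0 * exp (- 1 * \<phi> 0)"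
    proof (rule has_grad_zero_const[OF \<open>open V\<close> \<open>connected V\<close> _ t \<open>0 \<in> V\<close>])
      fix r assume r: "r \<in> V"
      have P: "partial i w' r = \<alpha> (ei i) r * w' r" for i
        using log[OF ei(1)[of i] r] nz[OF r] ei[of i] by (simp add: pd_log_def pd_def field_simps)
      have "has_grad (\<lambda>s. - 1 * \<phi> s) (\<lambda>i. - 1 * \<alpha> (ei i) r + 0 * \<phi> r) r"
        by (intro has_grad_mult has_grad_const \<phi>(3) VU r)
      from has_grad_mult[OF g1[OF r] has_grad_chain[OF this DERIV_exp]]
      show "has_grad (\<lambda>s. w' s * exp (- 1 * \<phi> s)) (\<lambda>i. 0) r"
        by (simp add: P)
    qed
    then show ?thesis using w'0 \<phi>(2)
      by (simp add: w_def exp_minus field_simps)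
  qed
  show ?thesis
  proof (intro exI[of _ w] conjI)
    show "w_solution e (u 1) U w" by (rule sol)
    show "special e U w" by (rule spec)
    show "\<forall>t\<in>U. \<forall>i\<in>{1..CARD('n)}. \<forall>j\<in>{1..CARD('n)}. 2 * pd e i (pd_log e j w) t = - p_coeff e u t i j"
      using w_p by (simp add: p_coeff_eq)
    show "\<forall>V w'. open V \<and> connected V \<and> 0 \<in> V \<and> V \<subseteq> U \<and>
       w_solution e (u 1) V w' \<and> special e V w' \<and>
       (\<forall>t\<in>V. \<forall>i\<in>{1..CARD('n)}. \<forall>j\<in>{1..CARD('n)}.
          2 * pd e i (pd_log e j w') t = - p_coeff e u t i j)
       \<longrightarrow> (\<forall>t\<in>V. w' t = w t)"
      using uniq by blast
  qed
qed

end

theorem theorem9p2: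
  fixes e :: "nat \<Rightarrow> 'n::finite"
    and u :: "nat \<Rightarrow> 'k::{real_normed_field, euclidean_space} ^ 'n \<Rightarrow> 'k"
    and U :: "('k ^ 'n) set"
  assumes "bij_betw e {1..CARD('n)} UNIV"
    and "open U" and "0 \<in> U" and "simply_connected U"
    and "\<forall>i\<in>{1..CARD('n)}. smooth_on (u i) U"
    and "kdv_system e u U"
  shows "\<exists>w.
    (w_solution e (u 1) U w \<and> special e U w \<and>
     (\<forall>t\<in>U. \<forall>i\<in>{1..CARD('n)}. \<forall>j\<in>{1..CARD('n)}.
        2 * pd e i (pd_log e j w) t = - p_coeff e u t i j)) \<and>
    (\<forall>V w'. open V \<and> connected V \<and> 0 \<in> V \<and> V \<subseteq> U \<and>
       w_solution e (u 1) V w' \<and> special e V w' \<and>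
       (\<forall>t\<in>V. \<forall>i\<in>{1..CARD('n)}. \<forall>j\<in>{1..CARD('n)}.
          2 * pd e i (pd_log e j w') t = - p_coeff e u t i j)
       \<longrightarrow> (\<forall>t\<in>V. w' t = w t))"
proof -
  interpret kdv e U u
    using assms by unfold_locales auto
  show ?thesis using assms(4,3) by (rule tau_exists_unique)
qed

end
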